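(* Let $Y$ be a compact connected oriented branched matchbox manifold. Then $Y$ has a light simplicial presentation by orientation preserving maps of finite directed nondegenerate graphs; that is, there is a light simplicial inverse sequence $\{X_k,f_k\}$ of finite directed nondegenerate graphs, with every $f_k\colon X_k\to X_{k-1}$ orientation preserving, whose inverse limit $\overline{X}=\{(x_0,x_1,\dots)\in\prod_{k\ge 0}X_k : f_{k+1}(x_{k+1})=x_k\}$ is homeomorphic to $Y$.
   Context: **Branched matchbox manifolds.** A branched matchbox is a space homeomorphic to $U=\bigl((S_1\times(-1,0])\cup(S_2\times[0,1))\bigr)/\sim$, where $S_1,S_2$ are (disjoint) zero-dimensional compact separable metrizable spaces and there is a closed equivalence relation $\approx$ on $S_1\cup S_2$ such that: every element of $S_1$ is $\approx$-equivalent to at least one element of $S_2$ and every element of $S_2$ to at least one element of $S_1$; $(S_1\cup S_2)/{\approx}$ is a zero-dimensional metrizable space in the quotient topology; and $(s,i)\sim(s',j)$ iff either $s\approx s'$ and $i=j=0$, or $s=s'$ and $i=j$. Its projection is $p_U\colon U\to(-1,1)$, $[(z,j)]\mapsto j$. A branched matchbox manifold is a separable metrizable space $Y$ with a collection of charts, i.e. homeomorphisms $h\colon V\to U$ from open subsets $V$ of $Y$ onto branched matchboxes, whose domains cover $Y$ and whose changes of coordinates are continuous. $Y$ is orientable if it is covered by domains of charts $h_i\colon V_i\to U_i$ (with projections $p_i$) such that for all $i,j$ and every locally one-to-one curve $\gamma\colon[0,1]\to V_i\cap V_j$, $p_i\circ h_i\circ\gamma$ is increasing iff $p_j\circ h_j\circ\gamma$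 is increasing; a maximal such collection of charts is an orientation, and $Y$ with a fixed orientation is oriented. **Simplicial maps.** Let $X_1,X_2$ be graphs with vertex sets $\mathcal{V}_i$ and edge sets $\mathcal{E}_i$. A continuous onto map $f\colon X_2\to X_1$ is simplicial relative to $(\mathcal{V}_1,\mathcal{V}_2)$ if $f(\mathcal{V}_2)\subseteq\mathcal{V}_1$ and for every $e_2\in\mathcal{E}_2$ there is $e_1\in\mathcal{E}_1$ such that $f|_{e_2\setminus\mathcal{V}_2}$ is a homeomorphism onto $e_1\setminus\mathcal{V}_1$ or a constant map. $f$ is simplicial if it is simplicial relative to some vertex sets of $X_1$ and $X_2$, and light if the preimage of each point is totally disconnected. An inverse sequence $\{X_k,f_k\}$ of graphs is light simplicial if each $f_k$ is light and simplicial. **Directed graphs.** A directed edge $e$ is parameterized as $e(t)$, $t\in[0,1]$, with initial vertex $e(0)$ and terminal vertex $e(1)$ (possibly equal). A continuous map $p\colon[0,1]\to G$ into a directed graph is orientation preserving if $e^{-1}\circ p\colon I\to[0,1]$ is increasing for every interval $I\subset[0,1]$ such that $p(I)$ is contained in a directed edge $e$. A continuous map $f\colon G_1\to G_2$ of directed graphs is orientation preserving if $f\circ p$ is orientation preserving for every orientation preserving $p\colon[0,1]\to G_1$. A directed graph is nondegenerate if every vertex has at least one incoming edge and at least one outgoing edge. *)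

theory Defs
  imports "HOL-Analysis.Analysis"
begin

section \<open>Quotient topologies\<close>

definition quotient_topology :: "'a topology \<Rightarrow> ('a \<times> 'a) set \<Rightarrow> 'a set topology" where
  "quotient_topology X r =
     topology (\<lambda>W. W \<subseteq> topspace X // r \<and> openin X {x \<in> topspace X. r `` {x} \<in> W})"

lemma istopology_quotient:
  "istopology (\<lambda>W. W \<subseteq> topspace X // r \<and> openin X {x \<in> topspace X. r `` {x} \<in> W})"
proof -
  have 1: "{x \<in> topspace X. r `` {x} \<in> S \<inter> T} =
      {x \<in> topspace X. r `` {x} \<in> S} \<inter> {x \<in> topspace X. r `` {x} \<in> T}" for S T
    by auto
  have 2: "{x \<in> topspace X. r `` {x} \<in> \<Union>K} = (\<Union>S\<in>K. {x \<in> topspace X. r `` {x} \<in> S})" for K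
    by auto
  show ?thesis
    unfolding istopology_def 1 2 by blast
qed

lemma openin_quotient_topology:
  "openin (quotient_topology X r) W \<longleftrightarrow>
     W \<subseteq> topspace X // r \<and> openin X {x \<in> topspace X. r `` {x} \<in> W}"
  by (simp add: quotient_topology_def istopology_quotient)

lemma topspace_quotient_topology [simp]:
  "topspace (quotient_topology X r) = topspace X // r"
proof -
  have "{x \<in> topspace X. r `` {x} \<in> topspace X // r} = topspace X"
    by (auto intro: quotientI)
  then have "openin (quotient_topology X r) (topspace X // r)"
    by (simp add: openin_quotient_topology)
  then show ?thesis
    by (metis openin_subset openin_topspace openin_quotient_topology subset_antisym)
qed

lemma quotient_map_quotient_topology:
  "quotient_map X (quotient_topology X r) (\<lambda>x. r `` {x})"
  by (auto simp: quotient_map_def openin_quotient_topology quotient_def)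


section \<open>Branched matchboxes\<close>

text \<open>The disjoint union of \<open>S1\<close> (tag \<open>False\<close>) and \<open>S2\<close> (tag \<open>True\<close>).\<close>

definition ends :: "'s topology \<Rightarrow> 's topology \<Rightarrow> (bool \<times> 's) topology" where
  "ends S1 S2 = sum_topology (\<lambda>b. if b then S2 else S1) UNIV"

text \<open>As usual for dimension at most zero, \<open>dim_le 0\<close> also admits the empty space.
  This only adds charts with empty domain.\<close>

definition branching_data ::
    "'s topology \<Rightarrow> 's topology \<Rightarrow> ((bool \<times> 's) \<times> (bool \<times> 's)) set \<Rightarrow> bool" where
  "branching_data S1 S2 R \<longleftrightarrow>
     S1 dim_le 0 \<and> compact_space S1 \<and> separable_space S1 \<and> metrizable_space S1 \<and>
     S2 dim_le 0 \<and> compact_space S2 \<and> separable_space S2 \<and> metrizable_space S2 \<and>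
     equiv (topspace (ends S1 S2)) R \<and>
     closedin (prod_topology (ends S1 S2) (ends S1 S2)) R \<and>
     (\<forall>s \<in> topspace S1. \<exists>t \<in> topspace S2. ((False, s), (True, t)) \<in> R) \<and>
     (\<forall>t \<in> topspace S2. \<exists>s \<in> topspace S1. ((True, t), (False, s)) \<in> R) \<and>
     quotient_topology (ends S1 S2) R dim_le 0 \<and>
     metrizable_space (quotient_topology (ends S1 S2) R)"

definition prematchbox :: "'s topology \<Rightarrow> 's topology \<Rightarrow> ((bool \<times> 's) \<times> real) topology" where
  "prematchbox S1 S2 =
     subtopology (prod_topology (ends S1 S2) euclideanreal)
       {((b, s), t). if b then t \<in> {0..<1} else t \<in> {-1<..0}}"

definition matchbox_rel ::
    "'s topology \<Rightarrow> 's topology \<Rightarrow> ((bool \<times> 's) \<times> (bool \<times> 's)) set \<Rightarrow>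
     (((bool \<times> 's) \<times> real) \<times> ((bool \<times> 's) \<times> real)) set" where
  "matchbox_rel S1 S2 R =
     {((z, i), (w, j)).
        (z, i) \<in> topspace (prematchbox S1 S2) \<and> (w, j) \<in> topspace (prematchbox S1 S2) \<and>
        ((z, w) \<in> R \<and> i = 0 \<and> j = 0 \<or> z = w \<and> i = j)}"

definition matchbox ::
    "'s topology \<Rightarrow> 's topology \<Rightarrow> ((bool \<times> 's) \<times> (bool \<times> 's)) set \<Rightarrow>
     ((bool \<times> 's) \<times> real) set topology" where
  "matchbox S1 S2 R = quotient_topology (prematchbox S1 S2) (matchbox_rel S1 S2 R)"

definition matchbox_proj :: "((bool \<times> 's) \<times> real) set \<Rightarrow> real" where
  "matchbox_proj c = the_elem (snd ` c)"

lemma equiv_matchbox_rel: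
  assumes "branching_data S1 S2 R"
  shows "equiv (topspace (prematchbox S1 S2)) (matchbox_rel S1 S2 R)"
proof -
  have R: "equiv (topspace (ends S1 S2)) R"
    using assms by (simp add: branching_data_def)
  show ?thesis
  proof (rule equivI)
    show "matchbox_rel S1 S2 R \<subseteq> topspace (prematchbox S1 S2) \<times> topspace (prematchbox S1 S2)"
      by (auto simp: matchbox_rel_def)
    show "refl_on (topspace (prematchbox S1 S2)) (matchbox_rel S1 S2 R)"
      by (auto simp: refl_on_def matchbox_rel_def)
    show "sym (matchbox_rel S1 S2 R)"
      using R unfolding equiv_def sym_def matchbox_rel_def by blast
    show "trans (matchbox_rel S1 S2 R)"
      using R unfolding equiv_def trans_def matchbox_rel_def by blast
  qed
qed

lemma matchbox_proj_class:
  assumes "(z, t) \<in> topspace (prematchbox S1 S2)"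
  shows "matchbox_proj (matchbox_rel S1 S2 R `` {(z, t)}) = t"
proof -
  have "(z, t) \<in> matchbox_rel S1 S2 R `` {(z, t)}"
    using assms by (simp add: matchbox_rel_def)
  moreover have "snd y = t" if "y \<in> matchbox_rel S1 S2 R `` {(z, t)}" for y
    using that by (auto simp: matchbox_rel_def)
  ultimately have "snd ` (matchbox_rel S1 S2 R `` {(z, t)}) = {t}"
    by (metis (no_types, lifting) equals0D image_is_empty snd_conv image_cong image_constant)
  then show ?thesis
    by (simp add: matchbox_proj_def)
qed


section \<open>Branched matchbox manifolds and orientations\<close>

text \<open>A chart carries the data of its branched matchbox, since the projection of the
  matchbox depends on them.  Charts onto spaces merely homeomorphic to a \<open>matchbox\<close> are
  covered by composing with the homeomorphism.  The matchboxes of all charts are built over one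
  type \<open>'s\<close>; this is no restriction, because \<open>S1\<close> and \<open>S2\<close> embed into the domain of the chart,
  so that already \<open>'s = 'a\<close> suffices.\<close>

record ('a, 's) chart =
  chart_dom :: "'a set"
  chart_left :: "'s topology"
  chart_right :: "'s topology"
  chart_rel :: "((bool \<times> 's) \<times> (bool \<times> 's)) set"
  chart_map :: "'a \<Rightarrow> ((bool \<times> 's) \<times> real) set"

definition chart_box :: "('a, 's) chart \<Rightarrow> ((bool \<times> 's) \<times> real) set topology" where
  "chart_box c = matchbox (chart_left c) (chart_right c) (chart_rel c)"

definition chart_on :: "'a topology \<Rightarrow> ('a, 's) chart \<Rightarrow> bool" where
  "chart_on Y c \<longleftrightarrow>
     openin Y (chart_dom c) \<and>
     branching_data (chart_left c) (chart_right c) (chart_rel c) \<and>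
     homeomorphic_map (subtopology Y (chart_dom c)) (chart_box c) (chart_map c)"

definition covers :: "('a, 's) chart set \<Rightarrow> 'a topology \<Rightarrow> bool" where
  "covers A Y \<longleftrightarrow> (\<Union>c\<in>A. chart_dom c) = topspace Y"

definition branched_matchbox_manifold :: "'a topology \<Rightarrow> ('a, 's) chart set \<Rightarrow> bool" where
  "branched_matchbox_manifold Y A \<longleftrightarrow>
     separable_space Y \<and> metrizable_space Y \<and>
     (\<forall>c\<in>A. chart_on Y c) \<and> covers A Y \<and>
     (\<forall>c\<in>A. \<forall>d\<in>A.
        continuous_map
          (subtopology (chart_box c) (chart_map c ` (chart_dom c \<inter> chart_dom d)))
          (chart_box d)
          (chart_map d \<circ> the_inv_into (chart_dom c) (chart_map c)))"

definition locally_one_to_one :: "(real \<Rightarrow> 'a) \<Rightarrow> bool" where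
  "locally_one_to_one \<gamma> \<longleftrightarrow> (\<forall>t\<in>{0..1}. \<exists>\<epsilon>>0. inj_on \<gamma> ({0..1} \<inter> ball t \<epsilon>))"

text \<open>Here ``increasing'' may be read weakly or strictly: fibres of the projection of a matchbox
  are totally disconnected, so a locally one-to-one curve along which the projection is
  nondecreasing has strictly increasing projection.\<close>

definition same_direction :: "'a topology \<Rightarrow> ('a, 's) chart \<Rightarrow> ('a, 's) chart \<Rightarrow> bool" where
  "same_direction Y c d \<longleftrightarrow>
     (\<forall>\<gamma>. continuous_map (top_of_set {0..1}) (subtopology Y (chart_dom c \<inter> chart_dom d)) \<gamma> \<and>
          locally_one_to_one \<gamma> \<longrightarrow>
          (mono_on {0..1} (matchbox_proj \<circ> chart_map c \<circ> \<gamma>) \<longleftrightarrow>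
           mono_on {0..1} (matchbox_proj \<circ> chart_map d \<circ> \<gamma>)))"

definition oriented_cover ::
    "'a topology \<Rightarrow> ('a, 's) chart set \<Rightarrow> ('a, 's) chart set \<Rightarrow> bool" where
  "oriented_cover Y A \<Omega> \<longleftrightarrow>
     \<Omega> \<subseteq> A \<and> covers \<Omega> Y \<and> (\<forall>c\<in>\<Omega>. \<forall>d\<in>\<Omega>. same_direction Y c d)"

definition orientation ::
    "'a topology \<Rightarrow> ('a, 's) chart set \<Rightarrow> ('a, 's) chart set \<Rightarrow> bool" where
  "orientation Y A \<Omega> \<longleftrightarrow>
     oriented_cover Y A \<Omega> \<and> (\<forall>\<Omega>'. oriented_cover Y A \<Omega>' \<and> \<Omega> \<subseteq> \<Omega>' \<longrightarrow> \<Omega>' = \<Omega>)"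


section \<open>Finite graphs\<close>

text \<open>A finite directed graph is a space \<open>X\<close> with a vertex set \<open>V\<close> and a set \<open>D\<close> of edges
  parameterized on the unit interval; loops and parallel edges are allowed.
  Since \<open>X\<close> is Hausdorff and \<open>D\<close> is finite, \<open>X\<close> has the topology of the one-dimensional cell
  complex with these cells.  The empty graph is not excluded.\<close>

definition finite_directed_graph :: "'b topology \<Rightarrow> 'b set \<Rightarrow> (real \<Rightarrow> 'b) set \<Rightarrow> bool" where
  "finite_directed_graph X V D \<longleftrightarrow>
     Hausdorff_space X \<and> finite V \<and> V \<subseteq> topspace X \<and> finite D \<and>
     (\<forall>e\<in>D. continuous_map (top_of_set {0..1}) X e \<and> e 0 \<in> V \<and> e 1 \<in> V \<and>
             inj_on e {0<..<1} \<and> e ` {0<..<1} \<inter> V = {}) \<and>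
     (\<forall>e\<in>D. \<forall>e'\<in>D. e \<noteq> e' \<longrightarrow> e ` {0<..<1} \<inter> e' ` {0<..<1} = {}) \<and>
     topspace X = V \<union> (\<Union>e\<in>D. e ` {0..1})"

definition nondegenerate :: "'b set \<Rightarrow> (real \<Rightarrow> 'b) set \<Rightarrow> bool" where
  "nondegenerate V D \<longleftrightarrow> (\<forall>v\<in>V. (\<exists>e\<in>D. e 1 = v) \<and> (\<exists>e\<in>D. e 0 = v))"

text \<open>Undirected graphs: forget the parameterizations and keep the (closed) edges as sets.\<close>

definition finite_graph :: "'b topology \<Rightarrow> 'b set \<Rightarrow> 'b set set \<Rightarrow> bool" where
  "finite_graph X V E \<longleftrightarrow>
     (\<exists>D. finite_directed_graph X V D \<and> E = (\<lambda>e. e ` {0..1}) ` D)"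


section \<open>Light simplicial maps\<close>

definition simplicial_rel ::
    "'b topology \<Rightarrow> 'b set \<Rightarrow> 'b set set \<Rightarrow> 'c topology \<Rightarrow> 'c set \<Rightarrow> 'c set set \<Rightarrow> ('b \<Rightarrow> 'c) \<Rightarrow> bool"
  where
  "simplicial_rel X2 V2 E2 X1 V1 E1 f \<longleftrightarrow>
     continuous_map X2 X1 f \<and> f ` topspace X2 = topspace X1 \<and> f ` V2 \<subseteq> V1 \<and>
     (\<forall>e2\<in>E2. \<exists>e1\<in>E1.
        homeomorphic_map (subtopology X2 (e2 - V2)) (subtopology X1 (e1 - V1)) f \<or>
        f constant_on (e2 - V2))"

definition simplicial :: "'b topology \<Rightarrow> 'c topology \<Rightarrow> ('b \<Rightarrow> 'c) \<Rightarrow> bool" where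
  "simplicial X2 X1 f \<longleftrightarrow>
     (\<exists>V2 E2 V1 E1. finite_graph X2 V2 E2 \<and> finite_graph X1 V1 E1 \<and>
        simplicial_rel X2 V2 E2 X1 V1 E1 f)"

definition totally_disconnectedin :: "'b topology \<Rightarrow> 'b set \<Rightarrow> bool" where
  "totally_disconnectedin X S \<longleftrightarrow>
     S \<subseteq> topspace X \<and> (\<forall>T. T \<subseteq> S \<and> connectedin X T \<longrightarrow> (\<forall>x\<in>T. \<forall>y\<in>T. x = y))"

definition light :: "'b topology \<Rightarrow> 'c topology \<Rightarrow> ('b \<Rightarrow> 'c) \<Rightarrow> bool" where
  "light X2 X1 f \<longleftrightarrow>
     (\<forall>y \<in> topspace X1. totally_disconnectedin X2 {x \<in> topspace X2. f x = y})"

text \<open>In an inverse sequence the bonding map \<open>f k\<close>, for \<open>k \<ge> 1\<close>, goes from \<open>X k\<close> to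
  \<open>X (k - 1)\<close>; the value \<open>f 0\<close> is irrelevant.  The vertex sets witnessing that \<open>f k\<close> and
  \<open>f (Suc k)\<close> are simplicial may induce different subdivisions of \<open>X k\<close>.\<close>

definition light_simplicial_sequence ::
    "(nat \<Rightarrow> 'b topology) \<Rightarrow> (nat \<Rightarrow> 'b \<Rightarrow> 'b) \<Rightarrow> bool" where
  "light_simplicial_sequence X f \<longleftrightarrow>
     (\<forall>k. light (X (Suc k)) (X k) (f (Suc k)) \<and> simplicial (X (Suc k)) (X k) (f (Suc k)))"

definition inverse_limit :: "(nat \<Rightarrow> 'b topology) \<Rightarrow> (nat \<Rightarrow> 'b \<Rightarrow> 'b) \<Rightarrow> (nat \<Rightarrow> 'b) topology" where
  "inverse_limit X f =
     subtopology (product_topology X UNIV) {x. \<forall>k. f (Suc k) (x (Suc k)) = x k}"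


section \<open>Orientation preserving maps\<close>

text \<open>For a loop \<open>e\<close> the inverse of \<open>e\<close> is only well defined off the vertex, so there one has to
  restrict to the open edge.  (For an edge with distinct ends, using the open edge would give an
  equivalent condition on a continuous \<open>p\<close>.)\<close>

definition edge_params :: "(real \<Rightarrow> 'b) \<Rightarrow> real set" where
  "edge_params e = (if e 0 \<noteq> e 1 then {0..1} else {0<..<1})"

definition op_path :: "'b topology \<Rightarrow> (real \<Rightarrow> 'b) set \<Rightarrow> (real \<Rightarrow> 'b) \<Rightarrow> bool" where
  "op_path X D p \<longleftrightarrow>
     continuous_map (top_of_set {0..1}) X p \<and>
     (\<forall>I. \<forall>e\<in>D. is_interval I \<and> I \<subseteq> {0..1} \<and> p ` I \<subseteq> e ` edge_params e \<longrightarrow>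
        mono_on I (the_inv_into (edge_params e) e \<circ> p))"

definition orientation_preserving ::
    "'b topology \<Rightarrow> (real \<Rightarrow> 'b) set \<Rightarrow> 'c topology \<Rightarrow> (real \<Rightarrow> 'c) set \<Rightarrow> ('b \<Rightarrow> 'c) \<Rightarrow> bool" where
  "orientation_preserving X1 D1 X2 D2 f \<longleftrightarrow>
     continuous_map X1 X2 f \<and> (\<forall>p. op_path X1 D1 p \<longrightarrow> op_path X2 D2 (f \<circ> p))"

text \<open>A light simplicial presentation of \<open>Y\<close> by orientation preserving maps of finite directed
  nondegenerate graphs.  The graphs are topologies on \<open>nat \<times> real\<close>, unrelated to the standard
  topology of that type; every finite graph has a copy of this form, because its set of points
  has at most the cardinality of the continuum.\<close>

definition directed_presentation ::
    "(nat \<Rightarrow> (nat \<times> real) topology) \<Rightarrow> (nat \<Rightarrow> (nat \<times> real) set) \<Rightarrow>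
     (nat \<Rightarrow> (real \<Rightarrow> nat \<times> real) set) \<Rightarrow> (nat \<Rightarrow> nat \<times> real \<Rightarrow> nat \<times> real) \<Rightarrow>
     'a topology \<Rightarrow> bool" where
  "directed_presentation X V D f Y \<longleftrightarrow>
     (\<forall>k. finite_directed_graph (X k) (V k) (D k) \<and> nondegenerate (V k) (D k)) \<and>
     light_simplicial_sequence X f \<and>
     (\<forall>k. orientation_preserving (X (Suc k)) (D (Suc k)) (X k) (D k) (f (Suc k))) \<and>
     inverse_limit X f homeomorphic_space Y"

end

theory Submission
  imports Defs
begin

text \<open>Cut \<open>Y\<close> along a compact zero-dimensional transversal \<open>K\<close> that contains all branch points and
  that meets every chart arc locally exactly once.  Finitely many boxes with ends in \<open>K\<close> cover
  \<open>Y\<close>, and between consecutive crossings of \<open>K\<close> they decompose into bundles of arcs.  Hence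
  \<open>Y\<close> is a quotient of \<open>Z \<times> [0,1]\<close> with \<open>Z\<close> compact and zero-dimensional, where only points
  over \<open>0\<close> and \<open>1\<close>, the points of \<open>K\<close>, are identified.  By the orientation every point of \<open>K\<close>
  is both an initial and a terminal point of arcs.  Refining sequences of finite clopen
  partitions of \<open>K\<close> (the vertices) and \<open>Z\<close> (the edges) then give finite directed graphs with
  simplicial bonding maps, and the inverse limit is \<open>Y\<close> by compactness.\<close>

section \<open>Zero-dimensional and connected spaces\<close>

text \<open>The obstacle is that heights in different charts are unrelated: a level set of one chart
  need not be a level set of another. What survives a change of charts is the order: by the
  orientation the height in every chart strictly increases along each strand. So \<open>K\<close> is
  only asked to be, near each of its points, a level of some chart, and this already makes crossings
  of \<open>K\<close> isolated and lets them vary continuously with the strand. Where two such parts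
  met, their union could fail to be a level of one chart; hence each new part is kept disjoint from
  the earlier ones. Zero-dimensionality permits this, since the height of a cut may be chosen
  independently on disjoint clopen sets of strands. Branch points leave no such freedom: they have
  height 0 in every chart around them. They are therefore put into \<open>K\<close> before any other
  cut is made. On the side of the graphs, the bonding maps keep the edge parameter fixed, and the
  direction of edges is inherited from that of the arcs.\<close>

lemma connectedin_subset_left:
  assumes "connectedin X S" "openin X A" "openin X B" "S \<subseteq> A \<union> B" "A \<inter> B \<inter> S = {}" "A \<inter> S \<noteq> {}"
  shows "S \<subseteq> A"
proof -
  have "B \<inter> S = {}" using assms unfolding connectedin by metis
  then show ?thesis using assms(4) by blast
qed

lemma clopen_neighbourhood:
  assumes "X dim_le 0" "openin X W" "x \<in> W"
  obtains U where "openin X U" "closedin X U" "x \<in> U" "U \<subseteq> W"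
proof -
  have "neighbourhood_base_of (\<lambda>U. closedin X U \<and> openin X U) X"
    using assms(1) by (simp add: dimension_le_0_neighbourhood_base_of_clopen)
  then have "\<forall>W x. openin X W \<and> x \<in> W \<longrightarrow> (\<exists>U. (closedin X U \<and> openin X U) \<and> x \<in> U \<and> U \<subseteq> W)"
    by (subst (asm) open_neighbourhood_base_of) auto
  then show thesis using assms that by blast
qed

lemma dim_le_0I:
  assumes "\<And>W x. openin X W \<Longrightarrow> x \<in> W \<Longrightarrow> \<exists>U. openin X U \<and> closedin X U \<and> x \<in> U \<and> U \<subseteq> W"
  shows "X dim_le 0"
proof -
  have "neighbourhood_base_of (\<lambda>U. closedin X U \<and> openin X U) X"
    by (subst open_neighbourhood_base_of) (simp, metis assms)
  then show ?thesis by (simp add: dimension_le_0_neighbourhood_base_of_clopen)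
qed

text \<open>A finite subcover by open sets with \<open>P\<close> is glued by \<open>union\<close>,
  and \<open>mono\<close> restricts the result to \<open>T\<close>. Most compactness arguments below
  are phrased as a choice of \<open>P\<close>, so that no cover has to be carried along.\<close>

lemma compactin_local_to_global:
  assumes "compactin X T" and empty: "P {}"
    and union: "\<And>A B. P A \<Longrightarrow> P B \<Longrightarrow> P (A \<union> B)"
    and mono: "\<And>A B. P B \<Longrightarrow> A \<subseteq> B \<Longrightarrow> P A"
    and "local": "\<And>x. x \<in> T \<Longrightarrow> \<exists>N. openin X N \<and> x \<in> N \<and> P N"
  shows "P T"
proof -
  define \<U> where "\<U> = {N. openin X N \<and> P N}"
  have "T \<subseteq> \<Union>\<U>" using "local" by (auto simp: \<U>_def)
  then obtain \<F> where \<F>: "finite \<F>" "\<F> \<subseteq> \<U>" "T \<subseteq> \<Union>\<F>"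
    using compactinD[OF assms(1), of \<U>] by (auto simp: \<U>_def)
  from \<F>(1,2) have "P (\<Union>\<F>)"
    by (induction \<F>) (auto simp: \<U>_def empty union)
  then show ?thesis using mono \<F>(3) by blast
qed

lemma clopen_separation:
  assumes "X dim_le 0" "compactin X A" "closedin X B" "A \<inter> B = {}"
  obtains U where "openin X U" "closedin X U" "A \<subseteq> U" "U \<inter> B = {}"
proof -
  have "\<exists>U. openin X U \<and> closedin X U \<and> A \<subseteq> U \<and> U \<inter> B = {}"
  proof (rule compactin_local_to_global[OF assms(2), where P = "\<lambda>A. \<exists>U. openin X U \<and> closedin X U \<and> A \<subseteq> U \<and> U \<inter> B = {}"])
    fix A A' assume "\<exists>U. openin X U \<and> closedin X U \<and> A \<subseteq> U \<and> U \<inter> B = {}"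
      "\<exists>U. openin X U \<and> closedin X U \<and> A' \<subseteq> U \<and> U \<inter> B = {}"
    then obtain U U' where U: "openin X U" "closedin X U" "A \<subseteq> U" "U \<inter> B = {}"
      "openin X U'" "closedin X U'" "A' \<subseteq> U'" "U' \<inter> B = {}" by blast
    then show "\<exists>U. openin X U \<and> closedin X U \<and> A \<union> A' \<subseteq> U \<and> U \<inter> B = {}"
      by (intro exI[of _ "U \<union> U'"]) auto
  next
    fix x assume x: "x \<in> A"
    then have "x \<in> topspace X - B" using assms compactin_subset_topspace by blast
    moreover have "openin X (topspace X - B)" using assms(3) by blast
    ultimately obtain U where "openin X U" "closedin X U" "x \<in> U" "U \<subseteq> topspace X - B"
      using clopen_neighbourhood[OF assms(1)] by metis
    then show "\<exists>N. openin X N \<and> x \<in> N \<and> (\<exists>U. openin X U \<and> closedin X U \<and> N \<subseteq> U \<and> U \<inter> B = {})"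
      by blast
  qed blast+
  then show thesis using that by blast
qed

text \<open>Zero-dimensionality turns the neighbourhoods into clopen ones, and on clopen sets two
  choices can be glued by letting the first take precedence. The result has finitely many values and
  open fibres, which is what cutting strands at chosen heights requires.\<close>

lemma locally_constant_selection:
  assumes "compact_space X" "X dim_le 0"
    and ex: "\<And>x. x \<in> topspace X \<Longrightarrow> \<exists>v U. openin X U \<and> x \<in> U \<and> (\<forall>x'\<in>U. \<Phi> x' v)"
  obtains l where "\<And>x. x \<in> topspace X \<Longrightarrow> \<Phi> x (l x)" "finite (l ` topspace X)"
    "\<And>v. openin X {x \<in> topspace X. l x = v}"
proof -
  \<comment> \<open>The choice lives on a clopen set \<open>T\<close> containing \<open>A\<close>
    rather than on \<open>A\<close> itself: this makes \<open>P\<close> pass to subsets and lets two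
    choices be merged.\<close>
  define P where "P A \<longleftrightarrow> (\<exists>T l. A \<subseteq> T \<and> openin X T \<and> closedin X T \<and> (\<forall>x\<in>T. \<Phi> x (l x)) \<and> finite (l ` T) \<and>
    (\<forall>v. openin X {x \<in> T. l x = v}))" for A
  have "P (topspace X)"
  proof (rule compactin_local_to_global[of X])
    show "P {}" unfolding P_def by (rule exI[of _ "{}"]) auto
    fix A B assume "P A" "P B"
    obtain T l where T: "A \<subseteq> T" "openin X T" "closedin X T" "\<forall>x\<in>T. \<Phi> x (l x)" "finite (l ` T)"
      "\<And>v. openin X {x \<in> T. l x = v}" using \<open>P A\<close> unfolding P_def by blast
    obtain T' l' where T': "B \<subseteq> T'" "openin X T'" "closedin X T'" "\<forall>x\<in>T'. \<Phi> x (l' x)" "finite (l' ` T')"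
      "\<And>v. openin X {x \<in> T'. l' x = v}" using \<open>P B\<close> unfolding P_def by blast
    define m where "m x = (if x \<in> T then l x else l' x)" for x
    have "openin X {x \<in> T \<union> T'. m x = v}" for v
    proof -
      have "{x \<in> T \<union> T'. m x = v} = {x \<in> T. l x = v} \<union> ({x \<in> T'. l' x = v} - T)"
        by (auto simp: m_def)
      then show ?thesis using T(6)[of v] T'(6)[of v] T(3) by (simp add: openin_Un openin_diff)
    qed
    moreover have "finite (m ` (T \<union> T'))"
      by (rule finite_subset[of _ "l ` T \<union> l' ` T'"]) (use T T' in \<open>auto simp: m_def\<close>)
    moreover have "\<forall>x\<in>T \<union> T'. \<Phi> x (m x)" using T T' by (auto simp: m_def)
    moreover have "A \<union> B \<subseteq> T \<union> T'" "openin X (T \<union> T')" "closedin X (T \<union> T')"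
      using T T' by auto
    ultimately show "P (A \<union> B)" unfolding P_def by blast
  next
    fix A B assume "P B" "A \<subseteq> B"
    then show "P A" unfolding P_def by (meson subset_trans)
  next
    fix x assume "x \<in> topspace X"
    then obtain v U where U: "openin X U" "x \<in> U" "\<forall>x'\<in>U. \<Phi> x' v" using ex by blast
    then obtain W where W: "openin X W" "closedin X W" "x \<in> W" "W \<subseteq> U"
      using clopen_neighbourhood[OF assms(2)] by metis
    have "P W" unfolding P_def
    proof (intro exI[of _ W] exI[of _ "\<lambda>_. v"] conjI allI)
      show "finite ((\<lambda>_. v) ` W)" by (rule finite_subset[of _ "{v}"]) auto
      show "openin X {x \<in> W. v = va}" for va using W(1) by (cases "v = va") auto
    qed (use U W in auto)
    then show "\<exists>N. openin X N \<and> x \<in> N \<and> P N" using W by blast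
  qed (use assms in \<open>simp add: compact_space_def\<close>)
  then obtain T l where T: "topspace X \<subseteq> T" "openin X T" "\<forall>x\<in>T. \<Phi> x (l x)" "finite (l ` T)"
      "\<And>v. openin X {x \<in> T. l x = v}" unfolding P_def by blast
  have "T = topspace X" using T openin_subset by blast
  then show thesis using that[of l] T by blast
qed

lemma closedin_fibre:
  assumes "\<And>v. openin X {x \<in> topspace X. l x = v}"
  shows "closedin X {x \<in> topspace X. l x = v}"
proof -
  have "{x \<in> topspace X. l x = v} = topspace X - (\<Union>w\<in>-{v}. {x \<in> topspace X. l x = w})" by auto
  moreover have "openin X (\<Union>w\<in>-{v}. {x \<in> topspace X. l x = w})" using assms by (intro openin_Union) auto
  ultimately show ?thesis by auto
qed

text \<open>Distinct points have basic neighbourhoods on the two sides of some clopen set, so it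
  suffices to fix one clopen separator for each pair of basic sets that has one; there are countably
  many pairs. Such sequences later provide the labels of vertices and edges.\<close>

lemma clopen_separating_sequence:
  assumes "second_countable X" "X dim_le 0" "t1_space X"
  obtains C :: "nat \<Rightarrow> 'a set" where "\<forall>n. openin X (C n) \<and> closedin X (C n)"
    "\<forall>x\<in>topspace X. \<forall>y\<in>topspace X. x \<noteq> y \<longrightarrow> (\<exists>n. x \<in> C n \<and> y \<notin> C n)"
proof -
  obtain \<B> where \<B>: "countable \<B>" "\<And>V. V \<in> \<B> \<Longrightarrow> openin X V"
    "\<And>U x. openin X U \<and> x \<in> U \<longrightarrow> (\<exists>V \<in> \<B>. x \<in> V \<and> V \<subseteq> U)"
    using assms(1) by (auto simp: second_countable_def)
  define Q where "Q U V W \<longleftrightarrow> openin X W \<and> closedin X W \<and> U \<subseteq> W \<and> W \<inter> V = {}" for U V W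
  \<comment> \<open>The empty set is the default for pairs without a separator; it is clopen, so
    every value of \<open>w\<close> is.\<close>
  define w where "w U V = (if \<exists>W. Q U V W then SOME W. Q U V W else {})" for U V
  have Qw: "Q U V (w U V)" if "\<exists>W. Q U V W" for U V
    unfolding w_def using someI_ex[OF that] that by simp
  have w: "openin X (w U V)" "closedin X (w U V)" for U V
  proof -
    have "Q U V (w U V) \<or> w U V = {}" using Qw[of U V] by (cases "\<exists>W. Q U V W") (auto simp: w_def)
    then show "openin X (w U V)" "closedin X (w U V)" by (auto simp: Q_def)
  qed
  \<comment> \<open>Inserting the empty set keeps the family nonempty, as its enumeration by
    \<open>nat\<close> requires.\<close>
  define \<W> where "\<W> = insert {} ((\<lambda>(U, V). w U V) ` (\<B> \<times> \<B>))"
  have "countable \<W>" "\<W> \<noteq> {}" using \<B>(1) by (auto simp: \<W>_def)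
  then obtain C :: "nat \<Rightarrow> 'a set" where C: "\<W> = range C"
    using range_from_nat_into by metis
  have "\<exists>n. x \<in> C n \<and> y \<notin> C n" if xy: "x \<in> topspace X" "y \<in> topspace X" "x \<noteq> y" for x y
  proof -
    obtain O1 where O1: "openin X O1" "x \<in> O1" "y \<notin> O1"
      using assms(3) xy unfolding t1_space_def by meson
    then obtain W where W: "openin X W" "closedin X W" "x \<in> W" "W \<subseteq> O1"
      using clopen_neighbourhood[OF assms(2)] by metis
    obtain U where U: "U \<in> \<B>" "x \<in> U" "U \<subseteq> W" using \<B>(3) W by blast
    have "openin X (topspace X - W)" using W by blast
    then obtain V where V: "V \<in> \<B>" "y \<in> V" "V \<subseteq> topspace X - W" using \<B>(3) xy O1 W by blast
    have "Q U V W" unfolding Q_def using W U V by blast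
    then have "Q U V (w U V)" using Qw by blast
    then have "x \<in> w U V" "y \<notin> w U V" using U V by (auto simp: Q_def)
    moreover have "w U V \<in> range C" using U V C unfolding \<W>_def by blast
    ultimately show ?thesis by auto
  qed
  moreover have "openin X (C n)" "closedin X (C n)" for n
  proof -
    have "C n \<in> \<W>" using C by blast
    then show "openin X (C n)" "closedin X (C n)" using w by (auto simp: \<W>_def)
  qed
  ultimately show thesis by (intro that[of C] allI conjI ballI impI)
qed

lemma connectedin_dim_le_0:
  assumes "X dim_le 0" "t1_space X" "connectedin X T" "x \<in> T" "y \<in> T"
  shows "x = y"
proof (rule ccontr)
  assume "x \<noteq> y"
  have T: "T \<subseteq> topspace X" using assms(3) by (rule connectedin_subset_topspace)
  then obtain O1 where O1: "openin X O1" "x \<in> O1" "y \<notin> O1"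
    using assms(2,4,5) \<open>x \<noteq> y\<close> unfolding t1_space_def by (meson subsetD)
  then obtain W where W: "openin X W" "closedin X W" "x \<in> W" "W \<subseteq> O1"
    using clopen_neighbourhood[OF assms(1)] by metis
  have "openin X (topspace X - W)" using W by blast
  moreover have "T \<subseteq> W \<union> (topspace X - W)" using T by blast
  ultimately have "T \<subseteq> W" using connectedin_subset_left[OF assms(3) W(1)] W assms(4) by blast
  then show False using assms(5) W O1 by blast
qed

text \<open>Balls of radius \<open>inverse (Suc n)\<close> around the points of a countable dense
  set form a base; a radius below \<open>r / 2\<close> leaves room to move the centre to a point of
  the dense set.\<close>

lemma second_countable_metrizable:
  assumes "metrizable_space X" "separable_space X"
  shows "second_countable X"
proof -
  obtain M d where Md: "Metric_space M d" "X = Metric_space.mtopology M d"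
    using assms(1) unfolding metrizable_space_def by blast
  interpret Metric_space M d by (rule Md(1))
  obtain C where C: "countable C" "C \<subseteq> M" "mtopology closure_of C = M"
    using assms(2) unfolding separable_space_def Md(2) by auto
  define \<B> where "\<B> = (\<lambda>(c, n). mball c (inverse (Suc n))) ` (C \<times> (UNIV::nat set))"
  have "countable \<B>" unfolding \<B>_def using C(1) by auto
  moreover have "openin mtopology V" if "V \<in> \<B>" for V using that by (auto simp: \<B>_def)
  moreover have "\<exists>V\<in>\<B>. x \<in> V \<and> V \<subseteq> U" if U: "openin mtopology U" "x \<in> U" for U x
  proof -
    have xM: "x \<in> M" using U openin_subset by fastforce
    obtain r where r: "r > 0" "mball x r \<subseteq> U" using U by (metis openin_mtopology)
    obtain n where n: "inverse (Suc n) < r / 2" using reals_Archimedean[of "r/2"] r by auto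
    have "x \<in> mtopology closure_of C" using C(3) xM by simp
    then obtain c where c: "c \<in> C" "c \<in> mball x (inverse (Suc n))"
      unfolding in_closure_of using xM openin_mball by (metis centre_in_mball_iff inverse_positive_iff_positive of_nat_0_less_iff zero_less_Suc)
    have "mball c (inverse (Suc n)) \<subseteq> mball x r"
    proof
      fix y assume y: "y \<in> mball c (inverse (Suc n))"
      then have "d x y \<le> d x c + d c y" using c xM by (intro triangle) auto
      then show "y \<in> mball x r" using y c n xM by auto
    qed
    moreover have "x \<in> mball c (inverse (Suc n))" using c xM by (auto simp: commute)
    ultimately show ?thesis using r c unfolding \<B>_def by force
  qed
  ultimately show ?thesis unfolding second_countable_def Md(2) by blast
qed

lemma compact_space_sum_topology:
  assumes "finite I" "\<And>i. i \<in> I \<Longrightarrow> compact_space (X i)"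
  shows "compact_space (sum_topology X I)"
proof -
  have "compactin (sum_topology X I) (\<Union>i\<in>I. Pair i ` topspace (X i))"
    using assms by (intro compactin_Union)
      (auto intro!: image_compactin[OF _ continuous_map_component_injection] simp: compact_space_def[symmetric])
  moreover have "(\<Union>i\<in>I. Pair i ` topspace (X i)) = topspace (sum_topology X I)" by auto
  ultimately show ?thesis by (simp add: compact_space_def)
qed

section \<open>Finite directed graphs\<close>

text \<open>The final topology for the parameterizations, that is, the quotient of a disjoint union
  of unit intervals. Continuity of maps out of it is tested edge by edge.\<close>

definition edge_topology :: "(real \<Rightarrow> 'b) set \<Rightarrow> 'b topology" where
  "edge_topology D = topology (\<lambda>U. U \<subseteq> (\<Union>e\<in>D. e ` {0..1}) \<and>
     (\<forall>e\<in>D. openin (top_of_set {0..1}) {t \<in> {0..1}. e t \<in> U}))"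

lemma openin_edge_topology:
  "openin (edge_topology D) U \<longleftrightarrow> U \<subseteq> (\<Union>e\<in>D. e ` {0..1}) \<and>
     (\<forall>e\<in>D. openin (top_of_set {0..1}) {t \<in> {0..1}. e t \<in> U})"
proof -
  have 1: "{t \<in> {0..1}. e t \<in> S \<inter> T} = {t \<in> {0..1}. e t \<in> S} \<inter> {t \<in> {0..1}. e t \<in> T}"
    for e :: "real \<Rightarrow> 'b" and S T by auto
  have 2: "{t \<in> {0..1}. e t \<in> \<Union>K} = (\<Union>S\<in>K. {t \<in> {0..1}. e t \<in> S})"
    for e :: "real \<Rightarrow> 'b" and K by auto
  have "istopology (\<lambda>U. U \<subseteq> (\<Union>e\<in>D. e ` {0..1}) \<and>
     (\<forall>e\<in>D. openin (top_of_set {0..1}) {t \<in> {0..1}. e t \<in> U}))"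
    unfolding istopology_def 1 2 by blast
  then show ?thesis
    by (simp add: edge_topology_def)
qed

lemma topspace_edge_topology [simp]: "topspace (edge_topology D) = (\<Union>e\<in>D. e ` {0..1})"
proof -
  have "openin (edge_topology D) (\<Union>e\<in>D. e ` {0..1})"
    unfolding openin_edge_topology
  proof (intro conjI ballI order_refl)
    fix e assume "e \<in> D"
    then have "{t \<in> {0..1}. e t \<in> (\<Union>e\<in>D. e ` {0..1})} = {0..1}" by auto
    then show "openin (top_of_set {0..1}) {t \<in> {0..1}. e t \<in> (\<Union>e\<in>D. e ` {0..1})}"
      by simp
  qed
  then show ?thesis
    using openin_subset[of "edge_topology D" "\<Union>e\<in>D. e ` {0..1}"]
      openin_edge_topology[of D "topspace (edge_topology D)"] by (simp add: subset_antisym)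
qed

lemma continuous_map_edge:
  assumes "e \<in> D" shows "continuous_map (top_of_set {0..1}) (edge_topology D) e"
  using assms by (auto simp: continuous_map_def openin_edge_topology)

lemma continuous_map_from_edges:
  assumes "\<And>e. e \<in> D \<Longrightarrow> continuous_map (top_of_set {0..1}) T (\<lambda>t. g (e t))"
  shows "continuous_map (edge_topology D) T g"
  unfolding continuous_map_def
proof (intro conjI allI impI)
  show "g \<in> topspace (edge_topology D) \<rightarrow> topspace T"
    using assms by (fastforce simp: continuous_map_def)
  fix U assume U: "openin T U"
  have *: "{t. t \<in> {0..1} \<and> e t \<in> {x \<in> topspace (edge_topology D). g x \<in> U}} = {t \<in> {0..1}. g (e t) \<in> U}"
    if "e \<in> D" for e using that unfolding topspace_edge_topology by blast
  show "openin (edge_topology D) {x \<in> topspace (edge_topology D). g x \<in> U}"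
    unfolding openin_edge_topology
  proof (intro conjI ballI)
    fix e assume "e \<in> D"
    then show "openin (top_of_set {0..1}) {t \<in> {0..1}. e t \<in> {x \<in> topspace (edge_topology D). g x \<in> U}}"
      unfolding *[OF \<open>e \<in> D\<close>] using assms U by (auto simp: continuous_map_def)
  qed auto
qed

text \<open>The equations for \<open>V\<close> say that the graph is nondegenerate.\<close>

locale closed_digraph =
  fixes V :: "'b set" and D :: "(real \<Rightarrow> 'b) set"
  assumes fin: "finite D"
    and V0: "V = (\<lambda>e. e 0) ` D" and V1: "V = (\<lambda>e. e 1) ` D"
    and edge_eq: "\<lbrakk>e \<in> D; e' \<in> D; 0 < t; t < 1; 0 \<le> t'; t' \<le> 1; e t = e' t'\<rbrakk> \<Longrightarrow> e = e' \<and> t = t'"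
begin

text \<open>Since \<open>edge_eq\<close> lets its second parameter run over the closed interval, it
  also keeps interior points of edges away from the vertices, which are values \<open>e' 0\<close>
  by \<open>V0\<close>.\<close>

lemma V_cases: "v \<in> V \<Longrightarrow> e \<in> D \<Longrightarrow> 0 \<le> t \<Longrightarrow> t \<le> 1 \<Longrightarrow> e t = v \<Longrightarrow> t = 0 \<or> t = 1"
proof -
  assume a: "v \<in> V" "e \<in> D" "0 \<le> t" "t \<le> 1" "e t = v"
  obtain e' where e': "e' \<in> D" "v = e' 0" using a(1) unfolding V0 by blast
  show "t = 0 \<or> t = 1"
    using edge_eq[of e e' t 0] a e' by (cases "0 < t"; cases "t < 1") auto
qed

lemma ends_in_V: "e \<in> D \<Longrightarrow> e 0 \<in> V" "e \<in> D \<Longrightarrow> e 1 \<in> V"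
proof -
  show "e 0 \<in> V" if "e \<in> D" by (subst V0, rule image_eqI[OF refl that])
  show "e 1 \<in> V" if "e \<in> D" by (subst V1, rule image_eqI[OF refl that])
qed

text \<open>Two vertices are separated by a function affine on every edge; an interior point is
  separated from every other point by a tent over its edge. The last hypothesis excludes only a
  vertex \<open>x\<close> with an interior point \<open>y\<close>, a case in which the two points
  can be exchanged.\<close>

lemma separating_function:
  assumes "x \<in> topspace (edge_topology D)" "y \<in> topspace (edge_topology D)" "x \<noteq> y" "x \<notin> V \<or> y \<in> V"
  shows "\<exists>g. continuous_map (edge_topology D) euclideanreal g \<and> g x \<noteq> g y"
proof (cases "x \<in> V")
  case True
  then have "y \<in> V" using assms by auto
  define h where "h v = (if v = x then 1 else 0::real)" for v
  \<comment> \<open>The edge and the parameter of an interior point are recovered by a choice, which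
    \<open>edge_eq\<close> makes unique.\<close>
  define P where "P z e t \<longleftrightarrow> e \<in> D \<and> 0 < t \<and> t < 1 \<and> e t = z" for z e and t :: real
  define g where "g z = (if z \<in> V then h z else
      (let p = (SOME p. P z (fst p) (snd p)) in (1 - snd p) * h (fst p 0) + snd p * h (fst p 1)))" for z
  have g: "g (e t) = (1 - t) * h (e 0) + t * h (e 1)" if "e \<in> D" "t \<in> {0..1}" for e t
  proof (cases "e t \<in> V")
    case True
    then have "t = 0 \<or> t = 1" using V_cases[of "e t" e t] that by simp
    then show ?thesis using True by (auto simp: g_def)
  next
    case False
    then have t: "0 < t" "t < 1"
      using that ends_in_V[of e] by (auto simp: less_le)
    define p where "p = (SOME p. P (e t) (fst p) (snd p))"
    have "P (e t) (fst p) (snd p)"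
      unfolding p_def by (rule someI[of _ "(e, t)"]) (use that t in \<open>simp add: P_def\<close>)
    then have "fst p = e \<and> snd p = t"
      using edge_eq[of e "fst p" t "snd p"] that(1) t by (simp add: P_def)
    then show ?thesis using False by (simp add: g_def p_def[symmetric])
  qed
  have "continuous_map (edge_topology D) euclideanreal g"
  proof (rule continuous_map_from_edges)
    fix e assume e: "e \<in> D"
    have "continuous_on {0..1} (\<lambda>t. (1 - t) * h (e 0) + t * h (e 1))"
      by (intro continuous_intros)
    then have "continuous_on {0..1} (\<lambda>t. g (e t))"
      using g[OF e] by (subst continuous_on_cong[OF refl]) auto
    then show "continuous_map (top_of_set {0..1}) euclideanreal (\<lambda>t. g (e t))" by simp
  qed
  moreover have "g x \<noteq> g y" using True \<open>y \<in> V\<close> assms by (simp add: g_def h_def)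
  ultimately show ?thesis by blast
next
  case False
  obtain e0 where e0D: "e0 \<in> D" "x \<in> e0 ` {0..1}" using assms(1) by auto
  then obtain t0 where e0: "e0 \<in> D" "x = e0 t0" "0 \<le> t0" "t0 \<le> 1" by auto
  have t0: "0 < t0" "t0 < 1"
    using e0 False ends_in_V[of e0] by (auto simp: less_le)
  \<comment> \<open>A tent with peak 1 at \<open>t0\<close> and value 0 at both ends, so that it
    extends by 0 to all other edges.\<close>
  define \<phi> where "\<phi> t = min (t / t0) ((1 - t) / (1 - t0))" for t
  \<comment> \<open>The chosen parameter is ambiguous only at the vertex of a loop, and
    \<open>\<phi>\<close> vanishes at both ends.\<close>
  define g where "g z = (if \<exists>t\<in>{0..1}. z = e0 t then \<phi> (SOME t. t \<in> {0..1} \<and> z = e0 t) else 0)" for z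
  have \<phi>0: "\<phi> 0 = 0" "\<phi> 1 = 0" "\<phi> t0 = 1" using t0 by (auto simp: \<phi>_def)
  have \<phi>1: "\<phi> t \<noteq> 1" if "t \<noteq> t0" for t
    using that t0 by (auto simp: \<phi>_def min_def divide_simps split: if_splits)
  have g1: "g (e0 t) = \<phi> t" if "t \<in> {0..1}" for t
  proof -
    define s where "s = (SOME s. s \<in> {0..1} \<and> e0 t = e0 s)"
    have s: "s \<in> {0..1} \<and> e0 t = e0 s"
      unfolding s_def by (rule someI[of _ t]) (use that in auto)
    have "\<phi> s = \<phi> t"
    proof (cases "0 < t \<and> t < 1")
      case True
      then show ?thesis using edge_eq[of e0 e0 t s] e0 s by auto
    next
      case F: False
      then have "t = 0 \<or> t = 1" using that by auto
      then have "e0 s \<in> V" using s ends_in_V e0 by metis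
      then have "s = 0 \<or> s = 1" using V_cases[of "e0 s" e0 s] e0 s by auto
      then show ?thesis using \<open>t = 0 \<or> t = 1\<close> \<phi>0 by auto
    qed
    then show ?thesis using that by (auto simp: g_def s_def)
  qed
  have g2: "g (e t) = 0" if "t \<in> {0..1}" "e \<in> D" "e \<noteq> e0" for e t
  proof (cases "\<exists>s\<in>{0..1}. e t = e0 s")
    case True
    then obtain s where s: "s \<in> {0..1}" "e t = e0 s" by blast
    have "\<not> (0 < s \<and> s < 1)" using edge_eq[of e0 e s t] s that e0 by auto
    then have "s = 0 \<or> s = 1" using s by auto
    then show ?thesis using g1[OF s(1)] s \<phi>0 by auto
  qed (auto simp: g_def)
  have "continuous_map (edge_topology D) euclideanreal g"
  proof (rule continuous_map_from_edges)
    fix e assume e: "e \<in> D"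
    have "continuous_on {0..1} (\<lambda>t. g (e t))"
    proof (cases "e = e0")
      case True
      have "continuous_on {0..1} \<phi>" unfolding \<phi>_def using t0 by (intro continuous_intros) auto
      then show ?thesis using True g1 by (subst continuous_on_cong[OF refl]) auto
    next
      case False
      then show ?thesis using g2 e by (subst continuous_on_cong[OF refl, of _ _ "\<lambda>_. 0"]) auto
    qed
    then show "continuous_map (top_of_set {0..1}) euclideanreal (\<lambda>t. g (e t))" by simp
  qed
  moreover have "g x \<noteq> g y"
  proof -
    have "g x = 1" using g1[of t0] e0 \<phi>0 by auto
    moreover have "g y \<noteq> 1"
    proof -
      obtain e where "e \<in> D" "y \<in> e ` {0..1}" using assms(2) by auto
      then obtain t where y: "e \<in> D" "y = e t" "t \<in> {0..1}" by auto
      show ?thesis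
      proof (cases "e = e0")
        case True
        then have "t \<noteq> t0" using assms y e0 by auto
        then show ?thesis using g1[of t] \<phi>1 y True by auto
      qed (use g2 y in auto)
    qed
    ultimately show ?thesis by simp
  qed
  ultimately show ?thesis by blast
qed

lemma Hausdorff_space_edge_topology: "Hausdorff_space (edge_topology D)"
  unfolding Hausdorff_space_def
proof (intro allI impI)
  fix x y assume a: "x \<in> topspace (edge_topology D) \<and> y \<in> topspace (edge_topology D) \<and> x \<noteq> y"
  obtain g where g: "continuous_map (edge_topology D) euclideanreal g" "g x \<noteq> g y"
    using separating_function[of x y] separating_function[of y x] a by metis
  obtain A B where AB: "open A" "open B" "g x \<in> A" "g y \<in> B" "A \<inter> B = {}"
    using hausdorff[OF g(2)] by blast
  show "\<exists>U W. openin (edge_topology D) U \<and> openin (edge_topology D) W \<and> x \<in> U \<and> y \<in> W \<and> disjnt U W"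
  proof (intro exI conjI)
    show "openin (edge_topology D) {z \<in> topspace (edge_topology D). g z \<in> A}"
      "openin (edge_topology D) {z \<in> topspace (edge_topology D). g z \<in> B}"
      using g(1) AB by (auto simp del: topspace_edge_topology intro!: openin_continuous_map_preimage)
    show "disjnt {z \<in> topspace (edge_topology D). g z \<in> A} {z \<in> topspace (edge_topology D). g z \<in> B}"
      using AB by (auto simp: disjnt_iff)
  qed (use a AB in simp_all)
qed

lemma finite_V: "finite V"
  unfolding V0 using fin by (rule finite_imageI)

lemma inj_edge: "e \<in> D \<Longrightarrow> inj_on e {0<..<1}"
proof (rule inj_onI)
  fix s t assume "e \<in> D" "s \<in> {0<..<1}" "t \<in> {0<..<1}" "e s = e t"
  then show "s = t" using edge_eq[of e e s t] by auto
qed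

lemma finite_directed_graph: "finite_directed_graph (edge_topology D) V D"
  unfolding finite_directed_graph_def
proof (intro conjI ballI impI)
  show "Hausdorff_space (edge_topology D)" by (rule Hausdorff_space_edge_topology)
  have V: "V \<subseteq> (\<Union>e\<in>D. e ` {0..1})" unfolding V0 by force
  then show "V \<subseteq> topspace (edge_topology D)" by simp
  fix e assume e: "e \<in> D"
  have "e t \<notin> V" if "0 < t" "t < 1" for t using V_cases[OF _ e, of "e t" t] that by auto
  then show "e ` {0<..<1} \<inter> V = {}" by auto
  fix e' assume "e' \<in> D" "e \<noteq> e'"
  then have "e t \<noteq> e' t'" if "0 < t" "t < 1" "0 < t'" "t' < 1" for t t'
    using edge_eq[of e e' t t'] e that by auto
  then show "e ` {0<..<1} \<inter> e' ` {0<..<1} = {}" by auto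
next
  have "V \<subseteq> (\<Union>e\<in>D. e ` {0..1})" unfolding V0 by force
  then show "topspace (edge_topology D) = V \<union> (\<Union>e\<in>D. e ` {0..1})" by auto
  fix e assume "e \<in> D"
  then show "continuous_map (top_of_set {0..1}) (edge_topology D) e" "e 0 \<in> V" "e 1 \<in> V" "inj_on e {0<..<1}"
    by (simp_all only: continuous_map_edge ends_in_V inj_edge)
qed (rule finite_V fin)+

lemma nondegenerate: "nondegenerate V D"
  unfolding nondegenerate_def
proof (intro ballI conjI)
  fix v assume v: "v \<in> V"
  show "\<exists>e\<in>D. e 1 = v" using v by (subst (asm) V1) auto
  show "\<exists>e\<in>D. e 0 = v" using v by (subst (asm) V0) auto
qed

text \<open>By \<open>edge_eq\<close> the image of an open set \<open>U\<close> inside the open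
  interval has preimage \<open>U\<close> under \<open>e\<close> and empty preimage under every other
  edge, so it is open in the final topology.\<close>

lemma edge_homeomorphic:
  assumes "e \<in> D"
  shows "homeomorphic_map (top_of_set {0<..<1}) (subtopology (edge_topology D) (e ` {0<..<1})) e"
proof (rule bijective_open_imp_homeomorphic_map)
  have c: "continuous_map (top_of_set {0<..<1}) (edge_topology D) e"
    by (rule continuous_map_from_subtopology_mono[OF continuous_map_edge[OF assms]]) auto
  then show "continuous_map (top_of_set {0<..<1}) (subtopology (edge_topology D) (e ` {0<..<1})) e"
    by (simp add: continuous_map_in_subtopology image_subset_iff_funcset)
  show "open_map (top_of_set {0<..<1}) (subtopology (edge_topology D) (e ` {0<..<1})) e"
    unfolding open_map_def
  proof (intro allI impI)
    fix U :: "real set" assume "openin (top_of_set {0<..<1}) U"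
    then have U: "open U" "U \<subseteq> {0<..<1}" 
      using openin_open_eq[of "{0<..<1::real}" U] by auto
    have "openin (edge_topology D) (e ` U)"
      unfolding openin_edge_topology
    proof (intro conjI ballI)
      show "e ` U \<subseteq> (\<Union>e\<in>D. e ` {0..1})" using U assms by fastforce
      fix e' assume "e' \<in> D"
      have *: "t \<in> U \<and> e' = e" if t: "t \<in> {0..1}" "u \<in> U" "e' t = e u" for t u
        using edge_eq[of e e' u t] t U \<open>e' \<in> D\<close> assms by auto
      have U01: "U \<subseteq> {0..1}" using U by force
      show "openin (top_of_set {0..1}) {t \<in> {0..1}. e' t \<in> e ` U}"
      proof (cases "e' = e")
        case True
        then have "{t \<in> {0..1}. e' t \<in> e ` U} = {0..1} \<inter> U" using * U01 by auto
        then show ?thesis using U by (auto simp: openin_open)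
      next
        case False
        then have "{t \<in> {0..1}. e' t \<in> e ` U} = {}" using * by blast
        then show ?thesis by (simp only: openin_empty)
      qed
    qed
    then show "openin (subtopology (edge_topology D) (e ` {0<..<1})) (e ` U)"
      using U by (auto simp: openin_subtopology intro!: exI[of _ "e ` U"])
  qed
  show "e ` topspace (top_of_set {0<..<1}) = topspace (subtopology (edge_topology D) (e ` {0<..<1}))"
  proof -
    have "e ` {0<..<1} \<subseteq> (\<Union>e\<in>D. e ` {0..1})"
      using assms by (intro order_trans[OF _ UN_upper[of e D]] image_mono) auto
    then show ?thesis by auto
  qed
  show "inj_on e (topspace (top_of_set {0<..<1}))" using inj_edge[OF assms] by simp
qed

end

lemma edge_in_topspace:
  assumes "e \<in> D" "t \<in> {0..1}" shows "e t \<in> topspace (edge_topology D)"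
  unfolding topspace_edge_topology by (rule UN_I[OF assms(1) imageI[OF assms(2)]])

lemma topspace_edgeE:
  assumes "x \<in> topspace (edge_topology D)"
  obtains e t where "e \<in> D" "t \<in> {0..1}" "x = e t"
proof -
  obtain e where e: "e \<in> D" "x \<in> e ` {0..1}" using assms unfolding topspace_edge_topology by (rule UN_E)
  from e(2) obtain t where "x = e t" "t \<in> {0..1}" by (rule imageE)
  then show thesis using e that by simp
qed

declare topspace_edge_topology [simp del]

lemma totally_disconnectedin_finite:
  assumes "Hausdorff_space X" "finite S" "S \<subseteq> topspace X"
  shows "totally_disconnectedin X S"
  unfolding totally_disconnectedin_def
proof (intro conjI allI impI ballI)
  fix T x y assume T: "T \<subseteq> S \<and> connectedin X T" and "x \<in> T" "y \<in> T"
  have "t1_space (subtopology X T)"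
    using assms Hausdorff_imp_t1_space Hausdorff_space_subtopology by blast
  moreover have "topspace (subtopology X T) = T" using T assms by auto
  moreover have "finite T" using T assms finite_subset by blast
  ultimately have "subtopology X T = discrete_topology T"
    using finite_t1_space_imp_discrete_topology[of "subtopology X T" T] by simp
  then have "connected_space (discrete_topology T)" using T by (simp add: connectedin_def)
  then show "x = y" using \<open>x \<in> T\<close> \<open>y \<in> T\<close> by (auto simp: connected_space_discrete_topology)
qed (use assms in auto)

context closed_digraph
begin

lemma openin_open_edge:
  assumes "e \<in> D" shows "openin (edge_topology D) (e ` {0<..<1})"
  unfolding openin_edge_topology
proof (intro conjI ballI)
  show "e ` {0<..<1} \<subseteq> (\<Union>e\<in>D. e ` {0..1})"
    using assms by (intro order_trans[OF _ UN_upper[of e D]] image_mono) auto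
  fix e' assume e': "e' \<in> D"
  have *: "t \<in> {0<..<1} \<and> e' = e" if t: "t \<in> {0..1}" "u \<in> {0<..<1}" "e' t = e u" for t u
    using edge_eq[of e e' u t] t e' assms by auto
  show "openin (top_of_set {0..1}) {t \<in> {0..1}. e' t \<in> e ` {0<..<1}}"
  proof (cases "e' = e")
    case True
    have "{t \<in> {0..1}. e' t \<in> e ` {0<..<1}} \<subseteq> {0<..<1}" using * by blast
    moreover have "{0<..<1} \<subseteq> {t \<in> {0..1}. e' t \<in> e ` {0<..<1}}" using True by auto
    ultimately have "{t \<in> {0..1}. e' t \<in> e ` {0<..<1}} = {0..1} \<inter> {0<..<1}" by auto
    then show ?thesis by (simp only: openin_open_Int open_greaterThanLessThan)
  next
    case False
    then have "{t \<in> {0..1}. e' t \<in> e ` {0<..<1}} = {}" using * by blast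
    then show ?thesis by (simp only: openin_empty)
  qed
qed

lemma edge_minus_V:
  assumes "e \<in> D" shows "e ` {0..1} - V = e ` {0<..<1}"
proof -
  have 1: "e t \<notin> V" if "t \<in> {0<..<1}" for t using V_cases[OF _ assms, of "e t" t] that by auto
  have 2: "e t \<in> V" if "t \<in> {0..1}" "t \<notin> {0<..<1}" for t
  proof -
    have "t = 0 \<or> t = 1" using that by auto
    then show ?thesis using ends_in_V[OF assms] by auto
  qed
  show ?thesis
  proof (intro equalityI subsetI)
    fix x assume x: "x \<in> e ` {0..1} - V"
    then obtain t where t: "x = e t" "t \<in> {0..1}" by blast
    then have "t \<in> {0<..<1}" using 2[of t] x by blast
    then show "x \<in> e ` {0<..<1}" unfolding t(1) by (rule imageI)
  next
    fix x assume "x \<in> e ` {0<..<1}"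
    then obtain t where t: "x = e t" "t \<in> {0<..<1}" by blast
    then have "t \<in> {0..1}" by simp
    then have "x \<in> e ` {0..1}" unfolding t(1) by (rule imageI)
    moreover have "x \<notin> V" unfolding t(1) by (rule 1[OF t(2)])
    ultimately show "x \<in> e ` {0..1} - V" by (rule DiffI)
  qed
qed

lemma inj_edge_params:
  assumes "e \<in> D" shows "inj_on e (edge_params e)"
proof (cases "e 0 = e 1")
  case True
  then show ?thesis using inj_edge[OF assms] by (simp add: edge_params_def)
next
  case False
  have "s = t" if "s \<in> {0..1}" "t \<in> {0..1}" "e s = e t" for s t
  proof (cases "0 < s \<and> s < 1")
    case True
    then show ?thesis using edge_eq[of e e s t] assms that by auto
  next
    case F: False
    then have "s = 0 \<or> s = 1" using that by auto
    moreover have "t = 0 \<or> t = 1"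
      using edge_eq[of e e t s] assms that F by (cases "0 < t \<and> t < 1") auto
    ultimately show ?thesis using that(3) False by auto
  qed
  then show ?thesis using False by (auto simp: edge_params_def inj_on_def)
qed

text \<open>A loop is covered by the case of the open interval. If the ends differ, \<open>e\<close>
  is injective on a compact interval and maps into a Hausdorff space.\<close>

lemma edge_params_homeomorphic:
  assumes "e \<in> D"
  shows "homeomorphic_map (top_of_set (edge_params e))
     (subtopology (edge_topology D) (e ` edge_params e)) e"
proof (cases "e 0 = e 1")
  case True
  then show ?thesis using edge_homeomorphic[OF assms] by (simp add: edge_params_def)
next
  case False
  have "e ` {0..1} \<subseteq> topspace (edge_topology D)" using edge_in_topspace[OF assms] by auto
  then have ts: "topspace (subtopology (edge_topology D) (e ` {0..1})) = e ` {0..1}" by auto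
  have "homeomorphic_map (top_of_set {0..1}) (subtopology (edge_topology D) (e ` {0..1})) e"
  proof (rule continuous_imp_homeomorphic_map)
    show "continuous_map (top_of_set {0..1}) (subtopology (edge_topology D) (e ` {0..1})) e"
      using continuous_map_edge[OF assms]
      by (simp add: continuous_map_in_subtopology image_subset_iff_funcset)
    show "e ` topspace (top_of_set {0..1}) = topspace (subtopology (edge_topology D) (e ` {0..1}))"
      using ts by simp
    show "inj_on e (topspace (top_of_set {0..1}))"
      using inj_edge_params[OF assms] False by (simp add: edge_params_def)
  qed (auto simp: compact_space_subtopology Hausdorff_space_subtopology Hausdorff_space_edge_topology)
  then show ?thesis using False by (simp add: edge_params_def)
qed

lemma continuous_map_edge_inverse:
  assumes "e \<in> D"
  shows "continuous_map (subtopology (edge_topology D) (e ` edge_params e)) euclideanreal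
     (the_inv_into (edge_params e) e)"
proof -
  obtain g where g: "homeomorphic_maps (top_of_set (edge_params e))
     (subtopology (edge_topology D) (e ` edge_params e)) e g"
    using edge_params_homeomorphic[OF assms] homeomorphic_map_maps by blast
  then have c: "continuous_map (subtopology (edge_topology D) (e ` edge_params e)) (top_of_set (edge_params e)) g"
    and ge: "\<And>t. t \<in> edge_params e \<Longrightarrow> g (e t) = t"
    by (simp_all add: homeomorphic_maps_def)
  have "continuous_map (subtopology (edge_topology D) (e ` edge_params e)) euclideanreal g"
    using c continuous_map_in_subtopology by blast
  then show ?thesis
  proof (rule continuous_map_eq)
    fix x assume "x \<in> topspace (subtopology (edge_topology D) (e ` edge_params e))"
    then obtain t where "t \<in> edge_params e" "x = e t" by auto
    then show "g x = the_inv_into (edge_params e) e x"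
      using ge the_inv_into_f_f[OF inj_edge_params[OF assms]] by simp
  qed
qed

end

section \<open>Maps sending edges to edges\<close>

text \<open>Keeping the parameter \<open>t\<close> fixed is what makes such a map light, simplicial
  and orientation preserving at once; \<open>edge_lift\<close> supplies surjectivity.\<close>

locale digraph_map = G2: closed_digraph V2 D2 + G1: closed_digraph V1 D1
  for V2 :: "'b set" and D2 and V1 :: "'c set" and D1 +
  fixes f :: "'b \<Rightarrow> 'c"
  assumes edge_to_edge: "e \<in> D2 \<Longrightarrow> \<exists>e'\<in>D1. \<forall>t\<in>{0..1}. f (e t) = e' t"
    and edge_lift: "e' \<in> D1 \<Longrightarrow> \<exists>e\<in>D2. \<forall>t\<in>{0..1}. f (e t) = e' t"
begin

lemma continuous: "continuous_map (edge_topology D2) (edge_topology D1) f"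
proof (rule continuous_map_from_edges)
  fix e assume "e \<in> D2"
  then obtain e' where e': "e' \<in> D1" "\<forall>t\<in>{0..1}. f (e t) = e' t" using edge_to_edge by blast
  show "continuous_map (top_of_set {0..1}) (edge_topology D1) (\<lambda>t. f (e t))"
    by (rule continuous_map_eq[OF continuous_map_edge[OF e'(1)]]) (use e' in simp)
qed

lemma onto: "f ` topspace (edge_topology D2) = topspace (edge_topology D1)"
proof
  show "f ` topspace (edge_topology D2) \<subseteq> topspace (edge_topology D1)"
    using continuous by (simp add: continuous_map_image_subset_topspace)
  show "topspace (edge_topology D1) \<subseteq> f ` topspace (edge_topology D2)"
  proof
    fix y assume "y \<in> topspace (edge_topology D1)"
    then obtain e' t where e': "e' \<in> D1" "t \<in> {0..1}" "y = e' t" by (rule topspace_edgeE)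
    then obtain e where e: "e \<in> D2" "f (e t) = y" using edge_lift[OF e'(1)] by auto
    show "y \<in> f ` topspace (edge_topology D2)"
      using imageI[OF edge_in_topspace[OF e(1) e'(2)], of f] unfolding e(2) .
  qed
qed

text \<open>By \<open>edge_eq\<close> an interior point determines its edge and its parameter, so a
  preimage of \<open>e' t\<close> sits at the same parameter of an edge over
  \<open>e'\<close>.\<close>

lemma preimage_edge_point:
  assumes "x \<in> topspace (edge_topology D2)" "e' \<in> D1" "0 < t" "t < 1" "f x = e' t"
  shows "\<exists>e\<in>D2. x = e t \<and> (\<forall>s\<in>{0..1}. f (e s) = e' s)"
proof -
  obtain e s where e: "e \<in> D2" and s: "s \<in> {0..1}" "x = e s" using assms(1) by (rule topspace_edgeE)
  obtain e'' where e'': "e'' \<in> D1" "\<forall>t\<in>{0..1}. f (e t) = e'' t" using edge_to_edge[OF e] by blast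
  have "e' = e'' \<and> t = s" using G1.edge_eq[of e' e'' t s] assms e'' s by auto
  then have "x = e t \<and> (\<forall>s\<in>{0..1}. f (e s) = e' s)" using s e'' by simp
  then show ?thesis using e by (rule bexI)
qed

lemma vertex_to_vertex: "f ` V2 \<subseteq> V1"
proof
  fix y assume "y \<in> f ` V2"
  then obtain v where v: "v \<in> V2" "y = f v" by blast
  from v(1) obtain e where e: "e \<in> D2" "v = e 0" unfolding G2.V0 by blast
  obtain e' where e': "e' \<in> D1" "\<forall>t\<in>{0..1}. f (e t) = e' t" using edge_to_edge[OF e(1)] by blast
  then show "y \<in> V1" using v e G1.ends_in_V(1)[of e'] by simp
qed

text \<open>Fibres are finite: over a vertex they consist of vertices, and over an interior point
  they contain at most one point of each edge.\<close>

lemma light: "light (edge_topology D2) (edge_topology D1) f"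
  unfolding light_def
proof
  fix y assume y: "y \<in> topspace (edge_topology D1)"
  have "finite {x \<in> topspace (edge_topology D2). f x = y}"
  proof (cases "y \<in> V1")
    case True
    have "{x \<in> topspace (edge_topology D2). f x = y} \<subseteq> V2"
    proof
      fix x assume x: "x \<in> {x \<in> topspace (edge_topology D2). f x = y}"
      then have "x \<in> topspace (edge_topology D2)" by simp
      then obtain e t where e: "e \<in> D2" and t: "t \<in> {0..1}" "x = e t" by (rule topspace_edgeE)
      obtain e' where e': "e' \<in> D1" "\<forall>t\<in>{0..1}. f (e t) = e' t" using edge_to_edge[OF e] by blast
      then have "t = 0 \<or> t = 1" using G1.V_cases[OF True e'(1), of t] t x by auto
      then show "x \<in> V2" using t G2.ends_in_V[of e] e by auto
    qed
    then show ?thesis using G2.finite_V finite_subset by blast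
  next
    case False
    obtain e' t where e': "e' \<in> D1" and t: "t \<in> {0..1}" "y = e' t" using y by (rule topspace_edgeE)
    then have t': "0 < t" "t < 1" using False G1.ends_in_V[of e'] e' by (auto simp: less_le)
    have "{x \<in> topspace (edge_topology D2). f x = y} \<subseteq> (\<lambda>e. e t) ` D2"
    proof
      fix x assume "x \<in> {x \<in> topspace (edge_topology D2). f x = y}"
      then obtain e where "e \<in> D2" "x = e t"
        using preimage_edge_point[OF _ e' t', of x] t by blast
      then show "x \<in> (\<lambda>e. e t) ` D2" by (simp add: image_eqI[of _ _ e])
    qed
    then show ?thesis using G2.fin finite_subset by blast
  qed
  then show "totally_disconnectedin (edge_topology D2) {x \<in> topspace (edge_topology D2). f x = y}"
    by (intro totally_disconnectedin_finite[OF G2.Hausdorff_space_edge_topology]) auto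
qed

text \<open>On an open edge \<open>f\<close> equals \<open>e' \<circ> g\<close> with
  \<open>g\<close> the inverse of \<open>e\<close>. The given vertex sets \<open>V2\<close> and
  \<open>V1\<close> are the witnesses, and no edge is collapsed.\<close>

lemma simplicial: "simplicial (edge_topology D2) (edge_topology D1) f"
proof -
  have "simplicial_rel (edge_topology D2) V2 ((\<lambda>e. e ` {0..1}) ` D2)
          (edge_topology D1) V1 ((\<lambda>e. e ` {0..1}) ` D1) f"
    unfolding simplicial_rel_def
  proof (intro conjI ballI)
    fix c assume "c \<in> (\<lambda>e. e ` {0..1}) ` D2"
    then obtain e where e: "e \<in> D2" "c = e ` {0..1}" by blast
    obtain e' where e': "e' \<in> D1" "\<forall>t\<in>{0..1}. f (e t) = e' t" using edge_to_edge[OF e(1)] by blast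
    obtain g where g: "homeomorphic_maps (top_of_set {0<..<1})
        (subtopology (edge_topology D2) (e ` {0<..<1})) e g"
      using G2.edge_homeomorphic[OF e(1)] homeomorphic_map_maps by blast
    have "homeomorphic_map (subtopology (edge_topology D2) (e ` {0<..<1}))
        (subtopology (edge_topology D1) (e' ` {0<..<1})) (e' \<circ> g)"
      using homeomorphic_map_compose[OF _ G1.edge_homeomorphic[OF e'(1)]] g
        homeomorphic_map_maps homeomorphic_maps_sym by blast
    then have "homeomorphic_map (subtopology (edge_topology D2) (e ` {0<..<1}))
        (subtopology (edge_topology D1) (e' ` {0<..<1})) f"
    proof (rule homeomorphic_map_eq)
      fix x assume "x \<in> topspace (subtopology (edge_topology D2) (e ` {0<..<1}))"
      then obtain t where t: "t \<in> {0<..<1}" "x = e t" by auto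
      then have "g x = t" using g by (simp add: homeomorphic_maps_def)
      then show "(e' \<circ> g) x = f x" using t e' by simp
    qed
    then have "homeomorphic_map (subtopology (edge_topology D2) (c - V2))
        (subtopology (edge_topology D1) (e' ` {0..1} - V1)) f"
      using G2.edge_minus_V[OF e(1)] G1.edge_minus_V[OF e'(1)] e by simp
    then show "\<exists>e1\<in>(\<lambda>e. e ` {0..1}) ` D1. homeomorphic_map (subtopology (edge_topology D2) (c - V2))
             (subtopology (edge_topology D1) (e1 - V1)) f \<or> f constant_on (c - V2)"
      using e'(1) by blast
  qed (use continuous onto vertex_to_vertex in auto)
  then show ?thesis
    unfolding simplicial_def finite_graph_def
    using G2.finite_directed_graph G1.finite_directed_graph by blast
qed

text \<open>If the edge coordinate \<open>g\<close> of \<open>f \<circ> p\<close> decreased, it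
  would do so over a time interval on which it stays strictly between 0 and 1. There
  \<open>p\<close> cannot change edges, its coordinate on a single edge of \<open>D2\<close> is
  again \<open>g\<close>, and the monotonicity of \<open>p\<close> applies. The interval has to be
  isolated first, because at vertices \<open>p\<close> may pass from one edge to another.\<close>

lemma op_path_image:
  assumes "op_path (edge_topology D2) D2 p"
  shows "op_path (edge_topology D1) D1 (f \<circ> p)"
  unfolding op_path_def
proof (intro conjI allI ballI impI)
  have pc: "continuous_map (top_of_set {0..1}) (edge_topology D2) p"
    using assms by (simp add: op_path_def)
  then show fpc: "continuous_map (top_of_set {0..1}) (edge_topology D1) (f \<circ> p)"
    using continuous continuous_map_compose by blast
  fix I e
  assume e: "e \<in> D1" and I: "is_interval I \<and> I \<subseteq> {0..1} \<and> (f \<circ> p) ` I \<subseteq> e ` edge_params e"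
  define g where "g = the_inv_into (edge_params e) e \<circ> (f \<circ> p)"
  have eg: "e (g w) = f (p w)" if "w \<in> I" for w
    using I that by (auto simp: g_def intro!: f_the_inv_into_f[OF G1.inj_edge_params[OF e]])
  have "continuous_map (top_of_set I) (subtopology (edge_topology D1) (e ` edge_params e)) (f \<circ> p)"
    using I continuous_map_from_subtopology_mono[OF fpc, of I]
    by (auto simp: continuous_map_in_subtopology)
  then have "continuous_map (top_of_set I) euclideanreal g"
    unfolding g_def by (rule continuous_map_compose[OF _ G1.continuous_map_edge_inverse[OF e]])
  then have gI: "continuous_on I g" by simp
  show "mono_on I (the_inv_into (edge_params e) e \<circ> (f \<circ> p))"
    unfolding g_def[symmetric]
  proof (rule ccontr)
    assume "\<not> mono_on I g"
    then obtain u v where uv: "u \<in> I" "v \<in> I" "u \<le> v" "g v < g u"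
      by (auto simp: mono_on_def not_le)
    have "{u..v} \<subseteq> I"
    proof
      fix x assume "x \<in> {u..v}"
      then show "x \<in> I" using I uv mem_is_interval_1_I[of I u v x] by auto
    qed
    then have guv: "continuous_on {u..v} g" using gI continuous_on_subset by blast
    \<comment> \<open>Two levels strictly between \<open>g v\<close> and \<open>g u\<close> stay
      away from 0 and 1, hence from the vertices.\<close>
    obtain c1 where c1: "g v < c1" "c1 < g u" using dense uv(4) by blast
    obtain c2 where c2: "g v < c2" "c2 < c1" using dense c1(1) by blast
    have g01: "g w \<in> {0..1}" if "w \<in> I" for w
    proof -
      have "g w \<in> edge_params e" unfolding g_def comp_def
        using I that by (intro the_inv_into_into[OF G1.inj_edge_params[OF e]]) auto
      then show ?thesis by (auto simp: edge_params_def split: if_splits)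
    qed
    have c01: "0 < c2" "c1 < 1" using c1 c2 g01[OF uv(1)] g01[OF uv(2)] by auto
    \<comment> \<open>\<open>u'\<close> is the last time at level \<open>c1\<close>, and
      \<open>v'\<close> the first time after it at level \<open>c2\<close>; in between
      \<open>g\<close> is trapped between the two levels.\<close>
    define S where "S = {w \<in> {u..v}. g w = c1}"
    have "closed S" unfolding S_def
      by (rule continuous_closed_preimage_constant[OF guv]) simp
    moreover have "bounded S" unfolding S_def by (rule bounded_subset[of "{u..v}"]) auto
    ultimately have "compact S" by (simp add: compact_eq_bounded_closed)
    moreover have "S \<noteq> {}" unfolding S_def using IVT2'[of g v c1 u, OF _ _ _ guv] c1 uv by force
    ultimately obtain u' where u': "u' \<in> S" "\<And>w. w \<in> S \<Longrightarrow> w \<le> u'"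
      using compact_attains_sup[of S] by auto
    have u'2: "u \<le> u'" "u' \<le> v" "g u' = c1" using u' by (auto simp: S_def)
    have gu'v: "continuous_on {u'..v} g"
      by (rule continuous_on_subset[OF guv]) (use u'2 in simp)
    define T where "T = {w \<in> {u'..v}. g w = c2}"
    have "closed T" unfolding T_def
      by (rule continuous_closed_preimage_constant[OF gu'v]) simp
    moreover have "bounded T" unfolding T_def by (rule bounded_subset[of "{u..v}"]) (use u'2 in auto)
    ultimately have "compact T" by (simp add: compact_eq_bounded_closed)
    moreover have "T \<noteq> {}" unfolding T_def using IVT2'[of g v c2 u', OF _ _ _ gu'v] c2 u'2 by force
    ultimately obtain v' where v': "v' \<in> T" "\<And>w. w \<in> T \<Longrightarrow> v' \<le> w"
      using compact_attains_inf[of T] by auto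
    have v'2: "u' \<le> v'" "v' \<le> v" "g v' = c2" using v' by (auto simp: T_def)
    have range: "c2 \<le> g w \<and> g w \<le> c1" if w: "w \<in> {u'..v'}" for w
    proof (rule ccontr)
      assume "\<not> ?thesis"
      then consider "g w < c2" | "c1 < g w" by linarith
      then show False
      proof cases
        case 1
        have "continuous_on {u'..w} g" using gu'v by (rule continuous_on_subset) (use w v'2 in auto)
        then obtain x where x: "u' \<le> x" "x \<le> w" "g x = c2" using IVT2'[of g w c2 u'] 1 c2 u'2 w by force
        then have "x \<in> T" using w v'2 by (auto simp: T_def)
        then have "v' \<le> x" by (rule v')
        then have "x = w" using x(2) w by simp
        then show False using x(3) 1 by simp
      next
        case 2
        have "continuous_on {w..v} g" using guv by (rule continuous_on_subset) (use w u'2 in auto)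
        then obtain x where x: "w \<le> x" "x \<le> v" "g x = c1" using IVT2'[of g v c1 w] 2 c1 v'2 w by force
        then have "x \<in> S" using w u'2 by (auto simp: S_def)
        then have "x \<le> u'" by (rule u')
        then have "x = w" using x(1) w by simp
        then show False using x(3) 2 by simp
      qed
    qed
    have sub: "{u'..v'} \<subseteq> I" using \<open>{u..v} \<subseteq> I\<close> u'2 v'2 by auto
    have lift: "\<exists>e2\<in>D2. p w = e2 (g w) \<and> (\<forall>s\<in>{0..1}. f (e2 s) = e s)" if "w \<in> {u'..v'}" for w
    proof (rule preimage_edge_point[OF _ e])
      show "p w \<in> topspace (edge_topology D2)"
        using continuous_map_funspace[OF pc] that sub I by (metis Pi_mem subsetD topspace_euclidean_subtopology)
      show "0 < g w" "g w < 1" using range[OF that] c01 by auto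
      show "f (p w) = e (g w)" using eg that sub by auto
    qed
    obtain e2 where e2: "e2 \<in> D2" "p u' = e2 (g u')" "\<forall>s\<in>{0..1}. f (e2 s) = e s"
      using lift[of u'] v'2 by auto
    \<comment> \<open>The open edge \<open>e2\<close> and the union of the other open edges are
      disjoint open sets covering this stretch of \<open>p\<close>, so by connectedness it stays in
      \<open>e2\<close>.\<close>
    define O1 where "O1 = e2 ` {0<..<1}"
    define O2 where "O2 = (\<Union>e\<in>D2 - {e2}. e ` {0<..<1})"
    have O1: "openin (edge_topology D2) O1" unfolding O1_def by (rule G2.openin_open_edge[OF e2(1)])
    have O2: "openin (edge_topology D2) O2" unfolding O2_def using G2.openin_open_edge by blast
    have "connectedin (edge_topology D2) (p ` {u'..v'})"
    proof (rule connectedin_continuous_map_image[OF pc])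
      have "{u'..v'} \<subseteq> {0..1}" using sub I by (meson subset_trans)
      then show "connectedin (top_of_set {0..1}) {u'..v'}" by (simp add: connectedin_subtopology)
    qed
    moreover have "p ` {u'..v'} \<subseteq> O1 \<union> O2"
    proof
      fix x assume "x \<in> p ` {u'..v'}"
      then obtain w where w: "w \<in> {u'..v'}" "x = p w" by blast
      obtain e3 where e3: "e3 \<in> D2" "p w = e3 (g w)" using lift[OF w(1)] by blast
      have "g w \<in> {0<..<1}" using range[OF w(1)] c01 by auto
      then have "x \<in> e3 ` {0<..<1}" using w e3 by simp
      then show "x \<in> O1 \<union> O2" using e3(1) unfolding O1_def O2_def by (cases "e3 = e2") auto
    qed
    moreover have "O1 \<inter> O2 \<inter> p ` {u'..v'} = {}"
    proof -
      have "e2 s \<noteq> e' t" if "e' \<in> D2" "e' \<noteq> e2" "s \<in> {0<..<1}" "t \<in> {0<..<1}" for e' s t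
        using G2.edge_eq[of e2 e' s t] that e2(1) by auto
      then show ?thesis unfolding O1_def O2_def by blast
    qed
    moreover have "O1 \<inter> p ` {u'..v'} \<noteq> {}"
    proof -
      have "g u' \<in> {0<..<1}" using range[of u'] c01 v'2 by auto
      then have "p u' \<in> O1" unfolding O1_def e2(2) by (rule imageI)
      then show ?thesis using v'2 by auto
    qed
    ultimately have inO1: "p ` {u'..v'} \<subseteq> O1"
      using connectedin_subset_left[OF _ O1 O2] by blast
    have par: "{0<..<1} \<subseteq> edge_params e2" by (auto simp: edge_params_def)
    have "p ` {u'..v'} \<subseteq> e2 ` edge_params e2" using inO1 par unfolding O1_def by blast
    then have mono: "mono_on {u'..v'} (the_inv_into (edge_params e2) e2 \<circ> p)"
      using assms e2(1) sub I unfolding op_path_def by (metis is_interval_cc subset_trans)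
    have val: "the_inv_into (edge_params e2) e2 (p w) = g w" if w: "w \<in> {u'..v'}" for w
    proof -
      obtain t where t: "t \<in> {0<..<1}" "p w = e2 t" using inO1 w unfolding O1_def by blast
      have "e (g w) = e t" using eg[of w] w sub t e2(3) by auto
      moreover have "0 < g w" "g w < 1" using range[OF w] c01 by auto
      ultimately have "g w = t" using G1.edge_eq[OF e e, of "g w" t] t by auto
      then show ?thesis
        using t par the_inv_into_f_f[OF G2.inj_edge_params[OF e2(1)], of t] by auto
    qed
    have "g u' \<le> g v'"
      using monotone_onD[OF mono, of u' v'] v'2 val[of u'] val[of v'] by auto
    then show False using u'2 v'2 c2 by simp
  qed
qed

lemma orientation_preserving:
  "orientation_preserving (edge_topology D2) D2 (edge_topology D1) D1 f"
  unfolding orientation_preserving_def by (intro conjI allI impI continuous op_path_image)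

end

section \<open>Inverse limits from clopen partitions\<close>

lemma finite_image_factor:
  assumes "finite (f ` A)" "\<And>x y. x \<in> A \<Longrightarrow> y \<in> A \<Longrightarrow> f x = f y \<Longrightarrow> g x = g y"
  shows "finite (g ` A)"
proof -
  have "g x = g (inv_into A f (f x))" if "x \<in> A" for x
    using assms(2)[OF that inv_into_into[of "f x" f A]] that by (simp add: f_inv_into_f)
  then have "g ` A \<subseteq> (\<lambda>l. g (inv_into A f l)) ` f ` A" by auto
  then show ?thesis by (rule finite_surj[OF assms(1)])
qed

lemma openin_Collect_all_less:
  assumes "\<And>n::nat. n < k \<Longrightarrow> openin X {x \<in> topspace X. P n x}"
  shows "openin X {x \<in> topspace X. \<forall>n<k. P n x}"
  using assms
proof (induction k)
  case (Suc k)
  have "{x \<in> topspace X. \<forall>n<Suc k. P n x} = {x \<in> topspace X. \<forall>n<k. P n x} \<inter> {x \<in> topspace X. P k x}"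
    using less_Suc_eq by auto
  then show ?case using Suc by (simp add: openin_Int)
qed auto

text \<open>The sets \<open>C n\<close> separate the arcs, and the sets \<open>B n\<close> separate the points of the
  transversal, which consists of the end points of the arcs.\<close>

locale arc_bundle =
  fixes Z :: "'z topology" and Y :: "'a topology" and q :: "'z \<Rightarrow> real \<Rightarrow> 'a"
    and C :: "nat \<Rightarrow> 'z set" and B :: "nat \<Rightarrow> 'a set"
  assumes compact_Z: "compact_space Z" and Hausdorff_Y: "Hausdorff_space Y"
    and q_cont: "continuous_map (prod_topology Z (top_of_set {0..1})) Y (\<lambda>(z, t). q z t)"
    and q_onto: "y \<in> topspace Y \<Longrightarrow> \<exists>z\<in>topspace Z. \<exists>t\<in>{0..1}. y = q z t"
    and q_inj: "\<lbrakk>z \<in> topspace Z; z' \<in> topspace Z; 0 < t; t < 1; 0 \<le> t'; t' \<le> 1; q z t = q z' t'\<rbrakk>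
                \<Longrightarrow> z = z' \<and> t = t'"
    and start_is_end: "z \<in> topspace Z \<Longrightarrow> \<exists>z'\<in>topspace Z. q z' 1 = q z 0"
    and end_is_start: "z \<in> topspace Z \<Longrightarrow> \<exists>z'\<in>topspace Z. q z' 0 = q z 1"
    and C_clopen: "openin Z (C n)" "closedin Z (C n)"
    and C_sep: "\<lbrakk>z \<in> topspace Z; z' \<in> topspace Z; z \<noteq> z'\<rbrakk> \<Longrightarrow> \<exists>n. (z \<in> C n) \<noteq> (z' \<in> C n)"
    and B_clopen: "i \<in> {0, 1} \<Longrightarrow> openin Z {z \<in> topspace Z. q z i \<in> B n}"
      "i \<in> {0, 1} \<Longrightarrow> closedin Z {z \<in> topspace Z. q z i \<in> B n}"
    and B_sep: "\<lbrakk>z \<in> topspace Z; z' \<in> topspace Z; i \<in> {0, 1}; i' \<in> {0, 1}; q z i \<noteq> q z' i'\<rbrakk>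
                \<Longrightarrow> \<exists>n. (q z i \<in> B n) \<noteq> (q z' i' \<in> B n)"
begin

text \<open>A vertex of the \<open>k\<close>-th graph is a pair \<open>(l, 0)\<close>, and an interior point of an edge is a pair
  \<open>(l, t)\<close> with \<open>0 < t < 1\<close>, where \<open>l\<close> encodes a cell of the \<open>k\<close>-th partition.  An edge label
  includes the labels of the end vertices.\<close>

definition vlabel :: "nat \<Rightarrow> 'a \<Rightarrow> nat" where
  "vlabel k y = set_encode {n. n < k \<and> y \<in> B n}"

definition elabel :: "nat \<Rightarrow> 'z \<Rightarrow> nat" where
  "elabel k z = prod_encode (set_encode {n. n < k \<and> z \<in> C n},
     prod_encode (vlabel k (q z 0), vlabel k (q z 1)))"

definition \<rho> :: "nat \<Rightarrow> 'z \<Rightarrow> real \<Rightarrow> nat \<times> real" where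
  "\<rho> k z t = (if t = 0 then (vlabel k (q z 0), 0) else if t = 1 then (vlabel k (q z 1), 0)
     else (elabel k z, t))"

definition D :: "nat \<Rightarrow> (real \<Rightarrow> nat \<times> real) set" where
  "D k = \<rho> k ` topspace Z"

definition V :: "nat \<Rightarrow> (nat \<times> real) set" where
  "V k = (\<lambda>e. e 0) ` D k"

definition X :: "nat \<Rightarrow> (nat \<times> real) topology" where
  "X k = edge_topology (D k)"

text \<open>Pull back along \<open>\<rho> k\<close>, push down along \<open>\<rho> (k - 1)\<close>.
  The preimage is not unique, but for \<open>k > 0\<close> the result does not depend on it by
  \<open>\<rho>_refines\<close>.\<close>

definition bond :: "nat \<Rightarrow> nat \<times> real \<Rightarrow> nat \<times> real" where
  "bond k x = (let p = (SOME p. fst p \<in> topspace Z \<and> snd p \<in> {0..1} \<and> \<rho> k (fst p) (snd p) = x)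
     in \<rho> (k - 1) (fst p) (snd p))"

lemma vlabel_eq_iff: "vlabel k y = vlabel k y' \<longleftrightarrow> (\<forall>n<k. y \<in> B n \<longleftrightarrow> y' \<in> B n)"
  unfolding vlabel_def by (subst inj_on_eq_iff[OF inj_on_set_encode]) auto

lemma elabel_eq_iff: "elabel k z = elabel k z' \<longleftrightarrow>
    (\<forall>n<k. (z \<in> C n \<longleftrightarrow> z' \<in> C n) \<and> (q z 0 \<in> B n \<longleftrightarrow> q z' 0 \<in> B n) \<and> (q z 1 \<in> B n \<longleftrightarrow> q z' 1 \<in> B n))"
proof -
  have "set_encode {n. n < k \<and> z \<in> C n} = set_encode {n. n < k \<and> z' \<in> C n} \<longleftrightarrow>
      (\<forall>n<k. z \<in> C n \<longleftrightarrow> z' \<in> C n)"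
    by (subst inj_on_eq_iff[OF inj_on_set_encode]) auto
  then show ?thesis
    unfolding elabel_def prod_encode_eq by (auto simp: vlabel_eq_iff)
qed

text \<open>The labels of both ends are part of \<open>elabel\<close>. Without them, arcs in one
  cell of the sets \<open>C n\<close> could end in different cells of the sets \<open>B n\<close>
  and would not define a single edge.\<close>

lemma \<rho>_cong: "elabel k z = elabel k z' \<Longrightarrow> \<rho> k z = \<rho> k z'"
  by (rule ext) (simp add: \<rho>_def elabel_def prod_encode_eq)

lemma finite_D: "finite (D k)"
proof -
  have v: "vlabel k y \<in> set_encode ` Pow {..<k}" for y by (auto simp: vlabel_def)
  have "elabel k z \<in> prod_encode ` (set_encode ` Pow {..<k} \<times>
      prod_encode ` (set_encode ` Pow {..<k} \<times> set_encode ` Pow {..<k}))" for z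
    unfolding elabel_def using v by (auto intro!: imageI)
  then have "elabel k ` topspace Z \<subseteq> prod_encode ` (set_encode ` Pow {..<k} \<times>
      prod_encode ` (set_encode ` Pow {..<k} \<times> set_encode ` Pow {..<k}))" by blast
  then have "finite (elabel k ` topspace Z)" by (rule finite_subset) simp
  then show ?thesis unfolding D_def by (rule finite_image_factor) (rule \<rho>_cong)
qed

text \<open>\<open>start_is_end\<close> and \<open>end_is_start\<close> make the sets of initial and
  of terminal vertices equal. For \<open>edge_eq\<close>, interior points are told apart from
  vertices by their nonzero second component, which also shows the parameter.\<close>

lemma closed_digraph: "closed_digraph (V k) (D k)"
proof
  show "V k = (\<lambda>e. e 1) ` D k"
  proof (intro equalityI subsetI)
    fix x assume "x \<in> V k"
    then obtain z where z: "z \<in> topspace Z" "x = \<rho> k z 0" by (auto simp: V_def D_def)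
    obtain z' where "z' \<in> topspace Z" "q z' 1 = q z 0" using start_is_end[OF z(1)] by blast
    then show "x \<in> (\<lambda>e. e 1) ` D k" using z by (auto simp: D_def image_image \<rho>_def intro!: image_eqI[of _ _ z'])
  next
    fix x assume "x \<in> (\<lambda>e. e 1) ` D k"
    then obtain z where z: "z \<in> topspace Z" "x = \<rho> k z 1" by (auto simp: D_def)
    obtain z' where "z' \<in> topspace Z" "q z' 0 = q z 1" using end_is_start[OF z(1)] by blast
    then show "x \<in> V k" using z by (auto simp: V_def D_def image_image \<rho>_def intro!: image_eqI[of _ _ z'])
  qed
  fix e e' :: "real \<Rightarrow> nat \<times> real" and t t' :: real
  assume a: "e \<in> D k" "e' \<in> D k" "0 < t" "t < 1" "0 \<le> t'" "t' \<le> 1" "e t = e' t'"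
  obtain z z' where z: "e = \<rho> k z" "e' = \<rho> k z'" using a(1,2) by (auto simp: D_def)
  have "t = t' \<and> elabel k z = elabel k z'"
    using a(3-) unfolding z by (auto simp: \<rho>_def split: if_splits)
  then show "e = e' \<and> t = t'" using \<rho>_cong z by blast
qed (simp_all add: finite_D V_def)

text \<open>Labels at level \<open>Suc k\<close> test one more set of each sequence than those at
  level \<open>k\<close>, so they determine the latter.\<close>

lemma \<rho>_refines:
  assumes "\<rho> (Suc k) z t = \<rho> (Suc k) z' t'" "t \<in> {0..1}" "t' \<in> {0..1}"
  shows "\<rho> k z t = \<rho> k z' t'"
proof -
  have v: "vlabel (Suc k) y = vlabel (Suc k) y' \<Longrightarrow> vlabel k y = vlabel k y'" for y y'
    unfolding vlabel_eq_iff by simp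
  have e: "elabel (Suc k) z = elabel (Suc k) z' \<Longrightarrow> elabel k z = elabel k z'"
    unfolding elabel_eq_iff by simp
  show ?thesis using assms by (auto simp: \<rho>_def split: if_splits intro: v e)
qed

lemma bond_\<rho>:
  assumes "z \<in> topspace Z" "t \<in> {0..1}"
  shows "bond (Suc k) (\<rho> (Suc k) z t) = \<rho> k z t"
proof -
  define p where "p = (SOME p. fst p \<in> topspace Z \<and> snd p \<in> {0..1} \<and>
    \<rho> (Suc k) (fst p) (snd p) = \<rho> (Suc k) z t)"
  have "fst p \<in> topspace Z \<and> snd p \<in> {0..1} \<and> \<rho> (Suc k) (fst p) (snd p) = \<rho> (Suc k) z t"
    unfolding p_def by (rule someI[of _ "(z, t)"]) (use assms in simp)
  then have "\<rho> k (fst p) (snd p) = \<rho> k z t" using \<rho>_refines assms by blast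
  then show ?thesis by (simp add: bond_def p_def)
qed

lemma digraph_map: "digraph_map (V (Suc k)) (D (Suc k)) (V k) (D k) (bond (Suc k))"
  unfolding digraph_map_def digraph_map_axioms_def
proof (intro conjI closed_digraph allI impI)
  fix e assume "e \<in> D (Suc k)"
  then obtain z where z: "z \<in> topspace Z" "e = \<rho> (Suc k) z" by (auto simp: D_def)
  then show "\<exists>e'\<in>D k. \<forall>t\<in>{0..1}. bond (Suc k) (e t) = e' t"
    using bond_\<rho>[OF z(1)] by (auto simp: D_def)
next
  fix e' assume "e' \<in> D k"
  then obtain z where z: "z \<in> topspace Z" "e' = \<rho> k z" by (auto simp: D_def)
  then show "\<exists>e\<in>D (Suc k). \<forall>t\<in>{0..1}. bond (Suc k) (e t) = e' t"
    using bond_\<rho>[OF z(1)] by (intro bexI[of _ "\<rho> (Suc k) z"]) (auto simp: D_def)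
qed

abbreviation P :: "('z \<times> real) topology" where
  "P \<equiv> prod_topology Z (top_of_set {0..1})"

lemma compact_P: "compact_space P"
  using compact_Z by (simp add: compact_space_prod_topology compact_space_subtopology)

lemma \<rho>_in_X: "z \<in> topspace Z \<Longrightarrow> t \<in> {0..1} \<Longrightarrow> \<rho> k z t \<in> topspace (X k)"
  unfolding X_def by (rule edge_in_topspace) (auto simp: D_def)

lemma openin_elabel_fibre: "openin Z {z \<in> topspace Z. elabel k z = elabel k z0}"
proof -
  have decide: "openin Z {z \<in> topspace Z. Q z \<longleftrightarrow> b}"
    if "openin Z {z \<in> topspace Z. Q z}" "closedin Z {z \<in> topspace Z. Q z}" for Q b
  proof (cases b)
    case False
    have "{z \<in> topspace Z. \<not> Q z} = topspace Z - {z \<in> topspace Z. Q z}" by auto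
    then show ?thesis using False that(2) openin_diff[OF openin_topspace that(2)] by simp
  qed (use that in simp)
  have C: "{z \<in> topspace Z. z \<in> C n} = C n" for n using C_clopen(1)[of n] openin_subset by auto
  have "openin Z {z \<in> topspace Z. (z \<in> C n \<longleftrightarrow> z0 \<in> C n) \<and> (q z 0 \<in> B n \<longleftrightarrow> q z0 0 \<in> B n) \<and>
      (q z 1 \<in> B n \<longleftrightarrow> q z0 1 \<in> B n)}" for n
  proof -
    have "{z \<in> topspace Z. (z \<in> C n \<longleftrightarrow> z0 \<in> C n) \<and> (q z 0 \<in> B n \<longleftrightarrow> q z0 0 \<in> B n) \<and>
      (q z 1 \<in> B n \<longleftrightarrow> q z0 1 \<in> B n)} = {z \<in> topspace Z. z \<in> C n \<longleftrightarrow> z0 \<in> C n} \<inter>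
      ({z \<in> topspace Z. q z 0 \<in> B n \<longleftrightarrow> q z0 0 \<in> B n} \<inter> {z \<in> topspace Z. q z 1 \<in> B n \<longleftrightarrow> q z0 1 \<in> B n})"
      by auto
    then show ?thesis using decide C_clopen B_clopen C by (simp add: openin_Int)
  qed
  then show ?thesis unfolding elabel_eq_iff by (rule openin_Collect_all_less)
qed

text \<open>On the open set where \<open>elabel k\<close> has a fixed value, \<open>\<rho> k\<close>
  does not depend on \<open>z\<close>; the preimage of an open set is therefore a union of open
  rectangles.\<close>

lemma continuous_map_\<rho>: "continuous_map P (X k) (\<lambda>(z, t). \<rho> k z t)"
  unfolding continuous_map_def
proof (intro conjI allI impI)
  show "(\<lambda>(z, t). \<rho> k z t) \<in> topspace P \<rightarrow> topspace (X k)" using \<rho>_in_X by auto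
  fix U assume U: "openin (X k) U"
  have "{x \<in> topspace P. (\<lambda>(z, t). \<rho> k z t) x \<in> U} =
      (\<Union>z0\<in>topspace Z. {z \<in> topspace Z. elabel k z = elabel k z0} \<times> {t \<in> {0..1}. \<rho> k z0 t \<in> U})"
    (is "?L = ?R")
  proof (intro equalityI subsetI)
    fix x assume "x \<in> ?L"
    then show "x \<in> ?R" by (cases x) auto
  next
    fix x assume "x \<in> ?R"
    then obtain z t z0 where z: "x = (z, t)" "z \<in> topspace Z" "t \<in> {0..1}"
      "elabel k z = elabel k z0" "\<rho> k z0 t \<in> U" by blast
    then show "x \<in> ?L" using \<rho>_cong[OF z(4)] by simp
  qed
  moreover have "openin P ({z \<in> topspace Z. elabel k z = elabel k z0} \<times> {t \<in> {0..1}. \<rho> k z0 t \<in> U})"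
    if "z0 \<in> topspace Z" for z0
  proof -
    have "\<rho> k z0 \<in> D k" using that by (simp add: D_def)
    then have "openin (top_of_set {0..1}) {t \<in> {0..1}. \<rho> k z0 t \<in> U}"
      using U by (simp add: X_def openin_edge_topology)
    then show ?thesis using openin_elabel_fibre unfolding openin_prod_Times_iff by blast
  qed
  ultimately show "openin P {x \<in> topspace P. (\<lambda>(z, t). \<rho> k z t) x \<in> U}"
    by (simp only:) (intro openin_Union, blast)
qed

lemma Hausdorff_X: "Hausdorff_space (X k)"
  unfolding X_def by (rule closed_digraph.Hausdorff_space_edge_topology[OF closed_digraph])

lemma Hausdorff_limit: "Hausdorff_space (inverse_limit X bond)"
  unfolding inverse_limit_def
  by (rule Hausdorff_space_subtopology) (simp add: Hausdorff_space_product_topology Hausdorff_X)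

lemma topspace_limit: "topspace (inverse_limit X bond) =
    {x. (\<forall>k. x k \<in> topspace (X k)) \<and> (\<forall>k. bond (Suc k) (x (Suc k)) = x k)}"
  unfolding inverse_limit_def by (auto simp: PiE_def)

definition \<rho>s :: "'z \<times> real \<Rightarrow> nat \<Rightarrow> nat \<times> real" where
  "\<rho>s p k = \<rho> k (fst p) (snd p)"

lemma continuous_map_\<rho>s: "continuous_map P (inverse_limit X bond) \<rho>s"
proof -
  have "continuous_map P (product_topology X UNIV) \<rho>s"
    using continuous_map_\<rho> by (simp add: continuous_map_componentwise_UNIV \<rho>s_def case_prod_unfold)
  then show ?thesis
    unfolding inverse_limit_def continuous_map_in_subtopology by (auto simp: \<rho>s_def bond_\<rho>)
qed

text \<open>For a thread \<open>x\<close>, the points of \<open>P\<close> that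
  \<open>\<rho> k\<close> sends to \<open>x k\<close> form a decreasing sequence of nonempty closed
  sets in a compact space.\<close>

lemma \<rho>s_onto: "\<rho>s ` topspace P = topspace (inverse_limit X bond)"
proof
  show "\<rho>s ` topspace P \<subseteq> topspace (inverse_limit X bond)"
    using continuous_map_\<rho>s by (rule continuous_map_image_subset_topspace)
  show "topspace (inverse_limit X bond) \<subseteq> \<rho>s ` topspace P"
  proof
    fix x assume x: "x \<in> topspace (inverse_limit X bond)"
    define F where "F k = {p \<in> topspace P. \<rho> k (fst p) (snd p) = x k}" for k
    have closed: "closedin P (F k)" for k
    proof -
      have "closedin (X k) {x k}"
        using x Hausdorff_X[of k] by (simp add: topspace_limit closedin_Hausdorff_singleton)
      then show ?thesis
        using closedin_continuous_map_preimage[OF continuous_map_\<rho>[of k], of "{x k}"]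
        by (simp add: F_def case_prod_unfold)
    qed
    have ne: "F k \<noteq> {}" for k
    proof -
      have "x k \<in> topspace (X k)" using x by (simp add: topspace_limit)
      then obtain e t where "e \<in> D k" "t \<in> {0..1}" "x k = e t" unfolding X_def by (rule topspace_edgeE)
      then show ?thesis by (auto simp: F_def D_def)
    qed
    have "F (Suc k) \<subseteq> F k" for k
    proof
      fix p assume p: "p \<in> F (Suc k)"
      then have "bond (Suc k) (\<rho> (Suc k) (fst p) (snd p)) = \<rho> k (fst p) (snd p)"
        by (intro bond_\<rho>) (auto simp: F_def)
      then show "p \<in> F k" using p x by (simp add: F_def topspace_limit)
    qed
    then have "decseq F" by (rule decseq_SucI)
    then obtain p where p: "\<And>k. p \<in> F k" using compact_space_imp_nest[of P F, OF compact_P closed ne] by blast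
    then have "\<rho>s p = x" "p \<in> topspace P" by (auto simp: F_def \<rho>s_def fun_eq_iff)
    then show "x \<in> \<rho>s ` topspace P" by blast
  qed
qed

text \<open>The limit makes the same identifications as \<open>q\<close>: an interior point shows
  its parameter as second component and its arc is determined by all labels together through
  \<open>C\<close>, while the ends of arcs are determined through \<open>B\<close>.\<close>

lemma \<rho>s_eq_iff:
  assumes "z \<in> topspace Z" "z' \<in> topspace Z" "t \<in> {0..1}" "t' \<in> {0..1}"
  shows "\<rho>s (z, t) = \<rho>s (z', t') \<longleftrightarrow> q z t = q z' t'"
proof -
  have end_point: "\<rho> k z t = (vlabel k (q z t), 0)" if "t \<in> {0, 1}" for k z t
    using that by (auto simp: \<rho>_def)
  consider "t \<in> {0, 1}" "t' \<in> {0, 1}" | "0 < t" "t < 1" | "0 < t'" "t' < 1"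
    using assms by fastforce
  then show ?thesis
  proof cases
    case 1
    have "(\<forall>k. vlabel k (q z t) = vlabel k (q z' t')) \<longleftrightarrow> q z t = q z' t'"
      using B_sep[OF assms(1,2) 1] by (auto simp: vlabel_eq_iff)
    then show ?thesis using 1 by (simp add: \<rho>s_def fun_eq_iff end_point del: insert_iff)
  next
    case 2
    have "z = z' \<and> t = t'" if "\<rho>s (z, t) = \<rho>s (z', t')"
    proof -
      have "\<rho> k z t = \<rho> k z' t'" for k using that by (metis \<rho>s_def fst_conv snd_conv)
      then have eq: "(elabel k z, t) = \<rho> k z' t'" for k using 2 by (simp add: \<rho>_def)
      then have "t = t'" using 2 by (metis \<rho>_def snd_conv less_irrefl)
      moreover have "elabel k z = elabel k z'" for k
        using eq[of k] 2 \<open>t = t'\<close> by (simp add: \<rho>_def)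
      then have "z = z'" using C_sep[OF assms(1,2)] unfolding elabel_eq_iff by blast
      ultimately show ?thesis by simp
    qed
    then show ?thesis using q_inj[OF assms(1,2) 2] assms by auto
  next
    case 3
    have "z = z' \<and> t = t'" if "\<rho>s (z, t) = \<rho>s (z', t')"
    proof -
      have "\<rho> k z' t' = \<rho> k z t" for k using that by (metis \<rho>s_def fst_conv snd_conv)
      then have eq: "(elabel k z', t') = \<rho> k z t" for k using 3 by (simp add: \<rho>_def)
      then have "t = t'" using 3 by (metis \<rho>_def snd_conv less_irrefl)
      moreover have "elabel k z = elabel k z'" for k
        using eq[of k] 3 \<open>t = t'\<close> by (simp add: \<rho>_def)
      then have "z = z'" using C_sep[OF assms(1,2)] unfolding elabel_eq_iff by blast
      ultimately show ?thesis by simp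
    qed
    then show ?thesis using q_inj[OF assms(2,1) 3] assms by force
  qed
qed

text \<open>\<open>Y\<close> and the inverse limit are Hausdorff quotients of the same compact
  space, and by \<open>\<rho>s_eq_iff\<close> the two quotient maps have the same fibres.\<close>

lemma limit_homeomorphic: "inverse_limit X bond homeomorphic_space Y"
proof -
  have onto: "(\<lambda>(z, t). q z t) ` topspace P = topspace Y"
    using continuous_map_image_subset_topspace[OF q_cont] q_onto by fastforce
  have "quotient_map P Y (\<lambda>(z, t). q z t)"
    by (rule continuous_imp_quotient_map[OF q_cont compact_P Hausdorff_Y onto])
  then obtain g where g: "continuous_map Y (inverse_limit X bond) g"
    "g ` topspace Y = \<rho>s ` topspace P" "\<And>p. p \<in> topspace P \<Longrightarrow> g ((\<lambda>(z, t). q z t) p) = \<rho>s p"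
    by (rule quotient_map_lift_exists[OF _ continuous_map_\<rho>s]) (use \<rho>s_eq_iff in auto)
  have "inj_on g (topspace Y)"
  proof (rule inj_onI)
    fix y y' assume y: "y \<in> topspace Y" "y' \<in> topspace Y" "g y = g y'"
    obtain z t where z: "z \<in> topspace Z" "t \<in> {0..1}" "y = q z t" using q_onto[OF y(1)] by blast
    obtain z' t' where z': "z' \<in> topspace Z" "t' \<in> {0..1}" "y' = q z' t'" using q_onto[OF y(2)] by blast
    show "y = y'" using g(3)[of "(z, t)"] g(3)[of "(z', t')"] z z' y(3) \<rho>s_eq_iff[of z z' t t'] by simp
  qed
  moreover have "compact_space Y"
    using compact_space_def image_compactin[of P "topspace P" Y] compact_P q_cont onto by metis
  ultimately have "homeomorphic_map Y (inverse_limit X bond) g"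
    using continuous_imp_homeomorphic_map[OF g(1) _ Hausdorff_limit] g(2) \<rho>s_onto by simp
  then show ?thesis
    using homeomorphic_map_imp_homeomorphic_space homeomorphic_space_sym by blast
qed

theorem directed_presentation: "directed_presentation X V D bond Y"
  unfolding directed_presentation_def light_simplicial_sequence_def X_def
proof (intro conjI allI)
  fix k
  interpret digraph_map "V (Suc k)" "D (Suc k)" "V k" "D k" "bond (Suc k)" by (rule digraph_map)
  show "finite_directed_graph (edge_topology (D k)) (V k) (D k)" by (rule G1.finite_directed_graph)
  show "nondegenerate (V k) (D k)" by (rule G1.nondegenerate)
  show "light (edge_topology (D (Suc k))) (edge_topology (D k)) (bond (Suc k))" by (rule light)
  show "simplicial (edge_topology (D (Suc k))) (edge_topology (D k)) (bond (Suc k))" by (rule simplicial)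
  show "orientation_preserving (edge_topology (D (Suc k))) (D (Suc k)) (edge_topology (D k)) (D k) (bond (Suc k))"
    by (rule orientation_preserving)
  show "inverse_limit (\<lambda>k. edge_topology (D k)) bond homeomorphic_space Y"
    using limit_homeomorphic unfolding X_def .
qed

end

section \<open>Transversals\<close>

definition side :: "bool \<Rightarrow> real set" where
  "side b = (if b then {0..<1} else {-1<..0})"

lemma side_bounds: "t \<in> side b \<Longrightarrow> -1 < t \<and> t < 1"
  by (auto simp: side_def split: if_splits)

lemma side_zero [simp]: "0 \<in> side b"
  by (simp add: side_def)

lemma side_unique: "t \<in> side b \<Longrightarrow> t \<in> side b' \<Longrightarrow> t \<noteq> 0 \<Longrightarrow> b = b'"
  by (auto simp: side_def split: if_splits)

lemma side_exists: "-1 < t \<Longrightarrow> t < 1 \<Longrightarrow> \<exists>b. t \<in> side b"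
  by (cases "0 \<le> t") (auto simp: side_def intro: exI[of _ True] exI[of _ False])

lemma side_convex: "s \<in> side b \<Longrightarrow> t \<in> side b \<Longrightarrow> {s..t} \<subseteq> side b"
  by (auto simp: side_def split: if_splits)

text \<open>\<open>p c\<close> is the height in the chart \<open>c\<close>, and \<open>G c b s t\<close> is the point at height \<open>t\<close> on the strand
  of \<open>s\<close>.  Strands with \<open>b = True\<close> lie above level \<open>0\<close>, those with \<open>b = False\<close> below.\<close>

locale oriented_charts =
  fixes Y :: "'a topology" and \<Omega> :: "'c set" and V :: "'c \<Rightarrow> 'a set" and p :: "'c \<Rightarrow> 'a \<Rightarrow> real"
    and S :: "'c \<Rightarrow> bool \<Rightarrow> 's topology" and G :: "'c \<Rightarrow> bool \<Rightarrow> 's \<Rightarrow> real \<Rightarrow> 'a"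
  assumes compact_Y: "compact_space Y" and Hausdorff_Y: "Hausdorff_space Y"
    and second_countable_Y: "second_countable Y"
    and covers: "topspace Y = (\<Union>c\<in>\<Omega>. V c)"
    and V_open: "c \<in> \<Omega> \<Longrightarrow> openin Y (V c)"
    and p_cont: "c \<in> \<Omega> \<Longrightarrow> continuous_map (subtopology Y (V c)) euclideanreal (p c)"
    and p_range: "c \<in> \<Omega> \<Longrightarrow> y \<in> V c \<Longrightarrow> -1 < p c y \<and> p c y < 1"
    and S_compact: "c \<in> \<Omega> \<Longrightarrow> compact_space (S c b)"
    and S_Hausdorff: "c \<in> \<Omega> \<Longrightarrow> Hausdorff_space (S c b)"
    and S_second_countable: "c \<in> \<Omega> \<Longrightarrow> second_countable (S c b)"
    and S_dim: "c \<in> \<Omega> \<Longrightarrow> S c b dim_le 0"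
    and G_cont: "c \<in> \<Omega> \<Longrightarrow> continuous_map (prod_topology (S c b) (top_of_set (side b))) Y (\<lambda>(s, t). G c b s t)"
    and G_in_V: "c \<in> \<Omega> \<Longrightarrow> s \<in> topspace (S c b) \<Longrightarrow> t \<in> side b \<Longrightarrow> G c b s t \<in> V c"
    and p_G: "c \<in> \<Omega> \<Longrightarrow> s \<in> topspace (S c b) \<Longrightarrow> t \<in> side b \<Longrightarrow> p c (G c b s t) = t"
    and G_onto: "c \<in> \<Omega> \<Longrightarrow> y \<in> V c \<Longrightarrow> p c y \<in> side b \<Longrightarrow> \<exists>s\<in>topspace (S c b). y = G c b s (p c y)"
    and G_inj: "c \<in> \<Omega> \<Longrightarrow> s \<in> topspace (S c b) \<Longrightarrow> s' \<in> topspace (S c b) \<Longrightarrow> t \<in> side b \<Longrightarrow> t \<noteq> 0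
      \<Longrightarrow> G c b s t = G c b s' t \<Longrightarrow> s = s'"
    and level_dim: "c \<in> \<Omega> \<Longrightarrow> subtopology Y {y \<in> V c. p c y = l} dim_le 0"
    and orient: "c \<in> \<Omega> \<Longrightarrow> d \<in> \<Omega> \<Longrightarrow> s \<in> topspace (S c b) \<Longrightarrow> t1 < t2 \<Longrightarrow> {t1..t2} \<subseteq> side b
      \<Longrightarrow> (\<forall>t\<in>{t1..t2}. G c b s t \<in> V d) \<Longrightarrow> p d (G c b s t1) < p d (G c b s t2)"
begin

definition box :: "'c \<Rightarrow> bool \<Rightarrow> 's set \<Rightarrow> real set \<Rightarrow> 'a set" where
  "box c b A T = {y. \<exists>s\<in>A. \<exists>t\<in>T. y = G c b s t}"

definition level :: "'c \<Rightarrow> real \<Rightarrow> 'a set" where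
  "level c l = {y \<in> V c. p c y = l}"

lemma box_memI: "s \<in> A \<Longrightarrow> t \<in> T \<Longrightarrow> G c b s t \<in> box c b A T"
  unfolding box_def by blast

lemma box_memE:
  assumes "y \<in> box c b A T"
  obtains s t where "s \<in> A" "t \<in> T" "y = G c b s t"
  using assms unfolding box_def by blast

lemma V_subset: "c \<in> \<Omega> \<Longrightarrow> V c \<subseteq> topspace Y"
  using V_open openin_subset by blast

lemma compactin_box:
  assumes "c \<in> \<Omega>" "closedin (S c b) A" "compact T" "T \<subseteq> side b"
  shows "compactin Y (box c b A T)"
proof -
  have "box c b A T = (\<lambda>(s, t). G c b s t) ` (A \<times> T)"
    by (auto simp: box_def)
  moreover have "compactin (prod_topology (S c b) (top_of_set (side b))) (A \<times> T)"
    using assms(3,4) closedin_compact_space[OF S_compact[OF assms(1)] assms(2)]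
    by (auto simp: compactin_Times compactin_subtopology)
  ultimately show ?thesis using image_compactin[OF _ G_cont[OF assms(1)]] by simp
qed

lemma closedin_box:
  assumes "c \<in> \<Omega>" "closedin (S c b) A" "compact T" "T \<subseteq> side b"
  shows "closedin Y (box c b A T)"
  using compactin_imp_closedin[OF Hausdorff_Y compactin_box[OF assms]] .

lemma level_eq_box:
  assumes "c \<in> \<Omega>" "l \<in> side b"
  shows "level c l = box c b (topspace (S c b)) {l}"
  using G_onto[OF assms(1), of _ b] G_in_V[OF assms(1) _ assms(2)] p_G[OF assms(1) _ assms(2)] assms(2)
  unfolding level_def box_def by blast

text \<open>A level is the continuous image of a compact space of strands, so it is closed in all of
  \<open>Y\<close> although \<open>V c\<close> is only open.\<close>

lemma closedin_level:
  assumes "c \<in> \<Omega>" shows "closedin Y (level c l)"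
proof (cases "-1 < l \<and> l < 1")
  case True
  then obtain b where "l \<in> side b" using side_exists by blast
  then show ?thesis using assms level_eq_box closedin_box by (metis closedin_topspace compact_sing empty_subsetI insert_subset)
next
  case False
  then have "level c l = {}" using p_range[OF assms] by (auto simp: level_def)
  then show ?thesis by simp
qed

lemma openin_p_preimage:
  assumes "c \<in> \<Omega>" "open I"
  shows "openin Y {y \<in> V c. p c y \<in> I}"
proof -
  have "openin (subtopology Y (V c)) {y \<in> topspace (subtopology Y (V c)). p c y \<in> I}"
    using p_cont[OF assms(1)] assms(2) by (intro openin_continuous_map_preimage) auto
  moreover have "topspace (subtopology Y (V c)) = V c" using V_subset[OF assms(1)] by auto
  ultimately show ?thesis using V_open[OF assms(1)] openin_trans_full by metis
qed

text \<open>Off height 0 strands do not meet, by \<open>G_inj\<close>. So the points of nearby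
  height whose strand lies outside \<open>W\<close> form a compact box that misses \<open>y\<close>;
  removing it from the strip of nearby heights leaves a neighbourhood inside the box.\<close>

lemma openin_box:
  assumes c: "c \<in> \<Omega>" and W: "openin (S c b) W" and I: "open I" "I \<subseteq> side b" "0 \<notin> I"
  shows "openin Y (box c b W I)"
proof (subst openin_subopen, intro ballI)
  fix y assume "y \<in> box c b W I"
  then obtain s0 t0 where y: "s0 \<in> W" "t0 \<in> I" "y = G c b s0 t0" by (auto simp: box_def)
  have WS: "W \<subseteq> topspace (S c b)" using W openin_subset by blast
  obtain \<delta> where \<delta>: "\<delta> > 0" "cball t0 \<delta> \<subseteq> I" using I(1) y(2) open_contains_cball by blast
  \<comment> \<open>A closed ball of heights is used to make this box compact.\<close>
  define B where "B = box c b (topspace (S c b) - W) (cball t0 \<delta>)"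
  define N where "N = {y \<in> V c. p c y \<in> ball t0 \<delta>} - B"
  have "closedin Y B" unfolding B_def using W \<delta> I
    by (intro closedin_box[OF c]) auto
  then have "openin Y N" unfolding N_def using openin_p_preimage[OF c open_ball] by (rule openin_diff[rotated])
  moreover have "y \<in> N"
  proof -
    have "y \<notin> B"
    proof
      assume "y \<in> B"
      then obtain s t where st: "s \<in> topspace (S c b) - W" "t \<in> cball t0 \<delta>" "y = G c b s t"
        unfolding B_def box_def by auto
      have tI: "t \<in> I" using st \<delta> by blast
      then have ts: "t \<in> side b" "t0 \<in> side b" using I(2) y by auto
      have "t = t0" using p_G[OF c _ ts(1), of s] p_G[OF c _ ts(2), of s0] st y WS by auto
      then have "s = s0" using G_inj[OF c, of s b s0 t] st y WS I tI by (metis DiffD1 subsetD)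
      then show False using st y by blast
    qed
    moreover have "s0 \<in> topspace (S c b)" "t0 \<in> side b" using y WS I(2) by auto
    ultimately show ?thesis
      unfolding N_def using y \<delta> G_in_V[OF c, of s0 b t0] p_G[OF c, of s0 b t0] by simp
  qed
  moreover have "N \<subseteq> box c b W I"
  proof
    fix x assume x: "x \<in> N"
    have pI: "p c x \<in> I" using x \<delta> unfolding N_def by (auto simp: subset_iff)
    then obtain s where s: "s \<in> topspace (S c b)" "x = G c b s (p c x)"
      using G_onto[OF c, of x b] x I unfolding N_def by blast
    have "s \<in> W"
    proof (rule ccontr)
      assume "s \<notin> W"
      moreover have "p c x \<in> cball t0 \<delta>" using x unfolding N_def by auto
      ultimately have "x \<in> B" unfolding B_def box_def using s by blast
      then show False using x by (simp add: N_def)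
    qed
    then show "x \<in> box c b W I" using s pI unfolding box_def by blast
  qed
  ultimately show "\<exists>T. openin Y T \<and> y \<in> T \<and> T \<subseteq> box c b W I" by blast
qed

lemma continuous_map_G_fixed_t:
  assumes "c \<in> \<Omega>" "t \<in> side b"
  shows "continuous_map (S c b) Y (\<lambda>s. G c b s t)"
proof -
  have "continuous_map (S c b) (prod_topology (S c b) (top_of_set (side b))) (\<lambda>s. (s, t))"
    using assms(2) by (intro continuous_map_pairedI) (auto simp: continuous_map_in_subtopology)
  from continuous_map_compose[OF this G_cont[OF assms(1)]] show ?thesis by (simp add: comp_def)
qed

lemma continuous_map_G_fixed_s:
  assumes "c \<in> \<Omega>" "s \<in> topspace (S c b)"
  shows "continuous_map (top_of_set (side b)) Y (\<lambda>t. G c b s t)"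
proof -
  have "continuous_map (top_of_set (side b)) (prod_topology (S c b) (top_of_set (side b))) (\<lambda>t. (s, t))"
    using assms(2) by (intro continuous_map_pairedI) auto
  from continuous_map_compose[OF this G_cont[OF assms(1)]] show ?thesis by (simp add: comp_def)
qed

definition stem :: "'c \<Rightarrow> 'a set \<Rightarrow> bool \<Rightarrow> 's set" where
  "stem c L b = {s \<in> topspace (S c b). G c b s 0 \<in> L}"

lemma closedin_stem: "c \<in> \<Omega> \<Longrightarrow> closedin Y L \<Longrightarrow> closedin (S c b) (stem c L b)"
  unfolding stem_def by (intro closedin_continuous_map_preimage[OF continuous_map_G_fixed_t]) auto

lemma stem_diff: "c \<in> \<Omega> \<Longrightarrow> topspace (S c b) - stem c L b = stem c (level c 0 - L) b"
  unfolding stem_def level_def using G_in_V[of c _ b 0] p_G[of c _ b 0] by auto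

lemma openin_stem:
  assumes "c \<in> \<Omega>" "closedin Y (level c 0 - L)"
  shows "openin (S c b) (stem c L b)"
proof -
  have "closedin (S c b) (topspace (S c b) - stem c L b)"
    unfolding stem_diff[OF assms(1)] using closedin_stem[OF assms] .
  then show ?thesis by (simp add: closedin_def stem_def double_diff)
qed

text \<open>Both sides are taken together because a neighbourhood of a point at height 0 contains
  strands above and below it. The star is an open strip of heights minus two compact boxes over the
  strands that issue from outside \<open>L\<close>.\<close>

lemma openin_star:
  assumes c: "c \<in> \<Omega>" and L: "closedin Y (level c 0 - L)" and r: "0 < r" "r < 1"
  shows "openin Y (\<Union>b. box c b (stem c L b) (side b \<inter> {-r<..<r}))"
proof -
  define B where "B b = box c b (topspace (S c b) - stem c L b) (side b \<inter> {-r..r})" for b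
  have T: "side b \<inter> {-r..r} = (if b then {0..r} else {-r..0})" for b
    using r by (auto simp: side_def)
  have "closedin Y (B b)" for b
    unfolding B_def
  proof (rule closedin_box[OF c])
    show "compact (side b \<inter> {-r..r})" unfolding T by simp
  qed (use openin_stem[OF c L, of b] in auto)
  then have B: "closedin Y (B True \<union> B False)" by blast
  have "(\<Union>b. box c b (stem c L b) (side b \<inter> {-r<..<r})) =
      {y \<in> V c. p c y \<in> {-r<..<r}} - (B True \<union> B False)" (is "?L = ?R")
  proof (intro equalityI subsetI)
    fix y assume "y \<in> ?L"
    then obtain b s t where y: "s \<in> stem c L b" "t \<in> side b" "t \<in> {-r<..<r}" "y = G c b s t"
      by (auto simp: box_def)
    have s: "s \<in> topspace (S c b)" "G c b s 0 \<in> L" using y by (auto simp: stem_def)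
    have "y \<notin> B b'" for b'
    proof
      assume "y \<in> B b'"
      then obtain s' t' where y': "s' \<in> topspace (S c b') - stem c L b'" "t' \<in> side b'" "y = G c b' s' t'"
        by (auto simp: B_def box_def)
      have "t = t'" using p_G[OF c, of s b t] p_G[OF c, of s' b' t'] y y' s by auto
      show False
      proof (cases "t = 0")
        case True
        then have "y \<in> L" using s y by simp
        moreover have "y \<notin> L" using y' True \<open>t = t'\<close> by (auto simp: stem_def)
        ultimately show False by blast
      next
        case False
        then have "b = b'" using side_unique y y' \<open>t = t'\<close> by blast
        moreover have "s = s'"
          using G_inj[OF c, of s b s' t] y y' s False \<open>t = t'\<close> \<open>b = b'\<close> by auto
        ultimately show False using y y' by blast
      qed
    qed
    then show "y \<in> ?R" using y s G_in_V[OF c s(1), of t] p_G[OF c s(1), of t] by auto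
  next
    fix y assume y: "y \<in> ?R"
    obtain b where b: "p c y \<in> side b" using side_exists p_range[OF c] y by blast
    then obtain s where s: "s \<in> topspace (S c b)" "y = G c b s (p c y)" using G_onto[OF c] y by blast
    have "p c y \<in> {-r..r}" using y by auto
    moreover have "y \<notin> B b" using y by (cases b) auto
    ultimately have "s \<in> stem c L b" using s b unfolding B_def box_def by blast
    then show "y \<in> ?L" using s b y unfolding box_def by blast
  qed
  then show ?thesis using openin_diff[OF openin_p_preimage[OF c, of "{-r<..<r}"] B] by simp
qed

text \<open>A transversal is locally a level set of a chart.  Since heights strictly increase along arcs
  in all charts, it meets arcs locally at most once.\<close>

definition crosses :: "'a set \<Rightarrow> 'c \<Rightarrow> 'a \<Rightarrow> bool" where
  "crosses K c y \<longleftrightarrow> (\<exists>O'. openin Y O' \<and> y \<in> O' \<and> O' \<subseteq> V c \<and> O' \<inter> K = {x \<in> O'. p c x = p c y})"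

definition transversal :: "'a set \<Rightarrow> bool" where
  "transversal K \<longleftrightarrow> closedin Y K \<and> (\<forall>y\<in>K. \<exists>c\<in>\<Omega>. crosses K c y)"

text \<open>Away from the closed set \<open>L\<close> nothing changes. This is why additions to a
  transversal are kept disjoint from what is already there.\<close>

lemma crosses_Un:
  assumes "crosses K c y" "closedin Y L" "y \<notin> L"
  shows "crosses (K \<union> L) c y"
proof -
  obtain O' where O': "openin Y O'" "y \<in> O'" "O' \<subseteq> V c" "O' \<inter> K = {x \<in> O'. p c x = p c y}"
    using assms(1) unfolding crosses_def by blast
  have "openin Y (O' - L)" using O'(1) assms(2) by (rule openin_diff)
  moreover have "(O' - L) \<inter> (K \<union> L) = {x \<in> O' - L. p c x = p c y}" using O'(4) by blast
  ultimately show ?thesis unfolding crosses_def using O' assms(3) by (intro exI[of _ "O' - L"]) auto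
qed

lemma crosses_level_part:
  assumes "c \<in> \<Omega>" "L \<subseteq> level c l" "closedin Y (level c l - L)" "y \<in> L"
  shows "crosses L c y"
proof -
  have l: "x \<in> V c" "p c x = l" if "x \<in> L" for x using that assms(2) by (auto simp: level_def)
  have "openin Y (V c - (level c l - L))" using V_open[OF assms(1)] assms(3) by (rule openin_diff)
  moreover have "(V c - (level c l - L)) \<inter> L = {x \<in> V c - (level c l - L). p c x = p c y}"
    using l l(2)[OF assms(4)] by (auto simp: level_def)
  ultimately show ?thesis unfolding crosses_def
    using l assms(4) by (intro exI[of _ "V c - (level c l - L)"]) auto
qed

text \<open>All branch points lie in \<open>branch_set\<close>.  It meets each chart in a part of its level \<open>0\<close>, so a
  transversal made of clopen parts of such levels meets it in a relatively open set; this is what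
  allows the transversal to be enlarged chart by chart, keeping the parts disjoint.\<close>

definition branch_set :: "'a set" where
  "branch_set = {y \<in> topspace Y. \<forall>c\<in>\<Omega>. y \<in> V c \<longrightarrow> p c y = 0}"

lemma closedin_branch_set: "closedin Y branch_set"
proof -
  have "branch_set = topspace Y - (\<Union>c\<in>\<Omega>. {y \<in> V c. p c y \<in> - {0}})"
    unfolding branch_set_def by auto
  moreover have "openin Y (\<Union>c\<in>\<Omega>. {y \<in> V c. p c y \<in> - {0}})"
    using openin_p_preimage[of _ "-{0}"] by (intro openin_Union) auto
  ultimately show ?thesis by auto
qed

text \<open>The level is zero-dimensional and \<open>F\<close> is compact. Relatively closed subsets
  of the level are closed in \<open>Y\<close>, because the level itself is.\<close>

lemma level_clopen_separation:
  assumes c: "c \<in> \<Omega>" and F: "closedin Y F" "F \<subseteq> level c l" and K: "closedin Y K" "F \<inter> K = {}"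
  obtains L where "L \<subseteq> level c l" "closedin Y L" "closedin Y (level c l - L)" "F \<subseteq> L" "L \<inter> K = {}"
proof -
  let ?X = "subtopology Y (level c l)"
  have lev: "closedin Y (level c l)" using closedin_level[OF c] .
  have dim: "?X dim_le 0" using level_dim[OF c] by (simp add: level_def)
  have "compactin Y F" using F(1) compact_Y closedin_compact_space by blast
  then have "compactin ?X F" using F(2) by (simp add: compactin_subtopology)
  moreover have "closedin ?X (level c l \<inter> K)" using K(1) by (rule closedin_subtopology_Int_closed)
  ultimately obtain L where L: "openin ?X L" "closedin ?X L" "F \<subseteq> L" "L \<inter> (level c l \<inter> K) = {}"
    using clopen_separation[OF dim, of F "level c l \<inter> K"] K(2) by blast
  have tX: "topspace ?X = level c l" using lev closedin_subset by auto
  have "L \<subseteq> level c l" using L(1) openin_subset tX by blast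
  moreover have "closedin Y L" using L(2) lev closedin_trans_full by blast
  moreover have "closedin ?X (level c l - L)" using L(1) closedin_diff[of ?X "topspace ?X" L] tX by auto
  then have "closedin Y (level c l - L)" using lev closedin_trans_full by blast
  moreover have "L \<inter> K = {}" using L(4) \<open>L \<subseteq> level c l\<close> by blast
  ultimately show thesis using that L(3) by blast
qed

text \<open>Induction over finitely many charts that cover \<open>Y\<close>. The clause
  \<open>p c y = 0\<close> belongs to the induction, since it is what forces branch points near
  \<open>K\<close> into \<open>K\<close>.\<close>

lemma branch_transversal:
  obtains K where "closedin Y K" "\<And>y. y \<in> K \<Longrightarrow> \<exists>c\<in>\<Omega>. p c y = 0 \<and> crosses K c y" "branch_set \<subseteq> K"
proof -
  define good where "good K \<longleftrightarrow> closedin Y K \<and> (\<forall>y\<in>K. \<exists>c\<in>\<Omega>. p c y = 0 \<and> crosses K c y)" for K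
  have "\<exists>K. good K \<and> branch_set \<inter> topspace Y \<subseteq> K"
  proof -
    obtain W where W: "finite W" "W \<subseteq> \<Omega>" "topspace Y \<subseteq> (\<Union>c\<in>W. V c)"
    proof -
      have "\<exists>\<F>. finite \<F> \<and> \<F> \<subseteq> V ` \<Omega> \<and> topspace Y \<subseteq> \<Union>\<F>"
        using compact_Y V_open covers by (intro compactinD) (auto simp: compact_space_def)
      then show thesis using that by (metis finite_subset_image)
    qed
    from W(1,2) have "\<exists>K. good K \<and> branch_set \<inter> (\<Union>c\<in>W. V c) \<subseteq> K"
    proof (induction W)
      case empty
      then show ?case by (intro exI[of _ "{}"]) (simp add: good_def)
    next
      case (insert c W)
      then obtain K where K: "good K" "branch_set \<inter> (\<Union>c\<in>W. V c) \<subseteq> K" by blast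
      have c: "c \<in> \<Omega>" using insert by blast
      have clK: "closedin Y K" using K(1) by (simp add: good_def)
      \<comment> \<open>Near a point where \<open>K\<close> is the level 0 of a chart
        \<open>d\<close>, branch points have height 0 in \<open>d\<close> and so lie in
        \<open>K\<close>. These neighbourhoods cover \<open>K\<close>, whence
        \<open>branch_set - K\<close> is closed.\<close>
      define \<O> where "\<O> = {O'. openin Y O' \<and> O' \<inter> branch_set \<subseteq> K}"
      have "K \<subseteq> \<Union>\<O>"
      proof
        fix y assume y: "y \<in> K"
        then obtain d where d: "d \<in> \<Omega>" "p d y = 0" "crosses K d y" using K(1) unfolding good_def by blast
        then obtain O' where O': "openin Y O'" "y \<in> O'" "O' \<subseteq> V d" "O' \<inter> K = {x \<in> O'. p d x = p d y}"
          unfolding crosses_def by blast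
        have "O' \<inter> branch_set \<subseteq> K"
        proof
          fix x assume x: "x \<in> O' \<inter> branch_set"
          then have "p d x = p d y" using O'(3) d(1,2) by (auto simp: branch_set_def)
          then have "x \<in> O' \<inter> K" using x O'(4) by simp
          then show "x \<in> K" by simp
        qed
        then show "y \<in> \<Union>\<O>" using O' unfolding \<O>_def by blast
      qed
      moreover have "\<Union>\<O> \<inter> branch_set \<subseteq> K" unfolding \<O>_def by auto
      ultimately have "branch_set - K = branch_set - \<Union>\<O>" by blast
      moreover have "openin Y (\<Union>\<O>)" unfolding \<O>_def by (intro openin_Union) auto
      ultimately have "closedin Y (branch_set - K)" using closedin_branch_set closedin_diff by metis
      then have "closedin Y ((branch_set - K) \<inter> level c 0)" using closedin_level[OF c] by (rule closedin_Int)
      then obtain L where L: "L \<subseteq> level c 0" "closedin Y L" "closedin Y (level c 0 - L)"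
        "(branch_set - K) \<inter> level c 0 \<subseteq> L" "L \<inter> K = {}"
        using level_clopen_separation[OF c _ _ clK, of "(branch_set - K) \<inter> level c 0" 0] by blast
      have "\<exists>d\<in>\<Omega>. p d y = 0 \<and> crosses (K \<union> L) d y" if "y \<in> K \<union> L" for y
      proof (cases "y \<in> L")
        case True
        have "crosses (L \<union> K) c y"
          using crosses_level_part[OF c L(1,3) True] clK by (rule crosses_Un) (use True L in blast)
        moreover have "p c y = 0" using True L(1) by (auto simp: level_def)
        ultimately show ?thesis using c by (metis Un_commute)
      next
        case False
        then have "y \<in> K" using that by blast
        then obtain d where "d \<in> \<Omega>" "p d y = 0" "crosses K d y" using K(1) unfolding good_def by blast
        then show ?thesis using crosses_Un[OF _ L(2) False] by blast
      qed
      then have "good (K \<union> L)" unfolding good_def using clK L(2) by blast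
      moreover have "branch_set \<inter> V c \<subseteq> level c 0" using c by (auto simp: branch_set_def level_def)
      then have "branch_set \<inter> (\<Union>c\<in>insert c W. V c) \<subseteq> K \<union> L" using K(2) L(4) by blast
      ultimately show ?case by blast
    qed
    then show ?thesis using W(3) by blast
  qed
  then obtain K where "good K" "branch_set \<inter> topspace Y \<subseteq> K" by blast
  moreover have "branch_set \<subseteq> topspace Y" by (auto simp: branch_set_def)
  ultimately show thesis using that[of K] unfolding good_def by blast
qed

text \<open>If a whole interval of a strand lay in \<open>K\<close>, then near one of its points
  \<open>K\<close> would be a level of some chart \<open>d\<close>, while the height in
  \<open>d\<close> strictly increases along the strand.\<close>

lemma transversal_avoid:
  assumes K: "transversal K" and c: "c \<in> \<Omega>" and s: "s \<in> topspace (S c b)"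
    and \<alpha>\<beta>: "\<alpha> < \<beta>" "{\<alpha><..<\<beta>} \<subseteq> side b"
  shows "\<exists>t. \<alpha> < t \<and> t < \<beta> \<and> G c b s t \<notin> K"
proof (rule ccontr)
  assume "\<not> ?thesis"
  then have inK: "G c b s t \<in> K" if "\<alpha> < t" "t < \<beta>" for t using that by blast
  obtain t0 where t0: "\<alpha> < t0" "t0 < \<beta>" using dense \<alpha>\<beta>(1) by blast
  obtain d O' where d: "d \<in> \<Omega>" "openin Y O'" "G c b s t0 \<in> O'" "O' \<subseteq> V d"
    "O' \<inter> K = {x \<in> O'. p d x = p d (G c b s t0)}"
    using K inK[OF t0] unfolding transversal_def crosses_def by blast
  have "openin (top_of_set (side b)) {t \<in> topspace (top_of_set (side b)). G c b s t \<in> O'}"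
    using continuous_map_G_fixed_s[OF c s] d(2) by (rule openin_continuous_map_preimage)
  then obtain U where U: "open U" "{t \<in> side b. G c b s t \<in> O'} = side b \<inter> U"
    by (auto simp: openin_open)
  have "t0 \<in> U \<inter> {\<alpha><..<\<beta>}" using U t0 d(3) \<alpha>\<beta>(2) by auto
  moreover have "open (U \<inter> {\<alpha><..<\<beta>})" using U(1) by auto
  ultimately obtain \<delta> where \<delta>: "\<delta> > 0" "cball t0 \<delta> \<subseteq> U \<inter> {\<alpha><..<\<beta>}" using open_contains_cball by blast
  have sub: "{t0..t0 + \<delta>} \<subseteq> cball t0 \<delta>" by (auto simp: dist_real_def)
  have O'': "G c b s t \<in> O'" "G c b s t \<in> K" if "t \<in> {t0..t0 + \<delta>}" for t
  proof -
    have "t \<in> U \<inter> {\<alpha><..<\<beta>}" using that sub \<delta>(2) by blast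
    then have "t \<in> U" "\<alpha> < t" "t < \<beta>" by auto
    then show "G c b s t \<in> O'" "G c b s t \<in> K" using inK U(2) \<alpha>\<beta>(2) by auto
  qed
  have "p d (G c b s t0) < p d (G c b s (t0 + \<delta>))"
  proof (rule orient[OF c d(1) s])
    show "{t0..t0 + \<delta>} \<subseteq> side b" using sub \<delta>(2) \<alpha>\<beta>(2) by blast
  qed (use O'' d(4) \<delta>(1) in auto)
  moreover have "G c b s (t0 + \<delta>) \<in> O' \<inter> K" using O''[of "t0 + \<delta>"] \<delta>(1) by auto
  ultimately show False unfolding d(5) by simp
qed

text \<open>The new part of the transversal is not a level set: its height is only locally constant, so
  that it can avoid the given transversal.\<close>

lemma add_caps:
  assumes K: "transversal K" and c: "c \<in> \<Omega>"
    and \<alpha>\<beta>: "\<alpha> < \<beta>" "{\<alpha><..<\<beta>} \<subseteq> side b" "0 \<notin> {\<alpha><..<\<beta>}"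
  obtains K' l where "transversal K'" "K \<subseteq> K'"
    "\<forall>s\<in>topspace (S c b). \<alpha> < l s \<and> l s < \<beta> \<and> G c b s (l s) \<in> K'"
    "finite (l ` topspace (S c b))" "\<forall>v. openin (S c b) {s \<in> topspace (S c b). l s = v}"
proof -
  let ?S = "topspace (S c b)"
  have clK: "closedin Y K" using K by (simp add: transversal_def)
  obtain l where l: "\<And>s. s \<in> ?S \<Longrightarrow> \<alpha> < l s \<and> l s < \<beta> \<and> G c b s (l s) \<notin> K"
    "finite (l ` ?S)" "\<And>v. openin (S c b) {s \<in> ?S. l s = v}"
  proof (rule locally_constant_selection[OF S_compact[OF c] S_dim[OF c], of b "\<lambda>s v. \<alpha> < v \<and> v < \<beta> \<and> G c b s v \<notin> K"])
    fix s assume s: "s \<in> ?S"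
    obtain t where t: "\<alpha> < t" "t < \<beta>" "G c b s t \<notin> K" using transversal_avoid[OF K c s \<alpha>\<beta>(1,2)] by blast
    have ts: "t \<in> side b" using t \<alpha>\<beta>(2) by auto
    \<comment> \<open>A strand that is off the closed set \<open>K\<close> at height
      \<open>t\<close> has only such strands nearby, so the constant height \<open>t\<close> works
      locally.\<close>
    have "openin (S c b) {s \<in> ?S. G c b s t \<in> topspace Y - K}"
      using continuous_map_G_fixed_t[OF c ts] clK by (intro openin_continuous_map_preimage) auto
    moreover have "G c b s t \<in> topspace Y" using G_in_V[OF c s ts] V_subset[OF c] by blast
    ultimately show "\<exists>v U. openin (S c b) U \<and> s \<in> U \<and> (\<forall>x'\<in>U. \<alpha> < v \<and> v < \<beta> \<and> G c b x' v \<notin> K)"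
      using s t by (intro exI[of _ t] exI[of _ "{s \<in> ?S. G c b s t \<in> topspace Y - K}"]) auto
  qed blast
  have ls: "l s \<in> side b" "l s \<noteq> 0" if "s \<in> ?S" for s
    using l(1)[OF that] \<alpha>\<beta> by (auto simp: subset_iff)
  define L where "L = (\<Union>v\<in>l ` ?S. box c b {s \<in> ?S. l s = v} {v})"
  have Lmem: "y \<in> L \<longleftrightarrow> (\<exists>s\<in>?S. y = G c b s (l s))" for y
  proof
    assume "y \<in> L"
    then obtain v where "v \<in> l ` ?S" "y \<in> box c b {s \<in> ?S. l s = v} {v}" unfolding L_def by (rule UN_E)
    then obtain s where "s \<in> ?S" "l s = v" "y = G c b s v" unfolding box_def by auto
    then show "\<exists>s\<in>?S. y = G c b s (l s)" by auto
  qed (auto simp: L_def box_def)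
  have cl_fibre: "closedin (S c b) {s \<in> ?S. l s = v}" for v
    by (rule closedin_fibre) (rule l(3))
  have clL: "closedin Y L" unfolding L_def
  proof (intro closedin_Union)
    show "finite ((\<lambda>v. box c b {s \<in> ?S. l s = v} {v}) ` l ` ?S)" using l(2) by simp
    fix B assume "B \<in> (\<lambda>v. box c b {s \<in> ?S. l s = v} {v}) ` l ` ?S"
    then obtain s where s: "s \<in> ?S" "B = box c b {s' \<in> ?S. l s' = l s} {l s}" by blast
    show "closedin Y B" unfolding s(2) using cl_fibre ls(1)[OF s(1)] by (intro closedin_box[OF c]) auto
  qed
  have disj: "K \<inter> L = {}" using l(1) by (auto simp: Lmem)
  have crL: "crosses L c y" if yL: "y \<in> L" for y
  proof -
    obtain s where s: "s \<in> ?S" "y = G c b s (l s)" using yL unfolding Lmem by blast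
    \<comment> \<open>Over the clopen set of strands cut at the same height \<open>l s\<close>, the
      new part is exactly the level \<open>l s\<close>, so this box witnesses the crossing.\<close>
    let ?O = "box c b {s' \<in> ?S. l s' = l s} {\<alpha><..<\<beta>}"
    have py: "p c y = l s" using p_G[OF c s(1) ls(1)[OF s(1)]] s(2) by simp
    have "openin Y ?O" using l(3) \<alpha>\<beta> by (intro openin_box[OF c]) auto
    moreover have "y \<in> ?O" unfolding s(2) using s l(1)[OF s(1)] by (intro box_memI) auto
    moreover have "?O \<subseteq> V c"
    proof
      fix x assume "x \<in> ?O"
      then obtain s' t where "s' \<in> ?S" "t \<in> {\<alpha><..<\<beta>}" "x = G c b s' t" unfolding box_def by blast
      then show "x \<in> V c" using G_in_V[OF c, of s' b t] \<alpha>\<beta>(2) by auto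
    qed
    moreover have "?O \<inter> L = {x \<in> ?O. p c x = p c y}"
    proof (intro equalityI subsetI)
      fix x assume x: "x \<in> ?O \<inter> L"
      then have "x \<in> ?O" by blast
      then obtain s' t where "s' \<in> {s' \<in> ?S. l s' = l s}" "t \<in> {\<alpha><..<\<beta>}" "x = G c b s' t"
        by (rule box_memE)
      then have s': "s' \<in> ?S" "l s' = l s" "\<alpha> < t" "t < \<beta>" "x = G c b s' t" by simp_all
      have t: "t \<in> side b" "t \<noteq> 0" using s' \<alpha>\<beta> by auto
      have "x \<in> L" using x by blast
      then obtain s'' where s'': "s'' \<in> ?S" "x = G c b s'' (l s'')" unfolding Lmem by blast
      have pt: "t = l s''" using p_G[OF c s'(1) t(1)] p_G[OF c s''(1) ls(1)[OF s''(1)]] s' s'' by simp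
      then have "s' = s''" using G_inj[OF c s'(1) s''(1) t] s' s'' by simp
      then have "p c x = p c y" using py p_G[OF c s'(1) t(1)] s' pt by simp
      then show "x \<in> {x \<in> ?O. p c x = p c y}" using x by blast
    next
      fix x assume x: "x \<in> {x \<in> ?O. p c x = p c y}"
      then have "x \<in> ?O" by blast
      then obtain s' t where "s' \<in> {s' \<in> ?S. l s' = l s}" "t \<in> {\<alpha><..<\<beta>}" "x = G c b s' t"
        by (rule box_memE)
      then have s': "s' \<in> ?S" "l s' = l s" "\<alpha> < t" "t < \<beta>" "x = G c b s' t" by simp_all
      have "t \<in> side b" using s' \<alpha>\<beta> by auto
      then have "t = l s'" using p_G[OF c s'(1), of t] s' x py by simp
      then have "x \<in> L" using Lmem s' by blast
      then show "x \<in> ?O \<inter> L" using x by blast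
    qed
    ultimately show ?thesis unfolding crosses_def by blast
  qed
  have "transversal (K \<union> L)"
    unfolding transversal_def
  proof (intro conjI ballI)
    show "closedin Y (K \<union> L)" using clK clL by blast
    fix y assume y: "y \<in> K \<union> L"
    show "\<exists>c\<in>\<Omega>. crosses (K \<union> L) c y"
    proof (cases "y \<in> L")
      case True
      then have "crosses (L \<union> K) c y" using crosses_Un[OF crL clK] disj by blast
      then show ?thesis using c by (metis Un_commute)
    next
      case False
      then obtain d where "d \<in> \<Omega>" "crosses K d y" using y K unfolding transversal_def by blast
      then show ?thesis using crosses_Un[OF _ clL False] by blast
    qed
  qed
  moreover have "\<alpha> < l s \<and> l s < \<beta> \<and> G c b s (l s) \<in> K \<union> L" if "s \<in> ?S" for s
    using l(1)[OF that] Lmem that by blast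
  ultimately show thesis using that[of "K \<union> L" l] l(2,3) by blast
qed

end

section \<open>Covers by boxes with ends in a transversal\<close>

context oriented_charts
begin

definition capped :: "'a set \<Rightarrow> 'a set \<Rightarrow> bool" where
  "capped K R \<longleftrightarrow> (\<exists>c\<in>\<Omega>. \<exists>b A \<alpha> \<beta>. openin (S c b) A \<and> closedin (S c b) A \<and> \<alpha> < \<beta> \<and> {\<alpha>..\<beta>} \<subseteq> side b \<and>
     (\<forall>s\<in>A. G c b s \<alpha> \<in> K \<and> G c b s \<beta> \<in> K) \<and> R = box c b A {\<alpha>..\<beta>})"

lemma capped_mono: "capped K R \<Longrightarrow> K \<subseteq> K' \<Longrightarrow> capped K' R"
  unfolding capped_def by (meson subsetD)

text \<open>Cut \<open>A\<close> into the clopen sets on which both bounds \<open>l\<close> and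
  \<open>m\<close> are constant; there are finitely many because both bounds have finite
  range.\<close>

lemma capped_pieces:
  assumes c: "c \<in> \<Omega>" and A: "openin (S c b) A" "closedin (S c b) A"
    and l: "\<forall>v. openin (S c b) {s \<in> topspace (S c b). l s = v}" "finite (l ` topspace (S c b))"
    and m: "\<forall>v. openin (S c b) {s \<in> topspace (S c b). m s = v}" "finite (m ` topspace (S c b))"
    and lm: "\<forall>s\<in>A. l s < m s \<and> {l s..m s} \<subseteq> side b \<and> G c b s (l s) \<in> K \<and> G c b s (m s) \<in> K"
  obtains \<R> where "finite \<R>" "\<forall>R\<in>\<R>. capped K R"
    "\<forall>s\<in>A. \<forall>t\<in>{l s..m s}. G c b s t \<in> \<Union>\<R>"
proof -
  let ?S = "topspace (S c b)"
  have AS: "A \<subseteq> ?S" using A(1) openin_subset by blast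
  define F where "F u v = A \<inter> ({s \<in> ?S. l s = u} \<inter> {s \<in> ?S. m s = v})" for u v
  define \<R> where "\<R> = (\<lambda>s. box c b (F (l s) (m s)) {l s..m s}) ` A"
  have F: "openin (S c b) (F u v)" "closedin (S c b) (F u v)" for u v
    unfolding F_def using A l(1) m(1) closedin_fibre[of "S c b" l] closedin_fibre[of "S c b" m]
    by (simp_all add: openin_Int closedin_Int)
  have "finite ((\<lambda>s. (l s, m s)) ` A)"
    by (rule finite_subset[of _ "(l ` ?S) \<times> (m ` ?S)"]) (use AS l(2) m(2) in auto)
  then have "finite \<R>" unfolding \<R>_def by (rule finite_image_factor) auto
  moreover have "capped K R" if R: "R \<in> \<R>" for R
  proof -
    obtain s where s: "s \<in> A" "R = box c b (F (l s) (m s)) {l s..m s}" using R unfolding \<R>_def by (rule imageE)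
    have "\<forall>s'\<in>F (l s) (m s). G c b s' (l s) \<in> K \<and> G c b s' (m s) \<in> K"
    proof
      fix s' assume "s' \<in> F (l s) (m s)"
      then have "s' \<in> A" "l s' = l s" "m s' = m s" by (auto simp: F_def)
      then show "G c b s' (l s) \<in> K \<and> G c b s' (m s) \<in> K" using lm by metis
    qed
    then show ?thesis unfolding capped_def s(2)
      using bspec[OF lm s(1)] F c by (intro bexI[OF _ c] exI conjI refl) auto
  qed
  moreover have "G c b s t \<in> \<Union>\<R>" if s: "s \<in> A" "t \<in> {l s..m s}" for s t
  proof -
    have "G c b s t \<in> box c b (F (l s) (m s)) {l s..m s}"
      using s AS by (intro box_memI) (auto simp: F_def)
    then show ?thesis unfolding \<R>_def using s(1) by blast
  qed
  ultimately show thesis by (intro that[of \<R>] ballI)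
qed

text \<open>The caps are placed in the margins between \<open>\<alpha>1\<close> and
  \<open>\<alpha>2\<close> and between \<open>\<beta>1\<close> and \<open>\<beta>2\<close>, so the
  segments between them contain \<open>{\<alpha>2..\<beta>1}\<close>. The second call of
  \<open>add_caps\<close> starts from the transversal with the lower caps, so both kinds
  survive.\<close>

lemma cap_box:
  assumes K: "transversal K" and c: "c \<in> \<Omega>" and o: "\<alpha>1 < \<alpha>2" "\<alpha>2 < \<beta>1" "\<beta>1 < \<beta>2"
    and sub: "{\<alpha>1..\<beta>2} \<subseteq> side b" "0 \<notin> {\<alpha>1..\<beta>2}"
  obtains K' \<R> where "transversal K'" "K \<subseteq> K'" "finite \<R>" "\<forall>R\<in>\<R>. capped K' R"
    "box c b (topspace (S c b)) {\<alpha>2..\<beta>1} \<subseteq> \<Union>\<R>"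
proof -
  let ?S = "topspace (S c b)"
  obtain K1 l where l: "transversal K1" "K \<subseteq> K1"
    "\<forall>s\<in>?S. \<alpha>1 < l s \<and> l s < \<alpha>2 \<and> G c b s (l s) \<in> K1"
    "finite (l ` ?S)" "\<forall>v. openin (S c b) {s \<in> ?S. l s = v}"
  proof (rule add_caps[OF K c o(1), of b])
    show "{\<alpha>1<..<\<alpha>2} \<subseteq> side b" using o by (intro subset_trans[OF _ sub(1)]) auto
    show "0 \<notin> {\<alpha>1<..<\<alpha>2}" using sub(2) o by auto
  qed
  obtain K2 m where m: "transversal K2" "K1 \<subseteq> K2"
    "\<forall>s\<in>?S. \<beta>1 < m s \<and> m s < \<beta>2 \<and> G c b s (m s) \<in> K2"
    "finite (m ` ?S)" "\<forall>v. openin (S c b) {s \<in> ?S. m s = v}"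
  proof (rule add_caps[OF l(1) c o(3), of b])
    show "{\<beta>1<..<\<beta>2} \<subseteq> side b" using o by (intro subset_trans[OF _ sub(1)]) auto
    show "0 \<notin> {\<beta>1<..<\<beta>2}" using sub(2) o by auto
  qed
  have lm: "\<forall>s\<in>?S. l s < m s \<and> {l s..m s} \<subseteq> side b \<and> G c b s (l s) \<in> K2 \<and> G c b s (m s) \<in> K2"
  proof
    fix s assume s: "s \<in> ?S"
    have "{l s..m s} \<subseteq> {\<alpha>1..\<beta>2}" using bspec[OF l(3) s] bspec[OF m(3) s] by auto
    then show "l s < m s \<and> {l s..m s} \<subseteq> side b \<and> G c b s (l s) \<in> K2 \<and> G c b s (m s) \<in> K2"
      using bspec[OF l(3) s] bspec[OF m(3) s] o sub(1) m(2) by auto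
  qed
  obtain \<R> where \<R>: "finite \<R>" "\<forall>R\<in>\<R>. capped K2 R"
    "\<forall>s\<in>?S. \<forall>t\<in>{l s..m s}. G c b s t \<in> \<Union>\<R>"
    by (rule capped_pieces[OF c openin_topspace closedin_topspace l(5,4) m(5,4) lm])
  have "box c b ?S {\<alpha>2..\<beta>1} \<subseteq> \<Union>\<R>"
  proof
    fix y assume "y \<in> box c b ?S {\<alpha>2..\<beta>1}"
    then obtain s t where s: "s \<in> ?S" "t \<in> {\<alpha>2..\<beta>1}" "y = G c b s t" by (rule box_memE)
    then show "y \<in> \<Union>\<R>" using bspec[OF \<R>(3) s(1)] bspec[OF l(3) s(1)] bspec[OF m(3) s(1)] by simp
  qed
  then show thesis using that[of K2 \<R>] m(1,2) l(2) \<R>(1,2) by blast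
qed

text \<open>\<open>L\<close> itself serves as the cap at height 0, so the boxes on the two sides of
  level 0 meet along \<open>K\<close>; only the outer caps are new.\<close>

lemma cap_half_star:
  assumes K: "transversal K" and c: "c \<in> \<Omega>"
    and L: "L \<subseteq> level c 0" "L \<subseteq> K" "closedin Y L" "closedin Y (level c 0 - L)"
  obtains K' \<R> where "transversal K'" "K \<subseteq> K'" "finite \<R>" "\<forall>R\<in>\<R>. capped K' R"
    "box c b (stem c L b) (side b \<inter> {-1/3<..<1/3}) \<subseteq> \<Union>\<R>"
proof -
  let ?S = "topspace (S c b)"
  \<comment> \<open>The outer caps lie at a distance between 1/3 and 1/2 from height 0, beyond the
    star of radius 1/3 that is to be covered.\<close>
  define \<alpha> \<beta> :: real where "\<alpha> = (if b then 1/3 else -1/2)" and "\<beta> = (if b then 1/2 else -1/3)"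
  have \<alpha>\<beta>: "\<alpha> < \<beta>" "{\<alpha><..<\<beta>} \<subseteq> side b" "0 \<notin> {\<alpha><..<\<beta>}" by (auto simp: \<alpha>_def \<beta>_def side_def)
  obtain K1 l where l: "transversal K1" "K \<subseteq> K1"
    "\<forall>s\<in>?S. \<alpha> < l s \<and> l s < \<beta> \<and> G c b s (l s) \<in> K1"
    "finite (l ` ?S)" "\<forall>v. openin (S c b) {s \<in> ?S. l s = v}"
    by (rule add_caps[OF K c \<alpha>\<beta>])
  define l0 :: "'s \<Rightarrow> real" where "l0 s = 0" for s
  have l0: "\<forall>v. openin (S c b) {s \<in> ?S. l0 s = v}" "finite (l0 ` ?S)"
  proof -
    have "openin (S c b) {s \<in> ?S. l0 s = v}" for v by (cases "v = 0") (auto simp: l0_def)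
    then show "\<forall>v. openin (S c b) {s \<in> ?S. l0 s = v}" by blast
    show "finite (l0 ` ?S)" by (rule finite_subset[of _ "{0}"]) (auto simp: l0_def)
  qed
  have stem: "openin (S c b) (stem c L b)" "closedin (S c b) (stem c L b)"
    using openin_stem[OF c L(4)] closedin_stem[OF c L(3)] by blast+
  have sS: "s \<in> ?S" "G c b s 0 \<in> K1" if "s \<in> stem c L b" for s
    using that L(2) l(2) by (auto simp: stem_def)
  show thesis
  proof (cases b)
    case True
    have lm: "\<forall>s\<in>stem c L b. l0 s < l s \<and> {l0 s..l s} \<subseteq> side b \<and> G c b s (l0 s) \<in> K1 \<and> G c b s (l s) \<in> K1"
    proof
      fix s assume s: "s \<in> stem c L b"
      show "l0 s < l s \<and> {l0 s..l s} \<subseteq> side b \<and> G c b s (l0 s) \<in> K1 \<and> G c b s (l s) \<in> K1"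
        using bspec[OF l(3) sS(1)[OF s]] sS(2)[OF s] True by (auto simp: l0_def \<alpha>_def \<beta>_def side_def)
    qed
    obtain \<R> where \<R>: "finite \<R>" "\<forall>R\<in>\<R>. capped K1 R"
      "\<forall>s\<in>stem c L b. \<forall>t\<in>{l0 s..l s}. G c b s t \<in> \<Union>\<R>"
      by (rule capped_pieces[OF c stem l0 l(5,4) lm])
    have "box c b (stem c L b) (side b \<inter> {-1/3<..<1/3}) \<subseteq> \<Union>\<R>"
    proof
      fix y assume "y \<in> box c b (stem c L b) (side b \<inter> {-1/3<..<1/3})"
      then obtain s t where s: "s \<in> stem c L b" "t \<in> side b \<inter> {-1/3<..<1/3}" "y = G c b s t" by (rule box_memE)
      then show "y \<in> \<Union>\<R>"
        using bspec[OF \<R>(3) s(1)] bspec[OF l(3) sS(1)[OF s(1)]] True by (simp add: l0_def \<alpha>_def side_def)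
    qed
    then show thesis using that[of K1 \<R>] l(1,2) \<R>(1,2) by blast
  next
    case False
    have lm: "\<forall>s\<in>stem c L b. l s < l0 s \<and> {l s..l0 s} \<subseteq> side b \<and> G c b s (l s) \<in> K1 \<and> G c b s (l0 s) \<in> K1"
    proof
      fix s assume s: "s \<in> stem c L b"
      show "l s < l0 s \<and> {l s..l0 s} \<subseteq> side b \<and> G c b s (l s) \<in> K1 \<and> G c b s (l0 s) \<in> K1"
        using bspec[OF l(3) sS(1)[OF s]] sS(2)[OF s] False by (auto simp: l0_def \<alpha>_def \<beta>_def side_def)
    qed
    obtain \<R> where \<R>: "finite \<R>" "\<forall>R\<in>\<R>. capped K1 R"
      "\<forall>s\<in>stem c L b. \<forall>t\<in>{l s..l0 s}. G c b s t \<in> \<Union>\<R>"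
      by (rule capped_pieces[OF c stem l(5,4) l0 lm])
    have "box c b (stem c L b) (side b \<inter> {-1/3<..<1/3}) \<subseteq> \<Union>\<R>"
    proof
      fix y assume "y \<in> box c b (stem c L b) (side b \<inter> {-1/3<..<1/3})"
      then obtain s t where s: "s \<in> stem c L b" "t \<in> side b \<inter> {-1/3<..<1/3}" "y = G c b s t" by (rule box_memE)
      then show "y \<in> \<Union>\<R>"
        using bspec[OF \<R>(3) s(1)] bspec[OF l(3) sS(1)[OF s(1)]] False by (simp add: l0_def \<beta>_def side_def)
    qed
    then show thesis using that[of K1 \<R>] l(1,2) \<R>(1,2) by blast
  qed
qed

text \<open>A point outside \<open>K0\<close> is not in \<open>branch_set\<close>, so some chart
  gives it a nonzero height and \<open>cap_box\<close> covers a neighbourhood. A point of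
  \<open>K0\<close> lies on a clopen part \<open>L\<close> of a level 0 with
  \<open>L \<subseteq> K0\<close>, and \<open>cap_half_star\<close> covers the star of
  \<open>L\<close> from both sides.\<close>

lemma capped_cover:
  obtains K \<R> where "transversal K" "finite \<R>" "\<forall>R\<in>\<R>. capped K R" "topspace Y \<subseteq> \<Union>\<R>"
proof -
  obtain K0 where K0: "closedin Y K0" "\<And>y. y \<in> K0 \<Longrightarrow> \<exists>c\<in>\<Omega>. p c y = 0 \<and> crosses K0 c y" "branch_set \<subseteq> K0"
    by (rule branch_transversal) blast
  \<comment> \<open>The quantifier over \<open>K\<close> makes the property closed under unions: caps added later do not
    destroy the boxes found before.\<close>
  define P where "P N \<longleftrightarrow> (\<forall>K. transversal K \<and> K0 \<subseteq> K \<longrightarrow> (\<exists>K' \<R>. transversal K' \<and> K \<subseteq> K' \<and>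
    finite \<R> \<and> (\<forall>R\<in>\<R>. capped K' R) \<and> N \<subseteq> \<Union>\<R>))" for N
  have "P (topspace Y)"
  proof (rule compactin_local_to_global[of Y])
    show "compactin Y (topspace Y)" using compact_Y by (simp add: compact_space_def)
    show "P {}" unfolding P_def
    proof (intro allI impI)
      fix K assume "transversal K \<and> K0 \<subseteq> K"
      then show "\<exists>K' \<R>. transversal K' \<and> K \<subseteq> K' \<and> finite \<R> \<and> (\<forall>R\<in>\<R>. capped K' R) \<and> {} \<subseteq> \<Union>\<R>"
        by (intro exI[of _ K] exI[of _ "{}"]) auto
    qed
    have PD: "\<exists>K' \<R>. transversal K' \<and> K \<subseteq> K' \<and> finite \<R> \<and> (\<forall>R\<in>\<R>. capped K' R) \<and> N \<subseteq> \<Union>\<R>"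
      if "P N" "transversal K" "K0 \<subseteq> K" for N K using that unfolding P_def by simp
    show "P N" if M: "P M" "N \<subseteq> M" for N M
      unfolding P_def
    proof (intro allI impI)
      fix K assume K: "transversal K \<and> K0 \<subseteq> K"
      obtain K1 \<R>1 where 1: "transversal K1" "K \<subseteq> K1" "finite \<R>1" "\<forall>R\<in>\<R>1. capped K1 R" "M \<subseteq> \<Union>\<R>1"
        using PD[OF M(1), of K] K by auto
      then show "\<exists>K' \<R>. transversal K' \<and> K \<subseteq> K' \<and> finite \<R> \<and> (\<forall>R\<in>\<R>. capped K' R) \<and> N \<subseteq> \<Union>\<R>"
        using M(2) by (intro exI[of _ K1] exI[of _ "\<R>1"]) auto
    qed
    show "P (M \<union> N)" if M: "P M" and N: "P N" for M N
      unfolding P_def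
    proof (intro allI impI)
      fix K assume K: "transversal K \<and> K0 \<subseteq> K"
      obtain K1 \<R>1 where 1: "transversal K1" "K \<subseteq> K1" "finite \<R>1" "\<forall>R\<in>\<R>1. capped K1 R" "M \<subseteq> \<Union>\<R>1"
        using PD[OF M, of K] K by auto
      obtain K2 \<R>2 where 2: "transversal K2" "K1 \<subseteq> K2" "finite \<R>2" "\<forall>R\<in>\<R>2. capped K2 R" "N \<subseteq> \<Union>\<R>2"
        using PD[OF N 1(1) subset_trans[OF conjunct2[OF K] 1(2)]] by auto
      have "\<forall>R\<in>\<R>1 \<union> \<R>2. capped K2 R"
        using capped_mono[OF bspec[OF 1(4)] 2(2)] 2(4) by (simp add: ball_Un)
      then show "\<exists>K' \<R>. transversal K' \<and> K \<subseteq> K' \<and> finite \<R> \<and> (\<forall>R\<in>\<R>. capped K' R) \<and> M \<union> N \<subseteq> \<Union>\<R>"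
        using 1 2 by (intro exI[of _ K2] exI[of _ "\<R>1 \<union> \<R>2"]) auto
    qed
    fix y assume y: "y \<in> topspace Y"
    show "\<exists>N. openin Y N \<and> y \<in> N \<and> P N"
    proof (cases "y \<in> K0")
      case False
      then obtain c where c: "c \<in> \<Omega>" "y \<in> V c" "p c y \<noteq> 0" using K0(3) y unfolding branch_set_def by blast
      define t0 where "t0 = p c y"
      have t0r: "-1 < t0" "t0 < 1" "t0 \<noteq> 0" using p_range[OF c(1,2)] c(3) by (auto simp: t0_def)
      obtain b where b: "t0 \<in> side b" using side_exists t0r by blast
      \<comment> \<open>The margins for the caps have to stay on the side of \<open>t0\<close>, away
        from 0 and from the open end of that side.\<close>
      obtain \<alpha>1 \<alpha>2 \<beta>1 \<beta>2 where o: "\<alpha>1 < \<alpha>2" "\<alpha>2 < t0" "t0 < \<beta>1" "\<beta>1 < \<beta>2"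
        and sub: "{\<alpha>1..\<beta>2} \<subseteq> side b" "0 \<notin> {\<alpha>1..\<beta>2}"
      proof (cases b)
        case True
        then have "0 < t0" using b t0r by (auto simp: side_def)
        then show thesis
          using t0r True by (intro that[of "t0/3" "t0/2" "t0 + (1 - t0)/3" "t0 + (1 - t0)/2"]) (auto simp: side_def field_simps)
      next
        case False
        then have "t0 < 0" using b t0r by (auto simp: side_def)
        then show thesis
          using t0r False by (intro that[of "t0 - (1 + t0)/2" "t0 - (1 + t0)/3" "t0/2" "t0/3"]) (auto simp: side_def field_simps)
      qed
      define N where "N = {x \<in> V c. p c x \<in> {\<alpha>2<..<\<beta>1}}"
      have "openin Y N" unfolding N_def by (rule openin_p_preimage[OF c(1) open_greaterThanLessThan])
      moreover have "y \<in> N" unfolding N_def using c(2) o by (simp add: t0_def)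
      moreover have "P N"
        unfolding P_def
      proof (intro allI impI)
        fix K assume K: "transversal K \<and> K0 \<subseteq> K"
        obtain K' \<R> where R: "transversal K'" "K \<subseteq> K'" "finite \<R>" "\<forall>R\<in>\<R>. capped K' R"
          "box c b (topspace (S c b)) {\<alpha>2..\<beta>1} \<subseteq> \<Union>\<R>"
          by (rule cap_box[OF conjunct1[OF K] c(1) o(1) order_less_trans[OF o(2,3)] o(4) sub])
        have "N \<subseteq> box c b (topspace (S c b)) {\<alpha>2..\<beta>1}"
        proof
          fix x assume x: "x \<in> N"
          then have px: "p c x \<in> {\<alpha>2..\<beta>1}" by (auto simp: N_def)
          then have "p c x \<in> {\<alpha>1..\<beta>2}" using o by auto
          then have "p c x \<in> side b" using sub(1) by blast
          then obtain s where "s \<in> topspace (S c b)" "x = G c b s (p c x)"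
            using G_onto[OF c(1)] x unfolding N_def by blast
          then show "x \<in> box c b (topspace (S c b)) {\<alpha>2..\<beta>1}" using px by (metis box_memI)
        qed
        then show "\<exists>K' \<R>. transversal K' \<and> K \<subseteq> K' \<and> finite \<R> \<and> (\<forall>R\<in>\<R>. capped K' R) \<and> N \<subseteq> \<Union>\<R>"
          using R by (intro exI[of _ K'] exI[of _ \<R>]) auto
      qed
      ultimately show ?thesis by blast
    next
      case True
      then obtain c where c: "c \<in> \<Omega>" "p c y = 0" "crosses K0 c y" using K0(2) by blast
      then obtain O' where O': "openin Y O'" "y \<in> O'" "O' \<subseteq> V c" "O' \<inter> K0 = {x \<in> O'. p c x = 0}"
        unfolding crosses_def by auto
      have yl: "y \<in> level c 0" using O' c(2) by (auto simp: level_def)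
      have "closedin Y {y}" using y Hausdorff_Y by (simp add: closedin_Hausdorff_singleton)
      moreover have "closedin Y (topspace Y - O')" using O'(1) by blast
      ultimately obtain L where L: "L \<subseteq> level c 0" "closedin Y L" "closedin Y (level c 0 - L)" "{y} \<subseteq> L"
        "L \<inter> (topspace Y - O') = {}"
        using level_clopen_separation[OF c(1), of "{y}" 0 "topspace Y - O'"] yl O'(2) by blast
      \<comment> \<open>\<open>L\<close> was separated from the complement of \<open>O'\<close>,
        where \<open>K0\<close> is the level 0; so \<open>L\<close> is part of \<open>K0\<close> and
        can serve as a cap.\<close>
      have "L \<subseteq> O'" using L(5) closedin_subset[OF L(2)] by blast
      then have LK: "L \<subseteq> K0" using L(1) O'(4) by (auto simp: level_def)
      define N where "N = (\<Union>b. box c b (stem c L b) (side b \<inter> {-(1/3)<..<1/3}))"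
      have "openin Y N" unfolding N_def by (rule openin_star[OF c(1) L(3)]) auto
      moreover have "y \<in> N"
      proof -
        obtain s where s: "s \<in> topspace (S c True)" "y = G c True s 0"
          using G_onto[OF c(1), of y True] yl by (auto simp: level_def)
        then have "s \<in> stem c L True" using L(4) by (simp add: stem_def)
        then have "y \<in> box c True (stem c L True) (side True \<inter> {-(1/3)<..<1/3})"
          unfolding s(2) by (rule box_memI) simp
        then show ?thesis unfolding N_def by blast
      qed
      moreover have "P N"
        unfolding P_def
      proof (intro allI impI)
        fix K assume K: "transversal K \<and> K0 \<subseteq> K"
        obtain K1 \<R>1 where 1: "transversal K1" "K \<subseteq> K1" "finite \<R>1" "\<forall>R\<in>\<R>1. capped K1 R"
          "box c True (stem c L True) (side True \<inter> {-1/3<..<1/3}) \<subseteq> \<Union>\<R>1"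
          by (rule cap_half_star[OF conjunct1[OF K] c(1) L(1) subset_trans[OF LK conjunct2[OF K]] L(2,3)])
        obtain K2 \<R>2 where 2: "transversal K2" "K1 \<subseteq> K2" "finite \<R>2" "\<forall>R\<in>\<R>2. capped K2 R"
          "box c False (stem c L False) (side False \<inter> {-1/3<..<1/3}) \<subseteq> \<Union>\<R>2"
          by (rule cap_half_star[OF 1(1) c(1) L(1) subset_trans[OF subset_trans[OF LK conjunct2[OF K]] 1(2)] L(2,3)])
        have "N = box c True (stem c L True) (side True \<inter> {-1/3<..<1/3}) \<union>
            box c False (stem c L False) (side False \<inter> {-1/3<..<1/3})"
          unfolding N_def UNIV_bool by (simp add: Un_commute)
        then have "N \<subseteq> \<Union>(\<R>1 \<union> \<R>2)" using 1(5) 2(5) by blast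
        moreover have "\<forall>R\<in>\<R>1 \<union> \<R>2. capped K2 R"
          using capped_mono[OF bspec[OF 1(4)] 2(2)] 2(4) by (simp add: ball_Un)
        ultimately show "\<exists>K' \<R>. transversal K' \<and> K \<subseteq> K' \<and> finite \<R> \<and> (\<forall>R\<in>\<R>. capped K' R) \<and> N \<subseteq> \<Union>\<R>"
          using 1 2 by (intro exI[of _ K2] exI[of _ "\<R>1 \<union> \<R>2"]) auto
      qed
      ultimately show ?thesis by blast
    qed
  qed
  moreover have "transversal K0" unfolding transversal_def using K0(1,2) by blast
  ultimately have "\<exists>K' \<R>. transversal K' \<and> K0 \<subseteq> K' \<and> finite \<R> \<and> (\<forall>R\<in>\<R>. capped K' R) \<and> topspace Y \<subseteq> \<Union>\<R>"
    unfolding P_def by simp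
  then show thesis using that by auto
qed

end

section \<open>Bundles of arcs between consecutive crossings\<close>

context oriented_charts
begin

text \<open>A bundle of arcs between consecutive crossings of \<open>K\<close>. Injectivity is asked
  in the interior only, because branching happens at the ends. Openness of the image of every open
  set of arcs allows arcs to be confined by connectedness, and the last clause records their
  direction through the heights of one chart \<open>d\<close>.\<close>

definition elementary :: "'a set \<Rightarrow> 's topology \<Rightarrow> ('s \<Rightarrow> real \<Rightarrow> 'a) \<Rightarrow> bool" where
  "elementary K Z Q \<longleftrightarrow>
     compact_space Z \<and> Hausdorff_space Z \<and> second_countable Z \<and> Z dim_le 0 \<and>
     continuous_map (prod_topology Z (top_of_set {0..1})) Y (\<lambda>(z, t). Q z t) \<and>
     (\<forall>z\<in>topspace Z. Q z 0 \<in> K \<and> Q z 1 \<in> K \<and> (\<forall>t. 0 < t \<and> t < 1 \<longrightarrow> Q z t \<notin> K)) \<and>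
     (\<forall>z\<in>topspace Z. \<forall>z'\<in>topspace Z. \<forall>t\<in>{0<..<1}. \<forall>t'\<in>{0<..<1}. Q z t = Q z' t' \<longrightarrow> z = z' \<and> t = t') \<and>
     (\<forall>W. openin Z W \<longrightarrow> openin Y {y. \<exists>z\<in>W. \<exists>t\<in>{0<..<1}. y = Q z t}) \<and>
     (\<exists>d\<in>\<Omega>. \<forall>z\<in>topspace Z. (\<forall>t\<in>{0..1}. Q z t \<in> V d) \<and>
        (\<forall>t t'. 0 \<le> t \<and> t < t' \<and> t' \<le> 1 \<longrightarrow> p d (Q z t) < p d (Q z t')))"

definition region :: "'s topology \<Rightarrow> ('s \<Rightarrow> real \<Rightarrow> 'a) \<Rightarrow> 'a set" where
  "region Z Q = {y. \<exists>z\<in>topspace Z. \<exists>t\<in>{0..1}. y = Q z t}"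

definition elementary_regions :: "'a set \<Rightarrow> 'a set set" where
  "elementary_regions K = {E. \<exists>Z Q. elementary K Z Q \<and> E = region Z Q}"

lemma tube:
  assumes c: "c \<in> \<Omega>" and T: "compact T" "T \<subseteq> side b" and O': "openin Y O'"
    and s0: "s0 \<in> topspace (S c b)" "\<forall>t\<in>T. G c b s0 t \<in> O'"
  obtains U where "openin (S c b) U" "s0 \<in> U" "\<forall>s\<in>U. \<forall>t\<in>T. G c b s t \<in> O'"
proof -
  let ?M = "prod_topology (S c b) (top_of_set (side b))"
  define W where "W = {x \<in> topspace ?M. (\<lambda>(s, t). G c b s t) x \<in> O'}"
  have "openin ?M W" unfolding W_def by (rule openin_continuous_map_preimage[OF G_cont[OF c] O'])
  moreover have "compactin (top_of_set (side b)) T" using T by (simp add: compactin_subtopology)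
  moreover have "{s0} \<times> T \<subseteq> W" unfolding W_def using s0 T(2) by auto
  ultimately obtain U U' where U: "openin (S c b) U" "s0 \<in> U" "T \<subseteq> U'" "U \<times> U' \<subseteq> W"
    using tube_lemma_right[of "S c b" "top_of_set (side b)" W T s0] s0(1) by blast
  have "G c b s t \<in> O'" if "s \<in> U" "t \<in> T" for s t
  proof -
    have "(s, t) \<in> W" using U(3,4) that by blast
    then show ?thesis by (simp add: W_def)
  qed
  then show thesis using that[OF U(1,2)] by blast
qed

lemma near_in_open:
  assumes c: "c \<in> \<Omega>" and s: "s \<in> topspace (S c b)" and t0: "t0 \<in> side b"
    and O': "openin Y O'" "G c b s t0 \<in> O'"
  obtains \<delta> where "\<delta> > 0" "\<forall>t\<in>side b. \<bar>t - t0\<bar> \<le> \<delta> \<longrightarrow> G c b s t \<in> O'"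
proof -
  have "openin (top_of_set (side b)) {t \<in> topspace (top_of_set (side b)). G c b s t \<in> O'}"
    using continuous_map_G_fixed_s[OF c s] O'(1) by (rule openin_continuous_map_preimage)
  then obtain U where U: "open U" "{t \<in> side b. G c b s t \<in> O'} = side b \<inter> U"
    by (auto simp: openin_open)
  have "t0 \<in> U" using U(2) t0 O'(2) by blast
  then obtain \<delta> where \<delta>: "\<delta> > 0" "cball t0 \<delta> \<subseteq> U" using U(1) open_contains_cball by blast
  have "G c b s t \<in> O'" if "t \<in> side b" "\<bar>t - t0\<bar> \<le> \<delta>" for t
  proof -
    have "t \<in> cball t0 \<delta>" using that(2) by (simp add: dist_real_def abs_minus_commute)
    then have "t \<in> {t \<in> side b. G c b s t \<in> O'}" unfolding U(2) using \<delta>(2) that(1) by blast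
    then show ?thesis by simp
  qed
  then show thesis using that[OF \<delta>(1)] by blast
qed

lemma closed_crossings:
  assumes c: "c \<in> \<Omega>" and s: "s \<in> topspace (S c b)" and K: "closedin Y K" and uv: "{u..v} \<subseteq> side b"
  shows "compact {t \<in> {u..v}. G c b s t \<in> K}"
proof -
  have "continuous_map (top_of_set {u..v}) Y (\<lambda>t. G c b s t)"
    using continuous_map_G_fixed_s[OF c s] uv by (rule continuous_map_from_subtopology_mono)
  then have "closedin (top_of_set {u..v}) {t \<in> topspace (top_of_set {u..v}). G c b s t \<in> K}"
    using K by (rule closedin_continuous_map_preimage)
  then have "closedin (top_of_set {u..v}) {t \<in> {u..v}. G c b s t \<in> K}" by simp
  then show ?thesis using closedin_compact compact_Icc by blast
qed

lemma continuous_on_p_G: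
  assumes c: "c \<in> \<Omega>" "d \<in> \<Omega>" and s: "s \<in> topspace (S c b)" and T: "T \<subseteq> side b" "\<forall>t\<in>T. G c b s t \<in> V d"
  shows "continuous_on T (\<lambda>t. p d (G c b s t))"
proof -
  have "continuous_map (top_of_set T) Y (\<lambda>t. G c b s t)"
    using continuous_map_G_fixed_s[OF c(1) s] T(1) by (rule continuous_map_from_subtopology_mono)
  then have "continuous_map (top_of_set T) (subtopology Y (V d)) (\<lambda>t. G c b s t)"
    using T(2) by (auto simp: continuous_map_in_subtopology)
  from continuous_map_compose[OF this p_cont[OF c(2)]] show ?thesis by (simp add: comp_def)
qed

end

section \<open>Crossings of the transversal within one capped box\<close>

locale capped_box = oriented_charts Y \<Omega> V p S G
  for Y :: "'a topology" and \<Omega> :: "'c set" and V :: "'c \<Rightarrow> 'a set" and p :: "'c \<Rightarrow> 'a \<Rightarrow> real"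
    and S :: "'c \<Rightarrow> bool \<Rightarrow> 's topology" and G :: "'c \<Rightarrow> bool \<Rightarrow> 's \<Rightarrow> real \<Rightarrow> 'a" +
  fixes K :: "'a set" and c :: 'c and b :: bool and A :: "'s set" and \<alpha> \<beta> :: real
  assumes K: "transversal K" and c: "c \<in> \<Omega>"
    and A: "openin (S c b) A" "closedin (S c b) A"
    and \<alpha>\<beta>: "\<alpha> < \<beta>" "{\<alpha>..\<beta>} \<subseteq> side b"
    and caps: "\<forall>s\<in>A. G c b s \<alpha> \<in> K \<and> G c b s \<beta> \<in> K"
begin

abbreviation g :: "'s \<Rightarrow> real \<Rightarrow> 'a" where "g \<equiv> G c b"

lemma A_subset: "A \<subseteq> topspace (S c b)"
  using A(1) openin_subset by blast

lemma closed_K: "closedin Y K"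
  using K by (simp add: transversal_def)

text \<open>0 is an end of either side, so it cannot lie strictly between two points of a side.
  Hence \<open>G_inj\<close> applies in the whole interior of the box.\<close>

lemma interior_nonzero: "\<alpha> < t \<Longrightarrow> t < \<beta> \<Longrightarrow> t \<noteq> 0"
proof -
  assume t: "\<alpha> < t" "t < \<beta>"
  have "\<alpha> \<in> side b" "\<beta> \<in> side b" using \<alpha>\<beta> by auto
  then show "t \<noteq> 0" using t by (auto simp: side_def split: if_splits)
qed

definition crossing :: "'s \<Rightarrow> real \<Rightarrow> real \<Rightarrow> real \<Rightarrow> bool" where
  "crossing s t0 \<delta> t \<longleftrightarrow> t \<in> {\<alpha>..\<beta>} \<and> \<bar>t - t0\<bar> \<le> \<delta> \<and> g s t \<in> K"

definition unique_near :: "'s \<Rightarrow> real \<Rightarrow> real \<Rightarrow> bool" where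
  "unique_near s t0 \<delta> \<longleftrightarrow> (\<exists>!t. crossing s t0 \<delta> t)"

text \<open>Near the crossing \<open>K\<close> is a level of a chart \<open>d\<close> whose height
  strictly increases along strands, which gives uniqueness. Existence for nearby strands comes from
  the caps if \<open>t0\<close> is an end of the box, and from the intermediate value theorem
  otherwise. All small \<open>\<delta>\<close> are allowed because later windows have to be kept
  apart.\<close>

lemma unique_crossing:
  assumes s0: "s0 \<in> A" and t0: "t0 \<in> {\<alpha>..\<beta>}" "g s0 t0 \<in> K"
  obtains \<delta>0 where "\<delta>0 > 0" "\<forall>\<delta>. 0 < \<delta> \<and> \<delta> \<le> \<delta>0 \<longrightarrow>
    (\<exists>U. openin (S c b) U \<and> s0 \<in> U \<and> U \<subseteq> A \<and> (\<forall>s\<in>U. unique_near s t0 \<delta>))"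
proof -
  obtain d O' where d: "d \<in> \<Omega>" "openin Y O'" "g s0 t0 \<in> O'" "O' \<subseteq> V d"
    "O' \<inter> K = {x \<in> O'. p d x = p d (g s0 t0)}"
    using K t0(2) unfolding transversal_def crosses_def by blast
  define l where "l = p d (g s0 t0)"
  have t0s: "t0 \<in> side b" using t0(1) \<alpha>\<beta>(2) by blast
  have s0S: "s0 \<in> topspace (S c b)" using s0 A_subset by blast
  obtain \<delta>1 where \<delta>1: "\<delta>1 > 0" "\<forall>t\<in>side b. \<bar>t - t0\<bar> \<le> \<delta>1 \<longrightarrow> g s0 t \<in> O'"
    by (rule near_in_open[OF c s0S t0s d(2,3)])
  \<comment> \<open>For an interior \<open>t0\<close> the window must stay inside the box, so that
    the heights at both its ends can be compared with the level. At an end of the box the cap is the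
    crossing, and any positive value will do.\<close>
  define \<delta>2 where "\<delta>2 = (if \<alpha> < t0 \<and> t0 < \<beta> then min (t0 - \<alpha>) (\<beta> - t0) else 1)"
  have \<delta>2: "\<delta>2 > 0" by (auto simp: \<delta>2_def)
  show thesis
  proof (rule that[of "min \<delta>1 \<delta>2"], use \<delta>1 \<delta>2 in simp, intro allI impI)
    fix \<delta> assume \<delta>: "0 < \<delta> \<and> \<delta> \<le> min \<delta>1 \<delta>2"
    define T where "T = {max \<alpha> (t0 - \<delta>)..min \<beta> (t0 + \<delta>)}"
    have Tmem: "t \<in> T \<longleftrightarrow> t \<in> {\<alpha>..\<beta>} \<and> \<bar>t - t0\<bar> \<le> \<delta>" for t unfolding T_def by auto
    have Ts: "T \<subseteq> side b" using \<alpha>\<beta>(2) Tmem by blast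
    have "\<forall>t\<in>T. g s0 t \<in> O'"
    proof
      fix t assume "t \<in> T"
      then have "t \<in> side b" "\<bar>t - t0\<bar> \<le> \<delta>1" using Tmem Ts \<delta> by auto
      then show "g s0 t \<in> O'" using \<delta>1(2) by blast
    qed
    then obtain U1 where U1: "openin (S c b) U1" "s0 \<in> U1" "\<forall>s\<in>U1. \<forall>t\<in>T. g s t \<in> O'"
      using tube[OF c _ Ts d(2) s0S] unfolding T_def by (metis compact_Icc)
    have inV: "g s t \<in> V d" if "s \<in> U1" "t \<in> T" for s t using U1(3) that d(4) by blast
    have strict: "p d (g s t) < p d (g s t')" if "s \<in> U1 \<inter> A" "t \<in> T" "t' \<in> T" "t < t'" for s t t'
    proof -
      have "{t..t'} \<subseteq> T" using that unfolding T_def by auto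
      then show ?thesis using that A_subset Ts inV by (intro orient[OF c d(1)]) auto
    qed
    have inK: "g s t \<in> K \<longleftrightarrow> p d (g s t) = l" if "s \<in> U1" "t \<in> T" for s t
    proof -
      have "g s t \<in> O'" using U1(3) that by blast
      then show ?thesis using d(5) unfolding l_def by blast
    qed
    have unique: "t = t'" if "s \<in> U1 \<inter> A" "crossing s t0 \<delta> t" "crossing s t0 \<delta> t'" for s t t'
    proof -
      have "t \<in> T" "t' \<in> T" "g s t \<in> K" "g s t' \<in> K" using that Tmem by (auto simp: crossing_def)
      then have "p d (g s t) = p d (g s t')" using inK that(1) by auto
      then show ?thesis using strict[OF that(1), of t t'] strict[OF that(1), of t' t] \<open>t \<in> T\<close> \<open>t' \<in> T\<close>
        by (metis less_irrefl linorder_neqE_linordered_idom)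
    qed
    have "\<exists>U. openin (S c b) U \<and> s0 \<in> U \<and> U \<subseteq> U1 \<inter> A \<and> (\<forall>s\<in>U. \<exists>t. crossing s t0 \<delta> t)"
    proof (cases "\<alpha> < t0 \<and> t0 < \<beta>")
      case False
      then have "t0 = \<alpha> \<or> t0 = \<beta>" using t0(1) by auto
      then have "\<forall>s\<in>U1 \<inter> A. crossing s t0 \<delta> t0"
        unfolding crossing_def using caps \<alpha>\<beta>(1) \<delta> by auto
      then show ?thesis using U1 A(1) s0 by (intro exI[of _ "U1 \<inter> A"]) auto
    next
      case True
      then have "\<delta> \<le> t0 - \<alpha>" "\<delta> \<le> \<beta> - t0" using \<delta> by (auto simp: \<delta>2_def)
      then have Teq: "T = {t0 - \<delta>..t0 + \<delta>}" unfolding T_def by auto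
      have ends: "t0 - \<delta> \<in> T" "t0 + \<delta> \<in> T" "t0 \<in> T" unfolding Teq using \<delta> by auto
      \<comment> \<open>The height in \<open>d\<close> lies below the level at one end of the window
        and above it at the other. Both inequalities are open conditions on the strand and thus
        persist nearby.\<close>
      have lo: "p d (g s0 (t0 - \<delta>)) < l" and hi: "l < p d (g s0 (t0 + \<delta>))"
        unfolding l_def using strict[of s0] U1(2) s0 ends \<delta> by auto
      have g2: "\<forall>t\<in>{t0 - \<delta>}. g s0 t \<in> {x \<in> V d. p d x \<in> {..<l}}" using lo inV[OF U1(2) ends(1)] by simp
      have g3: "\<forall>t\<in>{t0 + \<delta>}. g s0 t \<in> {x \<in> V d. p d x \<in> {l<..}}" using hi inV[OF U1(2) ends(2)] by simp
      have s23: "{t0 - \<delta>} \<subseteq> side b" "{t0 + \<delta>} \<subseteq> side b" using ends Ts by auto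
      obtain U2 where U2: "openin (S c b) U2" "s0 \<in> U2"
        "\<forall>s\<in>U2. \<forall>t\<in>{t0 - \<delta>}. g s t \<in> {x \<in> V d. p d x \<in> {..<l}}"
        by (rule tube[OF c compact_sing s23(1) openin_p_preimage[OF d(1) open_lessThan] s0S g2])
      obtain U3 where U3: "openin (S c b) U3" "s0 \<in> U3"
        "\<forall>s\<in>U3. \<forall>t\<in>{t0 + \<delta>}. g s t \<in> {x \<in> V d. p d x \<in> {l<..}}"
        by (rule tube[OF c compact_sing s23(2) openin_p_preimage[OF d(1) open_greaterThan] s0S g3])
      define U where "U = U1 \<inter> A \<inter> (U2 \<inter> U3)"
      have "\<exists>t. crossing s t0 \<delta> t" if s: "s \<in> U" for s
      proof -
        have sU: "s \<in> U1" "s \<in> A" "s \<in> U2" "s \<in> U3" using s by (auto simp: U_def)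
        have cont: "continuous_on {t0 - \<delta>..t0 + \<delta>} (\<lambda>t. p d (g s t))"
          using sU A_subset Ts inV unfolding Teq by (intro continuous_on_p_G[OF c d(1)]) auto
        have "p d (g s (t0 - \<delta>)) \<le> l" "l \<le> p d (g s (t0 + \<delta>))" using U2(3) U3(3) sU by auto
        then obtain t where t: "t0 - \<delta> \<le> t" "t \<le> t0 + \<delta>" "p d (g s t) = l"
          using IVT'[of "\<lambda>t. p d (g s t)" "t0 - \<delta>" l "t0 + \<delta>"] cont \<delta> by auto
        then have "t \<in> T" unfolding Teq by auto
        then show ?thesis using inK[OF sU(1)] t(3) Tmem unfolding crossing_def by blast
      qed
      moreover have "openin (S c b) U" unfolding U_def using U1 U2 U3 A by (intro openin_Int)
      moreover have "s0 \<in> U" "U \<subseteq> U1 \<inter> A" unfolding U_def using U1 U2 U3 s0 by auto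
      ultimately show ?thesis by blast
    qed
    then obtain U where U: "openin (S c b) U" "s0 \<in> U" "U \<subseteq> U1 \<inter> A" "\<forall>s\<in>U. \<exists>t. crossing s t0 \<delta> t"
      by blast
    have "unique_near s t0 \<delta>" if "s \<in> U" for s
    proof -
      obtain t where t: "crossing s t0 \<delta> t" using U(4) \<open>s \<in> U\<close> by blast
      have "s \<in> U1 \<inter> A" using U(3) that by blast
      then show ?thesis unfolding unique_near_def using t unique by (intro ex1I[of _ t]) blast+
    qed
    then show "\<exists>U. openin (S c b) U \<and> s0 \<in> U \<and> U \<subseteq> A \<and> (\<forall>s\<in>U. unique_near s t0 \<delta>)"
      using U(1-3) by (intro exI[of _ U]) auto
  qed
qed

lemma isolated_crossing:
  assumes s0: "s0 \<in> A" and t0: "t0 \<in> {\<alpha>..\<beta>}" "g s0 t0 \<in> K"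
  obtains \<delta> where "\<delta> > 0" "\<forall>t\<in>{\<alpha>..\<beta>}. \<bar>t - t0\<bar> \<le> \<delta> \<and> g s0 t \<in> K \<longrightarrow> t = t0"
proof -
  obtain \<delta>0 where \<delta>0: "\<delta>0 > 0" "\<forall>\<delta>. 0 < \<delta> \<and> \<delta> \<le> \<delta>0 \<longrightarrow>
    (\<exists>U. openin (S c b) U \<and> s0 \<in> U \<and> U \<subseteq> A \<and> (\<forall>s\<in>U. unique_near s t0 \<delta>))"
    by (rule unique_crossing[OF assms])
  then have "unique_near s0 t0 \<delta>0" by (metis order_refl)
  then have "\<exists>!t. crossing s0 t0 \<delta>0 t" by (simp only: unique_near_def)
  moreover have "crossing s0 t0 \<delta>0 t0" using t0 \<delta>0(1) by (simp add: crossing_def)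
  ultimately have "t = t0" if "crossing s0 t0 \<delta>0 t" for t using that by blast
  then show thesis using that[OF \<delta>0(1)] unfolding crossing_def by blast
qed

text \<open>After a gap of length \<open>\<delta>\<close> without further crossings, the remaining
  ones form a compact set, which contains \<open>\<beta>\<close> because of the cap; its least
  element is the next crossing.\<close>

lemma next_crossing:
  assumes s0: "s0 \<in> A" and t0: "t0 \<in> {\<alpha>..\<beta>}" "g s0 t0 \<in> K" "t0 < \<beta>"
  obtains t1 where "t0 < t1" "t1 \<in> {\<alpha>..\<beta>}" "g s0 t1 \<in> K" "\<forall>t. t0 < t \<and> t < t1 \<longrightarrow> g s0 t \<notin> K"
proof -
  obtain \<delta>' where \<delta>': "\<delta>' > 0" "\<forall>t\<in>{\<alpha>..\<beta>}. \<bar>t - t0\<bar> \<le> \<delta>' \<and> g s0 t \<in> K \<longrightarrow> t = t0"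
    by (rule isolated_crossing[OF s0 t0(1,2)])
  define \<delta> where "\<delta> = min \<delta>' (\<beta> - t0)"
  have \<delta>: "\<delta> > 0" "t0 + \<delta> \<le> \<beta>" using \<delta>'(1) t0(3) by (auto simp: \<delta>_def)
  define M where "M = {t \<in> {t0 + \<delta>..\<beta>}. g s0 t \<in> K}"
  have "{t0 + \<delta>..\<beta>} \<subseteq> {\<alpha>..\<beta>}" using t0(1) \<delta>(1) by auto
  then have "{t0 + \<delta>..\<beta>} \<subseteq> side b" using \<alpha>\<beta>(2) by blast
  then have "compact M" unfolding M_def using s0 A_subset closed_K by (intro closed_crossings[OF c]) auto
  moreover have "\<beta> \<in> M" unfolding M_def using \<delta>(2) caps s0 by auto
  ultimately obtain t1 where t1: "t1 \<in> M" "\<forall>t\<in>M. t1 \<le> t" using compact_attains_inf[of M] by auto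
  have "g s0 t \<notin> K" if "t0 < t" "t < t1" for t
  proof
    assume tK: "g s0 t \<in> K"
    have tI: "t \<in> {\<alpha>..\<beta>}" using that t0(1) t1(1) by (auto simp: M_def)
    show False
    proof (cases "t \<le> t0 + \<delta>")
      case True
      then have "\<bar>t - t0\<bar> \<le> \<delta>'" using that by (auto simp: \<delta>_def)
      then have "t = t0" using bspec[OF \<delta>'(2) tI] tK by blast
      then show False using that(1) by simp
    next
      case False
      then have "t \<in> M" using tI tK by (auto simp: M_def)
      then show False using t1(2) that(2) by auto
    qed
  qed
  then show thesis using that[of t1] t1(1) \<delta>(1) t0(1) by (auto simp: M_def)
qed

text \<open>The gap now precedes \<open>t0\<close>, the cap at \<open>\<alpha>\<close> keeps the
  compact set nonempty, and its greatest element is taken.\<close>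

lemma prev_crossing:
  assumes s0: "s0 \<in> A" and t0: "t0 \<in> {\<alpha>..\<beta>}" "g s0 t0 \<in> K" "\<alpha> < t0"
  obtains t1 where "t1 < t0" "t1 \<in> {\<alpha>..\<beta>}" "g s0 t1 \<in> K" "\<forall>t. t1 < t \<and> t < t0 \<longrightarrow> g s0 t \<notin> K"
proof -
  obtain \<delta>' where \<delta>': "\<delta>' > 0" "\<forall>t\<in>{\<alpha>..\<beta>}. \<bar>t - t0\<bar> \<le> \<delta>' \<and> g s0 t \<in> K \<longrightarrow> t = t0"
    by (rule isolated_crossing[OF s0 t0(1,2)])
  define \<delta> where "\<delta> = min \<delta>' (t0 - \<alpha>)"
  have \<delta>: "\<delta> > 0" "\<alpha> \<le> t0 - \<delta>" using \<delta>'(1) t0(3) by (auto simp: \<delta>_def)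
  define M where "M = {t \<in> {\<alpha>..t0 - \<delta>}. g s0 t \<in> K}"
  have "{\<alpha>..t0 - \<delta>} \<subseteq> {\<alpha>..\<beta>}" using t0(1) \<delta>(1) by auto
  then have "{\<alpha>..t0 - \<delta>} \<subseteq> side b" using \<alpha>\<beta>(2) by blast
  then have "compact M" unfolding M_def using s0 A_subset closed_K by (intro closed_crossings[OF c]) auto
  moreover have "\<alpha> \<in> M" unfolding M_def using \<delta>(2) caps s0 by auto
  ultimately obtain t1 where t1: "t1 \<in> M" "\<forall>t\<in>M. t \<le> t1" using compact_attains_sup[of M] by auto
  have "g s0 t \<notin> K" if "t1 < t" "t < t0" for t
  proof
    assume tK: "g s0 t \<in> K"
    have tI: "t \<in> {\<alpha>..\<beta>}" using that t0(1) t1(1) by (auto simp: M_def)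
    show False
    proof (cases "t0 - \<delta> \<le> t")
      case True
      then have "\<bar>t - t0\<bar> \<le> \<delta>'" using that by (auto simp: \<delta>_def)
      then have "t = t0" using bspec[OF \<delta>'(2) tI] tK by blast
      then show False using that(2) by simp
    next
      case False
      then have "t \<in> M" using tI tK by (auto simp: M_def)
      then show False using t1(2) that(1) by auto
    qed
  qed
  then show thesis using that[of t1] t1(1) \<delta>(1) t0(1) by (auto simp: M_def)
qed

text \<open>A closed graph argument: the strands whose crossing lies in a closed set
  \<open>C\<close> form the projection of a compact set of pairs of strand and height.\<close>

lemma continuous_crossing:
  assumes U: "closedin (S c b) U" and ex: "\<forall>s\<in>U. \<exists>!t. crossing s t0 \<delta> t"
  shows "continuous_map (subtopology (S c b) U) euclideanreal (\<lambda>s. THE t. crossing s t0 \<delta> t)"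
  unfolding continuous_map_closedin
proof (intro conjI ballI allI impI)
  let ?M = "prod_topology (S c b) (top_of_set (side b))"
  let ?\<tau> = "\<lambda>s. THE t. crossing s t0 \<delta> t"
  fix C :: "real set" assume "closedin euclideanreal C"
  then have C: "closed C" by simp
  define T where "T = {max \<alpha> (t0 - \<delta>)..min \<beta> (t0 + \<delta>)}"
  have Tmem: "t \<in> T \<longleftrightarrow> t \<in> {\<alpha>..\<beta>} \<and> \<bar>t - t0\<bar> \<le> \<delta>" for t unfolding T_def by auto
  have US: "U \<subseteq> topspace (S c b)" using U closedin_subset by blast
  have "closedin ?M {x \<in> topspace ?M. (\<lambda>(s, t). g s t) x \<in> K}"
    by (rule closedin_continuous_map_preimage[OF G_cont[OF c] closed_K])
  moreover have "compactin ?M (U \<times> (T \<inter> C))"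
  proof -
    have "compact (T \<inter> C)" unfolding T_def using C by (intro compact_Int_closed) auto
    moreover have "T \<inter> C \<subseteq> side b" using Tmem \<alpha>\<beta>(2) by blast
    ultimately show ?thesis
      using closedin_compact_space[OF S_compact[OF c] U] by (auto simp: compactin_Times compactin_subtopology)
  qed
  ultimately have "compactin ?M ({x \<in> topspace ?M. (\<lambda>(s, t). g s t) x \<in> K} \<inter> U \<times> (T \<inter> C))"
    by (rule closed_Int_compactin)
  then have "compactin (S c b) (fst ` ({x \<in> topspace ?M. (\<lambda>(s, t). g s t) x \<in> K} \<inter> U \<times> (T \<inter> C)))"
    by (rule image_compactin[OF _ continuous_map_fst])
  moreover have "fst ` ({x \<in> topspace ?M. (\<lambda>(s, t). g s t) x \<in> K} \<inter> U \<times> (T \<inter> C)) = {s \<in> U. ?\<tau> s \<in> C}"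
  proof (intro equalityI subsetI)
    fix s assume "s \<in> fst ` ({x \<in> topspace ?M. (\<lambda>(s, t). g s t) x \<in> K} \<inter> U \<times> (T \<inter> C))"
    then obtain t where t: "s \<in> U" "t \<in> T" "t \<in> C" "g s t \<in> K" by auto
    then have "crossing s t0 \<delta> t" using Tmem by (simp add: crossing_def)
    then have "?\<tau> s = t" by (rule the1_equality[OF bspec[OF ex t(1)]])
    then show "s \<in> {s \<in> U. ?\<tau> s \<in> C}" using t by simp
  next
    fix s assume s: "s \<in> {s \<in> U. ?\<tau> s \<in> C}"
    then have "s \<in> U" by simp
    then have "crossing s t0 \<delta> (?\<tau> s)" by (rule theI'[OF bspec[OF ex]])
    then have "?\<tau> s \<in> {\<alpha>..\<beta>}" and 1: "?\<tau> s \<in> T" "g s (?\<tau> s) \<in> K" using Tmem by (auto simp: crossing_def)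
    then have "?\<tau> s \<in> side b" using \<alpha>\<beta>(2) by blast
    then have "(s, ?\<tau> s) \<in> {x \<in> topspace ?M. (\<lambda>(s, t). g s t) x \<in> K} \<inter> U \<times> (T \<inter> C)"
      using 1 s US by auto
    then show "s \<in> fst ` ({x \<in> topspace ?M. (\<lambda>(s, t). g s t) x \<in> K} \<inter> U \<times> (T \<inter> C))"
      using image_eqI[of s fst "(s, ?\<tau> s)"] by simp
  qed
  ultimately have "closedin (S c b) {s \<in> U. ?\<tau> s \<in> C}"
    using compactin_imp_closedin[OF S_Hausdorff[OF c]] by metis
  moreover have "topspace (subtopology (S c b) U) = U" using US by auto
  ultimately show "closedin (subtopology (S c b) U) {s \<in> topspace (subtopology (S c b) U). ?\<tau> s \<in> C}"
    using closedin_subset_topspace by fastforce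
qed auto

end

context capped_box
begin

text \<open>Each strand is parameterized affinely from \<open>\<tau>0\<close> to
  \<open>\<tau>1\<close>. The open interior avoids height 0, so \<open>G_inj\<close> gives
  injectivity and \<open>openin_box\<close> gives openness; the chart \<open>c\<close> itself
  records the direction.\<close>

lemma elementary_strip:
  assumes U: "openin (S c b) U" "closedin (S c b) U" "U \<subseteq> A"
    and \<tau>: "\<forall>s\<in>U. \<tau>0 s \<in> {\<alpha>..\<beta>} \<and> \<tau>1 s \<in> {\<alpha>..\<beta>} \<and> \<tau>0 s < \<tau>1 s \<and> g s (\<tau>0 s) \<in> K \<and> g s (\<tau>1 s) \<in> K \<and>
      (\<forall>t. \<tau>0 s < t \<and> t < \<tau>1 s \<longrightarrow> g s t \<notin> K)"
    and cont: "continuous_map (subtopology (S c b) U) euclideanreal \<tau>0"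
      "continuous_map (subtopology (S c b) U) euclideanreal \<tau>1"
  shows "elementary K (subtopology (S c b) U) (\<lambda>s u. g s (\<tau>0 s + u * (\<tau>1 s - \<tau>0 s)))"
proof -
  let ?Z = "subtopology (S c b) U"
  define h where "h s u = \<tau>0 s + u * (\<tau>1 s - \<tau>0 s)" for s u
  have US: "U \<subseteq> topspace (S c b)" using U(3) A_subset by blast
  have tZ: "topspace ?Z = U" using US by auto
  have \<tau>D: "\<tau>0 s \<in> {\<alpha>..\<beta>}" "\<tau>1 s \<in> {\<alpha>..\<beta>}" "\<tau>0 s < \<tau>1 s" "g s (\<tau>0 s) \<in> K" "g s (\<tau>1 s) \<in> K"
    "\<And>t. \<tau>0 s < t \<Longrightarrow> t < \<tau>1 s \<Longrightarrow> g s t \<notin> K" if "s \<in> U" for s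
    using bspec[OF \<tau> that] by auto
  have h0: "h s 0 = \<tau>0 s" "h s 1 = \<tau>1 s" for s by (auto simp: h_def)
  have hmono: "h s u < h s u'" if "s \<in> U" "u < u'" for s u u'
    using \<tau>D(3)[OF that(1)] that(2) by (simp add: h_def)
  have hle: "h s u \<le> h s u'" if "s \<in> U" "u \<le> u'" for s u u'
    using hmono[of s u u'] that by (cases "u = u'") auto
  have hin: "h s u \<in> {\<alpha>..\<beta>}" if "s \<in> U" "u \<in> {0..1}" for s u
    using hle[OF that(1), of 0 u] hle[OF that(1), of u 1] \<tau>D(1,2)[OF that(1)] that(2) h0[of s] by auto
  have hside: "h s u \<in> side b" if "s \<in> U" "u \<in> {0..1}" for s u using hin[OF that] \<alpha>\<beta>(2) by blast
  have hopen: "\<tau>0 s < h s u" "h s u < \<tau>1 s" if "s \<in> U" "0 < u" "u < 1" for s u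
    using hmono[OF that(1), of 0 u] hmono[OF that(1), of u 1] that h0[of s] by auto
  have hne: "h s u \<noteq> 0" if "s \<in> U" "0 < u" "u < 1" for s u
    using hopen[OF that] \<tau>D(1,2)[OF that(1)] by (intro interior_nonzero) auto
  have Gin: "g s (h s u) \<in> V c" "p c (g s (h s u)) = h s u" if "s \<in> U" "u \<in> {0..1}" for s u
    using G_in_V[OF c _ hside[OF that]] p_G[OF c _ hside[OF that]] US that(1) by auto
  have "continuous_map (prod_topology ?Z (top_of_set {0..1})) Y (\<lambda>(s, u). g s (h s u))"
  proof -
    let ?P = "prod_topology ?Z (top_of_set {0..1::real})"
    have f: "continuous_map ?P ?Z fst" by (rule continuous_map_fst)
    have t0: "continuous_map ?P euclideanreal (\<lambda>x. \<tau>0 (fst x))"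
      "continuous_map ?P euclideanreal (\<lambda>x. \<tau>1 (fst x))"
      using continuous_map_compose[OF f cont(1)] continuous_map_compose[OF f cont(2)] by (simp_all add: comp_def)
    have "continuous_map ?P (top_of_set {0..1::real}) snd" by (rule continuous_map_snd)
    then have "continuous_map ?P euclideanreal snd" by (simp add: continuous_map_in_subtopology)
    then have "continuous_map ?P euclideanreal (\<lambda>x. \<tau>0 (fst x) + snd x * (\<tau>1 (fst x) - \<tau>0 (fst x)))"
      using t0 by (intro continuous_map_add continuous_map_real_mult continuous_map_diff)
    then have "continuous_map ?P euclideanreal (\<lambda>x. h (fst x) (snd x))" unfolding h_def .
    moreover have "(\<lambda>x. h (fst x) (snd x)) \<in> topspace ?P \<rightarrow> side b" using hside tZ by auto
    ultimately have "continuous_map ?P (top_of_set (side b)) (\<lambda>x. h (fst x) (snd x))"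
      by (simp add: continuous_map_in_subtopology)
    moreover have "continuous_map ?P (S c b) fst" using f continuous_map_in_subtopology by blast
    ultimately have "continuous_map ?P (prod_topology (S c b) (top_of_set (side b))) (\<lambda>x. (fst x, h (fst x) (snd x)))"
      by (rule continuous_map_pairedI[rotated])
    from continuous_map_compose[OF this G_cont[OF c]] show ?thesis by (simp add: comp_def case_prod_unfold)
  qed
  moreover have "openin Y {y. \<exists>z\<in>W. \<exists>t\<in>{0<..<1}. y = g z (h z t)}" if W: "openin ?Z W" for W
  proof (subst openin_subopen, intro ballI)
    have WU: "W \<subseteq> U" using W openin_subset tZ by blast
    fix y assume "y \<in> {y. \<exists>z\<in>W. \<exists>t\<in>{0<..<1}. y = g z (h z t)}"
    then obtain z u where z: "z \<in> W" "0 < u" "u < 1" "y = g z (h z u)" by auto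
    have zU: "z \<in> U" using z(1) WU by blast
    define t where "t = h z u"
    \<comment> \<open>The margin keeps the heights around \<open>t\<close> strictly between
      \<open>\<tau>0\<close> and \<open>\<tau>1\<close> also for strands near \<open>z\<close>, by
      continuity of both bounds.\<close>
    obtain \<eta> where \<eta>: "\<eta> > 0" "\<tau>0 z < t - \<eta>" "t + \<eta> < \<tau>1 z"
    proof (rule that[of "min (t - \<tau>0 z) (\<tau>1 z - t) / 2"])
    qed (use hopen[OF zU z(2,3)] in \<open>auto simp: t_def min_def field_simps\<close>)
    define W' where "W' = W \<inter> ({s \<in> U. \<tau>0 s \<in> {..<t - \<eta>}} \<inter> {s \<in> U. \<tau>1 s \<in> {t + \<eta><..}})"
    have o1: "openin ?Z {s \<in> topspace ?Z. \<tau>0 s \<in> {..<t - \<eta>}}"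
      by (rule openin_continuous_map_preimage[OF cont(1)]) simp
    have o2: "openin ?Z {s \<in> topspace ?Z. \<tau>1 s \<in> {t + \<eta><..}}"
      by (rule openin_continuous_map_preimage[OF cont(2)]) simp
    have "openin ?Z W'" unfolding W'_def using W o1 o2 unfolding tZ by (intro openin_Int)
    then have W'o: "openin (S c b) W'" using U(1) openin_trans_full by blast
    have zW': "z \<in> W'" unfolding W'_def using z zU \<eta> by auto
    have I: "{t - \<eta><..<t + \<eta>} \<subseteq> {\<alpha><..<\<beta>}" using \<eta> \<tau>D(1,2)[OF zU] by auto
    then have I2: "{t - \<eta><..<t + \<eta>} \<subseteq> side b" using \<alpha>\<beta>(2) greaterThanLessThan_subseteq_atLeastAtMost_iff by fastforce
    have I3: "0 \<notin> {t - \<eta><..<t + \<eta>}" using I interior_nonzero by fastforce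
    have "openin Y (box c b W' {t - \<eta><..<t + \<eta>})"
      by (rule openin_box[OF c W'o open_greaterThanLessThan I2 I3])
    moreover have "y \<in> box c b W' {t - \<eta><..<t + \<eta>}"
      unfolding z(4) t_def[symmetric] using zW' \<eta> by (intro box_memI) auto
    moreover have "box c b W' {t - \<eta><..<t + \<eta>} \<subseteq> {y. \<exists>z\<in>W. \<exists>t\<in>{0<..<1}. y = g z (h z t)}"
    proof
      fix x assume "x \<in> box c b W' {t - \<eta><..<t + \<eta>}"
      then obtain s t' where s: "s \<in> W'" "t' \<in> {t - \<eta><..<t + \<eta>}" "x = g s t'" by (rule box_memE)
      have sU: "s \<in> W" "s \<in> U" "\<tau>0 s < t'" "t' < \<tau>1 s" using s(1,2) by (auto simp: W'_def)
      define u' where "u' = (t' - \<tau>0 s) / (\<tau>1 s - \<tau>0 s)"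
      have "0 < u'" "u' < 1" using sU by (auto simp: u'_def field_simps)
      moreover have "h s u' = t'" using sU by (simp add: h_def u'_def)
      ultimately have "\<exists>t\<in>{0<..<1}. x = g s (h s t)" using s(3) by (intro bexI[of _ u']) auto
      then show "x \<in> {y. \<exists>z\<in>W. \<exists>t\<in>{0<..<1}. y = g z (h z t)}" using sU(1) by blast
    qed
    ultimately show "\<exists>T. openin Y T \<and> y \<in> T \<and> T \<subseteq> {y. \<exists>z\<in>W. \<exists>t\<in>{0<..<1}. y = g z (h z t)}" by blast
  qed
  moreover have "z = z' \<and> u = u'"
    if z: "z \<in> U" "z' \<in> U" "u \<in> {0<..<1}" "u' \<in> {0<..<1}" "g z (h z u) = g z' (h z' u')" for z z' u u'
  proof -
    have u01: "u \<in> {0..1}" "u' \<in> {0..1}" using z by auto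
    have eq: "h z u = h z' u'" using Gin(2)[OF z(1) u01(1)] Gin(2)[OF z(2) u01(2)] z(5) by simp
    have zz: "z = z'"
      using G_inj[OF c, of z b z' "h z u"] US z hside[OF z(1) u01(1)] hne[OF z(1), of u] eq by auto
    have "u = u'" using eq hmono[OF z(1), of u u'] hmono[OF z(1), of u' u] unfolding zz[symmetric]
      by (metis less_irrefl linorder_neqE_linordered_idom)
    then show ?thesis using zz by blast
  qed
  moreover have "g z (h z 0) \<in> K \<and> g z (h z 1) \<in> K \<and> (\<forall>t. 0 < t \<and> t < 1 \<longrightarrow> g z (h z t) \<notin> K)" if "z \<in> U" for z
    using \<tau>D(4-6)[OF that] hopen[OF that] h0 by simp
  moreover have "(\<forall>t\<in>{0..1}. g z (h z t) \<in> V c) \<and>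
        (\<forall>t t'. 0 \<le> t \<and> t < t' \<and> t' \<le> 1 \<longrightarrow> p c (g z (h z t)) < p c (g z (h z t')))" if "z \<in> U" for z
    using Gin[OF that] hmono[OF that] by auto
  moreover have "compact_space ?Z"
    using closedin_compact_space[OF S_compact[OF c] U(2)] by (simp add: compact_space_subtopology)
  moreover have "Hausdorff_space ?Z" using S_Hausdorff[OF c] by (rule Hausdorff_space_subtopology)
  moreover have "second_countable ?Z" using S_second_countable[OF c] by (rule second_countable_subtopology)
  moreover have "?Z dim_le 0" using S_dim[OF c] by (rule dimension_le_subtopology)
  ultimately have "elementary K ?Z (\<lambda>s u. g s (h s u))"
    unfolding elementary_def tZ using c by (intro conjI bexI[OF _ c] ballI allI impI) simp_all
  then show ?thesis by (simp add: h_def)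
qed

text \<open>Both crossings of \<open>s0\<close> persist uniquely in small windows for nearby
  strands, and by the tube lemma the stretch between the windows stays off \<open>K\<close>. So the
  two crossings remain consecutive. \<open>\<epsilon>\<close> bounds how far they may move.\<close>

lemma elementary_between:
  assumes s0: "s0 \<in> A" and t01: "t0 \<in> {\<alpha>..\<beta>}" "t1 \<in> {\<alpha>..\<beta>}" "t0 < t1"
    and K01: "g s0 t0 \<in> K" "g s0 t1 \<in> K" "\<forall>t. t0 < t \<and> t < t1 \<longrightarrow> g s0 t \<notin> K" and \<epsilon>: "\<epsilon> > 0"
  obtains U E where "openin (S c b) U" "s0 \<in> U" "U \<subseteq> A" "E \<in> elementary_regions K"
    "\<forall>s\<in>U. \<exists>\<tau>0 \<tau>1. crossing s t0 \<epsilon> \<tau>0 \<and> crossing s t1 \<epsilon> \<tau>1 \<and> (\<forall>t\<in>{\<tau>0..\<tau>1}. g s t \<in> E)"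
proof -
  have s0S: "s0 \<in> topspace (S c b)" using s0 A_subset by blast
  obtain \<delta>0 where \<delta>0: "\<delta>0 > 0" "\<forall>\<delta>. 0 < \<delta> \<and> \<delta> \<le> \<delta>0 \<longrightarrow>
    (\<exists>U. openin (S c b) U \<and> s0 \<in> U \<and> U \<subseteq> A \<and> (\<forall>s\<in>U. unique_near s t0 \<delta>))"
    by (rule unique_crossing[OF s0 t01(1) K01(1)])
  obtain \<delta>1 where \<delta>1: "\<delta>1 > 0" "\<forall>\<delta>. 0 < \<delta> \<and> \<delta> \<le> \<delta>1 \<longrightarrow>
    (\<exists>U. openin (S c b) U \<and> s0 \<in> U \<and> U \<subseteq> A \<and> (\<forall>s\<in>U. unique_near s t1 \<delta>))"
    by (rule unique_crossing[OF s0 t01(2) K01(2)])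
  \<comment> \<open>A third of the distance keeps the two windows disjoint.\<close>
  define \<delta> where "\<delta> = Min {\<epsilon>, \<delta>0, \<delta>1, (t1 - t0) / 3}"
  have \<delta>: "0 < \<delta>" "\<delta> \<le> \<epsilon>" "\<delta> \<le> \<delta>0" "\<delta> \<le> \<delta>1" "\<delta> \<le> (t1 - t0) / 3"
  proof -
    show "0 < \<delta>" using \<epsilon> \<delta>0(1) \<delta>1(1) t01(3) by (simp add: \<delta>_def)
    show "\<delta> \<le> \<epsilon>" "\<delta> \<le> \<delta>0" "\<delta> \<le> \<delta>1" "\<delta> \<le> (t1 - t0) / 3" unfolding \<delta>_def by (rule Min_le; simp)+
  qed
  obtain U0 where U0: "openin (S c b) U0" "s0 \<in> U0" "U0 \<subseteq> A" "\<forall>s\<in>U0. unique_near s t0 \<delta>"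
    using \<delta>0(2) \<delta>(1,3) by blast
  obtain U1 where U1: "openin (S c b) U1" "s0 \<in> U1" "U1 \<subseteq> A" "\<forall>s\<in>U1. unique_near s t1 \<delta>"
    using \<delta>1(2) \<delta>(1,4) by blast
  have mid: "{t0 + \<delta>..t1 - \<delta>} \<subseteq> {\<alpha>..\<beta>}" using t01 \<delta>(1) by auto
  have mid_side: "{t0 + \<delta>..t1 - \<delta>} \<subseteq> side b" using mid \<alpha>\<beta>(2) by blast
  have "\<forall>t\<in>{t0 + \<delta>..t1 - \<delta>}. g s0 t \<in> topspace Y - K"
  proof
    fix t assume t: "t \<in> {t0 + \<delta>..t1 - \<delta>}"
    then have "t0 < t \<and> t < t1" using \<delta>(1) by auto
    then have "g s0 t \<notin> K" using K01(3) by blast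
    moreover have "g s0 t \<in> V c" using G_in_V[OF c s0S, of t] t mid_side by blast
    ultimately show "g s0 t \<in> topspace Y - K" using V_subset[OF c] by blast
  qed
  then obtain U2 where U2: "openin (S c b) U2" "s0 \<in> U2" "\<forall>s\<in>U2. \<forall>t\<in>{t0 + \<delta>..t1 - \<delta>}. g s t \<in> topspace Y - K"
    by (rule tube[OF c compact_Icc mid_side openin_diff[OF openin_topspace closed_K] s0S])
  have "openin (S c b) (U0 \<inter> (U1 \<inter> U2))" "s0 \<in> U0 \<inter> (U1 \<inter> U2)" using U0 U1 U2 by (auto intro: openin_Int)
  then obtain U where U: "openin (S c b) U" "closedin (S c b) U" "s0 \<in> U" "U \<subseteq> U0 \<inter> (U1 \<inter> U2)"
    by (rule clopen_neighbourhood[OF S_dim[OF c]])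
  have sub: "U \<subseteq> U0" "U \<subseteq> U1" "U \<subseteq> U2" "U \<subseteq> A" using U(4) U0(3) by blast+
  define \<tau>0 where "\<tau>0 s = (THE t. crossing s t0 \<delta> t)" for s
  define \<tau>1 where "\<tau>1 s = (THE t. crossing s t1 \<delta> t)" for s
  have ex0: "\<forall>s\<in>U. \<exists>!t. crossing s t0 \<delta> t" and ex1: "\<forall>s\<in>U. \<exists>!t. crossing s t1 \<delta> t"
    unfolding unique_near_def[symmetric] using U0(4) U1(4) sub by blast+
  have c0: "crossing s t0 \<delta> (\<tau>0 s)" and c1: "crossing s t1 \<delta> (\<tau>1 s)" if "s \<in> U" for s
    unfolding \<tau>0_def \<tau>1_def by (rule theI'[OF bspec[OF ex0 that]], rule theI'[OF bspec[OF ex1 that]])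
  have cont0: "continuous_map (subtopology (S c b) U) euclideanreal \<tau>0"
  proof -
    have "\<tau>0 = (\<lambda>s. THE t. crossing s t0 \<delta> t)" by (rule ext) (simp only: \<tau>0_def)
    then show ?thesis using continuous_crossing[OF U(2) ex0] by (simp only:)
  qed
  have cont1: "continuous_map (subtopology (S c b) U) euclideanreal \<tau>1"
  proof -
    have "\<tau>1 = (\<lambda>s. THE t. crossing s t1 \<delta> t)" by (rule ext) (simp only: \<tau>1_def)
    then show ?thesis using continuous_crossing[OF U(2) ex1] by (simp only:)
  qed
  have less: "\<tau>0 s < \<tau>1 s" if "s \<in> U" for s
    using c0[OF that] c1[OF that] \<delta>(1,5) unfolding crossing_def by (auto simp: abs_le_iff)
  have noK: "g s t \<notin> K" if s: "s \<in> U" and t: "\<tau>0 s < t" "t < \<tau>1 s" for s t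
  proof
    assume tK: "g s t \<in> K"
    have tI: "t \<in> {\<alpha>..\<beta>}" using c0[OF s] c1[OF s] t unfolding crossing_def by auto
    have t': "t0 - \<delta> \<le> t" "t \<le> t1 + \<delta>" using c0[OF s] c1[OF s] t unfolding crossing_def by (auto simp: abs_le_iff)
    consider "t < t0 + \<delta>" | "t1 - \<delta> < t" | "t \<in> {t0 + \<delta>..t1 - \<delta>}" by fastforce
    then show False
    proof cases
      case 1
      then have "crossing s t0 \<delta> t" using tI tK t' by (auto simp: crossing_def abs_le_iff)
      then have "t = \<tau>0 s" unfolding \<tau>0_def using bspec[OF ex0 s] by (rule the1_equality[symmetric, rotated])
      then show False using t by simp
    next
      case 2
      then have "crossing s t1 \<delta> t" using tI tK t' by (auto simp: crossing_def abs_le_iff)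
      then have "t = \<tau>1 s" unfolding \<tau>1_def using bspec[OF ex1 s] by (rule the1_equality[symmetric, rotated])
      then show False using t by simp
    next
      case 3
      then have "g s t \<in> topspace Y - K" using U2(3) s sub(3) by blast
      then show False using tK by blast
    qed
  qed
  let ?Z = "subtopology (S c b) U" and ?Q = "\<lambda>s u. g s (\<tau>0 s + u * (\<tau>1 s - \<tau>0 s))"
  have "elementary K ?Z ?Q"
  proof (rule elementary_strip[OF U(1,2) sub(4) _ cont0 cont1], intro ballI)
    fix s assume s: "s \<in> U"
    show "\<tau>0 s \<in> {\<alpha>..\<beta>} \<and> \<tau>1 s \<in> {\<alpha>..\<beta>} \<and> \<tau>0 s < \<tau>1 s \<and> g s (\<tau>0 s) \<in> K \<and> g s (\<tau>1 s) \<in> K \<and>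
      (\<forall>t. \<tau>0 s < t \<and> t < \<tau>1 s \<longrightarrow> g s t \<notin> K)"
      using c0[OF s] c1[OF s] less[OF s] noK[OF s] unfolding crossing_def by simp
  qed
  then have E: "region ?Z ?Q \<in> elementary_regions K" unfolding elementary_regions_def by blast
  have "\<forall>s\<in>U. \<exists>\<tau>0 \<tau>1. crossing s t0 \<epsilon> \<tau>0 \<and> crossing s t1 \<epsilon> \<tau>1 \<and> (\<forall>t\<in>{\<tau>0..\<tau>1}. g s t \<in> region ?Z ?Q)"
  proof
    fix s assume s: "s \<in> U"
    have "crossing s t0 \<epsilon> (\<tau>0 s)" "crossing s t1 \<epsilon> (\<tau>1 s)"
      using c0[OF s] c1[OF s] \<delta>(2) by (auto simp: crossing_def)
    moreover have "g s t \<in> region ?Z ?Q" if t: "t \<in> {\<tau>0 s..\<tau>1 s}" for t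
    proof -
      define u where "u = (t - \<tau>0 s) / (\<tau>1 s - \<tau>0 s)"
      have u: "u \<in> {0..1}" "\<tau>0 s + u * (\<tau>1 s - \<tau>0 s) = t"
        using t less[OF s] by (auto simp: u_def field_simps)
      have "s \<in> topspace ?Z" using s sub(4) A_subset by auto
      moreover have "g s t = ?Q s u" by (simp only: u(2))
      ultimately show ?thesis unfolding region_def using u(1) by blast
    qed
    ultimately show "\<exists>\<tau>0 \<tau>1. crossing s t0 \<epsilon> \<tau>0 \<and> crossing s t1 \<epsilon> \<tau>1 \<and> (\<forall>t\<in>{\<tau>0..\<tau>1}. g s t \<in> region ?Z ?Q)"
      by blast
  qed
  then show thesis by (rule that[OF U(1,3) sub(4) E])
qed

text \<open>A point off \<open>K\<close> lies strictly between two consecutive crossings of its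
  strand, and one strip covers its surroundings. At a crossing two strips are needed, one up to the
  next crossing and one down to the previous; at an end of the box one of them suffices.\<close>

lemma local_cover:
  assumes s0: "s0 \<in> A" and t0: "t0 \<in> {\<alpha>..\<beta>}"
  obtains U \<delta> \<E> where "openin (S c b) U" "s0 \<in> U" "\<delta> > 0" "finite \<E>" "\<E> \<subseteq> elementary_regions K"
    "\<forall>s\<in>U. \<forall>t\<in>{\<alpha>..\<beta>}. \<bar>t - t0\<bar> < \<delta> \<longrightarrow> g s t \<in> \<Union>\<E>"
proof (cases "g s0 t0 \<in> K")
  case False
  have s0S: "s0 \<in> topspace (S c b)" using s0 A_subset by blast
  define M where "M = {t \<in> {\<alpha>..t0}. g s0 t \<in> K}"
  have "{\<alpha>..t0} \<subseteq> {\<alpha>..\<beta>}" using t0 by auto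
  then have "{\<alpha>..t0} \<subseteq> side b" using \<alpha>\<beta>(2) by blast
  then have "compact M" unfolding M_def by (rule closed_crossings[OF c s0S closed_K])
  moreover have "\<alpha> \<in> M" unfolding M_def using t0 caps s0 by auto
  ultimately obtain t1 where t1: "t1 \<in> M" "\<forall>t\<in>M. t \<le> t1" using compact_attains_sup[of M] by auto
  have t1': "t1 \<in> {\<alpha>..\<beta>}" "g s0 t1 \<in> K" "t1 \<le> t0" using t1(1) t0 by (auto simp: M_def)
  then have "t1 < t0" using False by (cases "t1 = t0") auto
  then have "t1 < \<beta>" using t0 by auto
  then obtain t2 where t2: "t1 < t2" "t2 \<in> {\<alpha>..\<beta>}" "g s0 t2 \<in> K" "\<forall>t. t1 < t \<and> t < t2 \<longrightarrow> g s0 t \<notin> K"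
    by (rule next_crossing[OF s0 t1'(1,2)])
  have "t0 < t2"
  proof (rule ccontr)
    assume "\<not> t0 < t2"
    then have "t2 \<in> M" using t2 by (auto simp: M_def)
    then show False using t1(2) t2(1) by auto
  qed
  \<comment> \<open>Half of the smaller distance: crossings that move by at most
    \<open>\<epsilon>\<close> leave all heights within \<open>\<epsilon>\<close> of
    \<open>t0\<close> between them.\<close>
  define \<epsilon> where "\<epsilon> = min (t0 - t1) (t2 - t0) / 2"
  have "\<epsilon> \<le> (t0 - t1) / 2" "\<epsilon> \<le> (t2 - t0) / 2" unfolding \<epsilon>_def by (intro divide_right_mono; simp)+
  moreover have "\<epsilon> > 0" unfolding \<epsilon>_def using \<open>t1 < t0\<close> \<open>t0 < t2\<close> by simp
  ultimately have \<epsilon>: "\<epsilon> > 0" "t1 + \<epsilon> \<le> t0 - \<epsilon>" "t0 + \<epsilon> \<le> t2 - \<epsilon>" by (simp_all add: field_simps)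
  obtain U E where E: "openin (S c b) U" "s0 \<in> U" "U \<subseteq> A" "E \<in> elementary_regions K"
    "\<forall>s\<in>U. \<exists>\<tau>0 \<tau>1. crossing s t1 \<epsilon> \<tau>0 \<and> crossing s t2 \<epsilon> \<tau>1 \<and> (\<forall>t\<in>{\<tau>0..\<tau>1}. g s t \<in> E)"
    by (rule elementary_between[OF s0 t1'(1) t2(2,1) t1'(2) t2(3,4) \<epsilon>(1)])
  have "g s t \<in> E" if "s \<in> U" "\<bar>t - t0\<bar> < \<epsilon>" for s t
  proof -
    obtain \<tau>0 \<tau>1 where \<tau>: "crossing s t1 \<epsilon> \<tau>0" "crossing s t2 \<epsilon> \<tau>1" "\<forall>t\<in>{\<tau>0..\<tau>1}. g s t \<in> E"
      using E(5) \<open>s \<in> U\<close> by blast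
    have "t \<in> {\<tau>0..\<tau>1}" using \<tau>(1,2) \<open>\<bar>t - t0\<bar> < \<epsilon>\<close> \<epsilon> unfolding crossing_def by auto
    then show ?thesis using \<tau>(3) by blast
  qed
  then show thesis using E(4) by (intro that[OF E(1,2) \<epsilon>(1), of "{E}"]) auto
next
  case True
  obtain \<delta>0 where \<delta>0: "\<delta>0 > 0" "\<forall>\<delta>. 0 < \<delta> \<and> \<delta> \<le> \<delta>0 \<longrightarrow>
    (\<exists>U. openin (S c b) U \<and> s0 \<in> U \<and> U \<subseteq> A \<and> (\<forall>s\<in>U. unique_near s t0 \<delta>))"
    by (rule unique_crossing[OF s0 t0 True])
  \<comment> \<open>At most half of the distance to the next crossing, for the same reason as off
    \<open>K\<close>; the value 1 is a default for the upper end of the box, where there is no next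
    crossing.\<close>
  obtain \<gamma>r where \<gamma>r: "\<gamma>r > 0" "t0 < \<beta> \<longrightarrow> (\<exists>t1. t0 + 2 * \<gamma>r \<le> t1 \<and> t1 \<in> {\<alpha>..\<beta>} \<and> g s0 t1 \<in> K \<and> (\<forall>t. t0 < t \<and> t < t1 \<longrightarrow> g s0 t \<notin> K))"
  proof (cases "t0 < \<beta>")
    case less: True
    obtain t1 where t1: "t0 < t1" "t1 \<in> {\<alpha>..\<beta>}" "g s0 t1 \<in> K" "\<forall>t. t0 < t \<and> t < t1 \<longrightarrow> g s0 t \<notin> K"
      by (rule next_crossing[OF s0 t0 True less])
    then show thesis by (intro that[of "(t1 - t0) / 2"] impI exI[of _ t1]) (auto simp: field_simps)
  qed (use that[of 1] in simp)
  obtain \<gamma>l where \<gamma>l: "\<gamma>l > 0" "\<alpha> < t0 \<longrightarrow> (\<exists>t1. t1 \<le> t0 - 2 * \<gamma>l \<and> t1 \<in> {\<alpha>..\<beta>} \<and> g s0 t1 \<in> K \<and> (\<forall>t. t1 < t \<and> t < t0 \<longrightarrow> g s0 t \<notin> K))"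
  proof (cases "\<alpha> < t0")
    case less: True
    obtain t1 where t1: "t1 < t0" "t1 \<in> {\<alpha>..\<beta>}" "g s0 t1 \<in> K" "\<forall>t. t1 < t \<and> t < t0 \<longrightarrow> g s0 t \<notin> K"
      by (rule prev_crossing[OF s0 t0 True less])
    then show thesis by (intro that[of "(t0 - t1) / 2"] impI exI[of _ t1]) (auto simp: field_simps)
  qed (use that[of 1] in simp)
  define \<epsilon> where "\<epsilon> = Min {\<delta>0, \<gamma>r, \<gamma>l}"
  have \<epsilon>: "\<epsilon> > 0" "\<epsilon> \<le> \<delta>0" "\<epsilon> \<le> \<gamma>r" "\<epsilon> \<le> \<gamma>l" using \<delta>0(1) \<gamma>r(1) \<gamma>l(1) by (auto simp: \<epsilon>_def)
  obtain U0 where U0: "openin (S c b) U0" "s0 \<in> U0" "U0 \<subseteq> A" "\<forall>s\<in>U0. unique_near s t0 \<epsilon>"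
    using \<delta>0(2) \<epsilon>(1,2) by blast
  \<comment> \<open>The strip above the crossing. The guard \<open>t0 < \<beta>\<close> makes the
    claim hold with the empty family at the upper end of the box.\<close>
  have "\<exists>U \<E>. openin (S c b) U \<and> s0 \<in> U \<and> finite \<E> \<and> \<E> \<subseteq> elementary_regions K \<and>
    (\<forall>s\<in>U. \<forall>t\<in>{\<alpha>..\<beta>}. t0 < \<beta> \<and> t < t0 + \<epsilon> \<and> (\<forall>\<tau>. crossing s t0 \<epsilon> \<tau> \<longrightarrow> \<tau> \<le> t) \<longrightarrow> g s t \<in> \<Union>\<E>)"
  proof (cases "t0 < \<beta>")
    case less: True
    then obtain t1 where t1: "t0 + 2 * \<gamma>r \<le> t1" "t1 \<in> {\<alpha>..\<beta>}" "g s0 t1 \<in> K" "\<forall>t. t0 < t \<and> t < t1 \<longrightarrow> g s0 t \<notin> K"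
      using \<gamma>r(2) by blast
    then have "t0 < t1" using \<gamma>r(1) by simp
    obtain U E where E: "openin (S c b) U" "s0 \<in> U" "U \<subseteq> A" "E \<in> elementary_regions K"
      "\<forall>s\<in>U. \<exists>\<tau>0 \<tau>1. crossing s t0 \<epsilon> \<tau>0 \<and> crossing s t1 \<epsilon> \<tau>1 \<and> (\<forall>t\<in>{\<tau>0..\<tau>1}. g s t \<in> E)"
      by (rule elementary_between[OF s0 t0 t1(2) \<open>t0 < t1\<close> True t1(3,4) \<epsilon>(1)])
    have "g s t \<in> E" if s: "s \<in> U" and t: "t < t0 + \<epsilon>" "\<forall>\<tau>. crossing s t0 \<epsilon> \<tau> \<longrightarrow> \<tau> \<le> t" for s t
    proof -
      obtain \<tau>0 \<tau>1 where \<tau>: "crossing s t0 \<epsilon> \<tau>0" "crossing s t1 \<epsilon> \<tau>1" "\<forall>t\<in>{\<tau>0..\<tau>1}. g s t \<in> E"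
        using E(5) s by blast
      have "\<tau>0 \<le> t" using t(2) \<tau>(1) by blast
      moreover have "t \<le> \<tau>1" using \<tau>(2) t(1) t1(1) \<epsilon>(3) unfolding crossing_def by auto
      ultimately show ?thesis using \<tau>(3) by auto
    qed
    then show ?thesis using E by (intro exI[of _ U] exI[of _ "{E}"]) auto
  next
    case False
    then show ?thesis using U0 by (intro exI[of _ U0] exI[of _ "{}"]) auto
  qed
  then obtain U1 \<E>1 where 1: "openin (S c b) U1" "s0 \<in> U1" "finite \<E>1" "\<E>1 \<subseteq> elementary_regions K"
    "\<forall>s\<in>U1. \<forall>t\<in>{\<alpha>..\<beta>}. t0 < \<beta> \<and> t < t0 + \<epsilon> \<and> (\<forall>\<tau>. crossing s t0 \<epsilon> \<tau> \<longrightarrow> \<tau> \<le> t) \<longrightarrow> g s t \<in> \<Union>\<E>1" by auto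
  have "\<exists>U \<E>. openin (S c b) U \<and> s0 \<in> U \<and> finite \<E> \<and> \<E> \<subseteq> elementary_regions K \<and>
    (\<forall>s\<in>U. \<forall>t\<in>{\<alpha>..\<beta>}. \<alpha> < t0 \<and> t0 - \<epsilon> < t \<and> (\<forall>\<tau>. crossing s t0 \<epsilon> \<tau> \<longrightarrow> t \<le> \<tau>) \<longrightarrow> g s t \<in> \<Union>\<E>)"
  proof (cases "\<alpha> < t0")
    case less: True
    then obtain t1 where t1: "t1 \<le> t0 - 2 * \<gamma>l" "t1 \<in> {\<alpha>..\<beta>}" "g s0 t1 \<in> K" "\<forall>t. t1 < t \<and> t < t0 \<longrightarrow> g s0 t \<notin> K"
      using \<gamma>l(2) by blast
    then have "t1 < t0" using \<gamma>l(1) by simp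
    obtain U E where E: "openin (S c b) U" "s0 \<in> U" "U \<subseteq> A" "E \<in> elementary_regions K"
      "\<forall>s\<in>U. \<exists>\<tau>0 \<tau>1. crossing s t1 \<epsilon> \<tau>0 \<and> crossing s t0 \<epsilon> \<tau>1 \<and> (\<forall>t\<in>{\<tau>0..\<tau>1}. g s t \<in> E)"
      by (rule elementary_between[OF s0 t1(2) t0 \<open>t1 < t0\<close> t1(3) True t1(4) \<epsilon>(1)])
    have "g s t \<in> E" if s: "s \<in> U" and t: "t0 - \<epsilon> < t" "\<forall>\<tau>. crossing s t0 \<epsilon> \<tau> \<longrightarrow> t \<le> \<tau>" for s t
    proof -
      obtain \<tau>0 \<tau>1 where \<tau>: "crossing s t1 \<epsilon> \<tau>0" "crossing s t0 \<epsilon> \<tau>1" "\<forall>t\<in>{\<tau>0..\<tau>1}. g s t \<in> E"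
        using E(5) s by blast
      have "t \<le> \<tau>1" using t(2) \<tau>(2) by blast
      moreover have "\<tau>0 \<le> t" using \<tau>(1) t(1) t1(1) \<epsilon>(4) unfolding crossing_def by auto
      ultimately show ?thesis using \<tau>(3) by auto
    qed
    then show ?thesis using E by (intro exI[of _ U] exI[of _ "{E}"]) auto
  next
    case False
    then show ?thesis using U0 by (intro exI[of _ U0] exI[of _ "{}"]) auto
  qed
  then obtain U2 \<E>2 where 2: "openin (S c b) U2" "s0 \<in> U2" "finite \<E>2" "\<E>2 \<subseteq> elementary_regions K"
    "\<forall>s\<in>U2. \<forall>t\<in>{\<alpha>..\<beta>}. \<alpha> < t0 \<and> t0 - \<epsilon> < t \<and> (\<forall>\<tau>. crossing s t0 \<epsilon> \<tau> \<longrightarrow> t \<le> \<tau>) \<longrightarrow> g s t \<in> \<Union>\<E>2" by auto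
  have "g s t \<in> \<Union>(\<E>1 \<union> \<E>2)" if s: "s \<in> U0 \<inter> (U1 \<inter> U2)" and t: "t \<in> {\<alpha>..\<beta>}" "\<bar>t - t0\<bar> < \<epsilon>" for s t
  proof -
    have "unique_near s t0 \<epsilon>" using U0(4) s by blast
    then obtain \<tau> where \<tau>: "crossing s t0 \<epsilon> \<tau>" "\<forall>\<tau>'. crossing s t0 \<epsilon> \<tau>' \<longrightarrow> \<tau>' = \<tau>"
      unfolding unique_near_def by (rule ex1E) blast
    have "s \<in> A" using s U0(3) by blast
    \<comment> \<open>At an end of the box the cap is the unique crossing near it, so no point of
      the box lies on the side where the strip is missing.\<close>
    have b: "\<tau> = \<beta>" if "t0 = \<beta>"
      using spec[OF \<tau>(2), of \<beta>] that caps \<open>s \<in> A\<close> \<epsilon>(1) \<alpha>\<beta>(1) by (auto simp: crossing_def)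
    have a: "\<tau> = \<alpha>" if "t0 = \<alpha>"
      using spec[OF \<tau>(2), of \<alpha>] that caps \<open>s \<in> A\<close> \<epsilon>(1) \<alpha>\<beta>(1) by (auto simp: crossing_def)
    consider "\<tau> \<le> t" "t0 < \<beta>" | "t \<le> \<tau>" "\<alpha> < t0"
      using t(1) t0 a b \<alpha>\<beta>(1) by fastforce
    then show ?thesis
    proof cases
      case 1
      then have "\<forall>\<tau>'. crossing s t0 \<epsilon> \<tau>' \<longrightarrow> \<tau>' \<le> t" using \<tau>(2) by metis
      moreover have "t < t0 + \<epsilon>" using t(2) by auto
      ultimately have "g s t \<in> \<Union>\<E>1" using \<open>t0 < \<beta>\<close> 1 s t(1) \<open>finite \<E>1\<close>
        \<open>\<forall>s\<in>U1. \<forall>t\<in>{\<alpha>..\<beta>}. t0 < \<beta> \<and> t < t0 + \<epsilon> \<and> (\<forall>\<tau>. crossing s t0 \<epsilon> \<tau> \<longrightarrow> \<tau> \<le> t) \<longrightarrow> g s t \<in> \<Union>\<E>1\<close> by blast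
      then show ?thesis by blast
    next
      case 2
      then have "\<forall>\<tau>'. crossing s t0 \<epsilon> \<tau>' \<longrightarrow> t \<le> \<tau>'" using \<tau>(2) by metis
      moreover have "t0 - \<epsilon> < t" using t(2) by auto
      ultimately have "g s t \<in> \<Union>\<E>2" using \<open>\<alpha> < t0\<close> s t(1)
        \<open>\<forall>s\<in>U2. \<forall>t\<in>{\<alpha>..\<beta>}. \<alpha> < t0 \<and> t0 - \<epsilon> < t \<and> (\<forall>\<tau>. crossing s t0 \<epsilon> \<tau> \<longrightarrow> t \<le> \<tau>) \<longrightarrow> g s t \<in> \<Union>\<E>2\<close> by blast
      then show ?thesis by blast
    qed
  qed
  moreover have "openin (S c b) (U0 \<inter> (U1 \<inter> U2))" using U0 1 2 by (intro openin_Int)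
  ultimately show thesis
    using U0(2) 1(2-4) 2(2-4) \<epsilon>(1) by (intro that[of "U0 \<inter> (U1 \<inter> U2)" \<epsilon> "\<E>1 \<union> \<E>2"]) blast+
qed

lemma box_cover:
  obtains \<E> where "finite \<E>" "\<E> \<subseteq> elementary_regions K" "box c b A {\<alpha>..\<beta>} \<subseteq> \<Union>\<E>"
proof -
  let ?M = "prod_topology (S c b) (top_of_set {\<alpha>..\<beta>})"
  define P where "P N \<longleftrightarrow> (\<exists>\<E>. finite \<E> \<and> \<E> \<subseteq> elementary_regions K \<and>
    (\<forall>x\<in>N. snd x \<in> {\<alpha>..\<beta>} \<longrightarrow> g (fst x) (snd x) \<in> \<Union>\<E>))" for N
  have "P (A \<times> {\<alpha>..\<beta>})"
  proof (rule compactin_local_to_global[of ?M])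
    show "compactin ?M (A \<times> {\<alpha>..\<beta>})"
      using closedin_compact_space[OF S_compact[OF c] A(2)] by (auto simp: compactin_Times compactin_subtopology)
    show "P {}" unfolding P_def by (intro exI[of _ "{}"]) simp
    show "P (M \<union> N)" if "P M" "P N" for M N
    proof -
      obtain \<E> where 1: "finite \<E>" "\<E> \<subseteq> elementary_regions K" "\<forall>x\<in>M. snd x \<in> {\<alpha>..\<beta>} \<longrightarrow> g (fst x) (snd x) \<in> \<Union>\<E>"
        using \<open>P M\<close> unfolding P_def by blast
      obtain \<E>' where 2: "finite \<E>'" "\<E>' \<subseteq> elementary_regions K" "\<forall>x\<in>N. snd x \<in> {\<alpha>..\<beta>} \<longrightarrow> g (fst x) (snd x) \<in> \<Union>\<E>'"
        using \<open>P N\<close> unfolding P_def by blast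
      have "\<forall>x\<in>M \<union> N. snd x \<in> {\<alpha>..\<beta>} \<longrightarrow> g (fst x) (snd x) \<in> \<Union>(\<E> \<union> \<E>')"
        using 1(3) 2(3) by (simp add: ball_Un)
      then show ?thesis unfolding P_def using 1(1,2) 2(1,2) by (intro exI[of _ "\<E> \<union> \<E>'"]) simp
    qed
    show "P M" if "P N" "M \<subseteq> N" for M N using that unfolding P_def by (meson subsetD)
    fix x assume "x \<in> A \<times> {\<alpha>..\<beta>}"
    then obtain s0 t0 where x: "x = (s0, t0)" "s0 \<in> A" "t0 \<in> {\<alpha>..\<beta>}" by auto
    obtain U \<delta> \<E> where U: "openin (S c b) U" "s0 \<in> U" "\<delta> > 0" "finite \<E>" "\<E> \<subseteq> elementary_regions K"
      "\<forall>s\<in>U. \<forall>t\<in>{\<alpha>..\<beta>}. \<bar>t - t0\<bar> < \<delta> \<longrightarrow> g s t \<in> \<Union>\<E>"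
      by (rule local_cover[OF x(2,3)])
    have "openin ?M (U \<times> ({\<alpha>..\<beta>} \<inter> ball t0 \<delta>))"
      using U(1) openin_open_Int[OF open_ball, of "{\<alpha>..\<beta>}" t0 \<delta>] unfolding openin_prod_Times_iff by blast
    moreover have "x \<in> U \<times> ({\<alpha>..\<beta>} \<inter> ball t0 \<delta>)" using x U(2,3) by auto
    moreover have "P (U \<times> ({\<alpha>..\<beta>} \<inter> ball t0 \<delta>))"
      unfolding P_def
    proof (intro exI[of _ \<E>] conjI U(4,5) ballI impI)
      fix x assume "x \<in> U \<times> ({\<alpha>..\<beta>} \<inter> ball t0 \<delta>)"
      then have "fst x \<in> U" "snd x \<in> {\<alpha>..\<beta>}" "\<bar>snd x - t0\<bar> < \<delta>" by (auto simp: dist_real_def)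
      then show "g (fst x) (snd x) \<in> \<Union>\<E>" using U(6) by blast
    qed
    ultimately show "\<exists>N. openin ?M N \<and> x \<in> N \<and> P N" by blast
  qed
  then obtain \<E> where \<E>: "finite \<E>" "\<E> \<subseteq> elementary_regions K"
    "\<forall>x\<in>A \<times> {\<alpha>..\<beta>}. snd x \<in> {\<alpha>..\<beta>} \<longrightarrow> g (fst x) (snd x) \<in> \<Union>\<E>" unfolding P_def by blast
  have "box c b A {\<alpha>..\<beta>} \<subseteq> \<Union>\<E>"
  proof
    fix y assume "y \<in> box c b A {\<alpha>..\<beta>}"
    then obtain s t where "s \<in> A" "t \<in> {\<alpha>..\<beta>}" "y = g s t" by (rule box_memE)
    then show "y \<in> \<Union>\<E>" using bspec[OF \<E>(3), of "(s, t)"] by simp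
  qed
  then show thesis by (rule that[OF \<E>(1,2)])
qed

end

context oriented_charts
begin

lemma elementary_cover:
  obtains K \<E> where "transversal K" "finite \<E>" "\<E> \<subseteq> elementary_regions K" "topspace Y \<subseteq> \<Union>\<E>"
proof -
  obtain K \<R> where R: "transversal K" "finite \<R>" "\<forall>R\<in>\<R>. capped K R" "topspace Y \<subseteq> \<Union>\<R>"
    by (rule capped_cover)
  have "\<exists>\<E>. finite \<E> \<and> \<E> \<subseteq> elementary_regions K \<and> R \<subseteq> \<Union>\<E>" if "R \<in> \<R>" for R
  proof -
    obtain c b A \<alpha> \<beta> where cap: "c \<in> \<Omega>" "openin (S c b) A" "closedin (S c b) A" "\<alpha> < \<beta>" "{\<alpha>..\<beta>} \<subseteq> side b"
     "\<forall>s\<in>A. G c b s \<alpha> \<in> K \<and> G c b s \<beta> \<in> K" "R = box c b A {\<alpha>..\<beta>}"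
      using bspec[OF R(3) \<open>R \<in> \<R>\<close>] unfolding capped_def by auto
    interpret capped_box Y \<Omega> V p S G K c b A \<alpha> \<beta>
      by unfold_locales (use R(1) cap in auto)
    obtain \<E> where "finite \<E>" "\<E> \<subseteq> elementary_regions K" "box c b A {\<alpha>..\<beta>} \<subseteq> \<Union>\<E>" by (rule box_cover)
    then show ?thesis unfolding cap(7) by blast
  qed
  then have "\<forall>R\<in>\<R>. \<exists>\<E>. finite \<E> \<and> \<E> \<subseteq> elementary_regions K \<and> R \<subseteq> \<Union>\<E>" by simp
  from bchoice[OF this] obtain \<E> where
    \<E>: "\<forall>R\<in>\<R>. finite (\<E> R) \<and> \<E> R \<subseteq> elementary_regions K \<and> R \<subseteq> \<Union>(\<E> R)" by (rule exE)
  have "finite (\<Union>R\<in>\<R>. \<E> R)" using R(2) \<E> by blast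
  moreover have "(\<Union>R\<in>\<R>. \<E> R) \<subseteq> elementary_regions K" using \<E> by blast
  moreover have "topspace Y \<subseteq> \<Union>(\<Union>R\<in>\<R>. \<E> R)"
  proof
    fix y assume "y \<in> topspace Y"
    then obtain R' where R': "R' \<in> \<R>" "y \<in> R'" using R(4) by blast
    then have "R' \<subseteq> \<Union>(\<E> R')" using bspec[OF \<E> R'(1)] by simp
    then obtain E where "E \<in> \<E> R'" "y \<in> E" using R'(2) by blast
    then show "y \<in> \<Union>(\<Union>R\<in>\<R>. \<E> R)" using R'(1) by blast
  qed
  ultimately show thesis by (rule that[OF R(1)])
qed

end

section \<open>The bundle of all arcs\<close>

context oriented_charts
begin

text \<open>Near each of its points \<open>K\<close> agrees with a level, which is zero-dimensional.
  A clopen part of the level inside the neighbourhood of agreement is also clopen in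
  \<open>K\<close>.\<close>

lemma transversal_dim:
  assumes K: "transversal K" shows "subtopology Y K dim_le 0"
proof (rule dim_le_0I)
  fix W y assume W: "openin (subtopology Y K) W" and y: "y \<in> W"
  obtain W0 where W0: "openin Y W0" "W = W0 \<inter> K" using W by (auto simp: openin_subtopology)
  have clK: "closedin Y K" using K by (simp add: transversal_def)
  have yK: "y \<in> K" using y W0 by blast
  then obtain c where c: "c \<in> \<Omega>" "crosses K c y" using K unfolding transversal_def by blast
  obtain O' where O': "openin Y O'" "y \<in> O'" "O' \<subseteq> V c" "O' \<inter> K = {x \<in> O'. p c x = p c y}"
    using c(2) unfolding crosses_def by blast
  let ?l = "p c y"
  have yY: "y \<in> topspace Y" using O'(1,2) openin_subset by blast
  have 1: "closedin Y {y}" using yY Hausdorff_Y by (simp add: closedin_Hausdorff_singleton)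
  have 2: "{y} \<subseteq> level c ?l" using O'(2,3) by (auto simp: level_def)
  have 3: "closedin Y (topspace Y - (O' \<inter> W0))" using O'(1) W0(1) by blast
  have 4: "{y} \<inter> (topspace Y - (O' \<inter> W0)) = {}" using O'(2) y W0(2) by blast
  obtain L where L: "L \<subseteq> level c ?l" "closedin Y L" "closedin Y (level c ?l - L)" "{y} \<subseteq> L"
    "L \<inter> (topspace Y - (O' \<inter> W0)) = {}"
    by (rule level_clopen_separation[OF c(1) 1 2 3 4])
  have sub: "L \<subseteq> O' \<inter> W0" using L(5) closedin_subset[OF L(2)] by blast
  have LK: "L \<subseteq> K"
  proof
    fix x assume x: "x \<in> L"
    then have "x \<in> {x \<in> O'. p c x = ?l}" using sub L(1) by (auto simp: level_def)
    then show "x \<in> K" using O'(4) by blast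
  qed
  have "L = K \<inter> (O' - (level c ?l - L))"
  proof
    show "L \<subseteq> K \<inter> (O' - (level c ?l - L))" using LK sub by blast
    show "K \<inter> (O' - (level c ?l - L)) \<subseteq> L"
    proof
      fix x assume x: "x \<in> K \<inter> (O' - (level c ?l - L))"
      then have "x \<in> {x \<in> O'. p c x = ?l}" using O'(4) by blast
      then have "x \<in> level c ?l" using O'(3) by (auto simp: level_def)
      then show "x \<in> L" using x by blast
    qed
  qed
  moreover have "openin Y (O' - (level c ?l - L))" using O'(1) L(3) by (rule openin_diff)
  ultimately have "openin (subtopology Y K) L" by (metis openin_subtopology_Int2)
  moreover have "closedin (subtopology Y K) L" using L(2) LK by (simp add: closedin_subset_topspace)
  moreover have "y \<in> L" "L \<subseteq> W" using L(4) sub LK W0(2) by blast+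
  ultimately show "\<exists>U. openin (subtopology Y K) U \<and> closedin (subtopology Y K) U \<and> y \<in> U \<and> U \<subseteq> W"
    by blast
qed

text \<open>In a chart in which \<open>K\<close> is locally the level of \<open>y\<close>, a strand
  through \<open>y\<close> leaves \<open>K\<close> at once, because along a strand of that chart the
  height is the parameter.\<close>

lemma leave_transversal_up:
  assumes K: "transversal K" and y: "y \<in> K"
  obtains c b s t0 t1 where "c \<in> \<Omega>" "s \<in> topspace (S c b)" "t0 < t1" "{t0..t1} \<subseteq> side b" "y = G c b s t0"
    "\<forall>t\<in>{t0<..t1}. G c b s t \<notin> K"
proof -
  obtain d where d: "d \<in> \<Omega>" "crosses K d y" using K y unfolding transversal_def by blast
  obtain O' where O': "openin Y O'" "y \<in> O'" "O' \<subseteq> V d" "O' \<inter> K = {x \<in> O'. p d x = p d y}"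
    using d(2) unfolding crosses_def by blast
  have yV: "y \<in> V d" using O' by blast
  define t0 where "t0 = p d y"
  have t0: "-1 < t0" "t0 < 1" using p_range[OF d(1) yV] by (auto simp: t0_def)
  \<comment> \<open>At height 0 the upper side has to be taken, as the lower one has no room
    upwards.\<close>
  define b where "b = (0 \<le> t0)"
  have tb: "t0 \<in> side b" using t0 by (auto simp: b_def side_def)
  obtain s where s: "s \<in> topspace (S d b)" "y = G d b s t0"
    using G_onto[OF d(1) yV] tb unfolding t0_def by blast
  have "G d b s t0 \<in> O'" using s O'(2) by simp
  from near_in_open[OF d(1) s(1) tb O'(1) this]
  obtain \<delta> where \<delta>: "\<delta> > 0" "\<forall>t\<in>side b. \<bar>t - t0\<bar> \<le> \<delta> \<longrightarrow> G d b s t \<in> O'" by blast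
  \<comment> \<open>The second bound keeps \<open>t1\<close> on the chosen side: halfway to height
    1, or at most up to height 0.\<close>
  define t1 where "t1 = t0 + min \<delta> (if b then (1 - t0) / 2 else - t0)"
  have t1: "t0 < t1" "t1 \<le> t0 + \<delta>" using \<delta>(1) t0 by (auto simp: t1_def b_def)
  have "t1 \<in> side b"
  proof (cases b)
    case True
    have "t1 \<le> t0 + (1 - t0) / 2"
      unfolding t1_def using True by (simp only: if_True)
    then have "t1 < 1" using t0 by (simp add: field_simps)
    then show ?thesis using True t1(1) by (simp add: side_def b_def)
  next
    case False
    have "t1 \<le> 0" using False by (simp add: t1_def)
    then show ?thesis using False t1(1) t0 by (simp add: side_def)
  qed
  then have sub: "{t0..t1} \<subseteq> side b" using tb side_convex by blast
  have inO: "G d b s t \<in> O'" if "t \<in> {t0..t1}" for t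
  proof -
    have "t \<in> side b" using that sub by blast
    moreover have "\<bar>t - t0\<bar> \<le> \<delta>" using that t1(2) by auto
    ultimately show ?thesis using \<delta>(2) by blast
  qed
  have "G d b s t \<notin> K" if t: "t \<in> {t0<..t1}" for t
  proof
    assume "G d b s t \<in> K"
    moreover have "G d b s t \<in> O'" using inO t by auto
    ultimately have "p d (G d b s t) = p d y" using O'(4) by blast
    moreover have "t \<in> side b" using subsetD[OF sub, of t] t by auto
    then have "p d (G d b s t) = t" by (rule p_G[OF d(1) s(1)])
    ultimately show False using t by (simp add: t0_def)
  qed
  then show thesis using that[OF d(1) s(1) t1(1) sub s(2)] by blast
qed

lemma leave_transversal_down:
  assumes K: "transversal K" and y: "y \<in> K"
  obtains c b s t0 t1 where "c \<in> \<Omega>" "s \<in> topspace (S c b)" "t1 < t0" "{t1..t0} \<subseteq> side b" "y = G c b s t0"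
    "\<forall>t\<in>{t1..<t0}. G c b s t \<notin> K"
proof -
  obtain d where d: "d \<in> \<Omega>" "crosses K d y" using K y unfolding transversal_def by blast
  obtain O' where O': "openin Y O'" "y \<in> O'" "O' \<subseteq> V d" "O' \<inter> K = {x \<in> O'. p d x = p d y}"
    using d(2) unfolding crosses_def by blast
  have yV: "y \<in> V d" using O' by blast
  define t0 where "t0 = p d y"
  have t0: "-1 < t0" "t0 < 1" using p_range[OF d(1) yV] by (auto simp: t0_def)
  \<comment> \<open>The inequality is strict here: downwards from height 0 only the lower side has
    room.\<close>
  define b where "b = (0 < t0)"
  have tb: "t0 \<in> side b" using t0 by (auto simp: b_def side_def)
  obtain s where s: "s \<in> topspace (S d b)" "y = G d b s t0"
    using G_onto[OF d(1) yV] tb unfolding t0_def by blast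
  have "G d b s t0 \<in> O'" using s O'(2) by simp
  from near_in_open[OF d(1) s(1) tb O'(1) this]
  obtain \<delta> where \<delta>: "\<delta> > 0" "\<forall>t\<in>side b. \<bar>t - t0\<bar> \<le> \<delta> \<longrightarrow> G d b s t \<in> O'" by blast
  define t1 where "t1 = t0 - min \<delta> (if b then t0 else (t0 + 1) / 2)"
  have t1: "t1 < t0" "t0 - \<delta> \<le> t1" using \<delta>(1) t0 by (auto simp: t1_def b_def)
  have "t1 \<in> side b"
  proof (cases b)
    case True
    have "0 \<le> t1" using True by (simp add: t1_def)
    then show ?thesis using True t1(1) t0 by (simp add: side_def)
  next
    case False
    have "t0 - (t0 + 1) / 2 \<le> t1"
      unfolding t1_def using False by (simp only: if_False)
    then have "-1 < t1" using t0 by (simp add: field_simps)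
    then show ?thesis using False t1(1) by (simp add: side_def b_def)
  qed
  then have sub: "{t1..t0} \<subseteq> side b" using tb side_convex by blast
  have inO: "G d b s t \<in> O'" if "t \<in> {t1..t0}" for t
  proof -
    have "t \<in> side b" using that sub by blast
    moreover have "\<bar>t - t0\<bar> \<le> \<delta>" using that t1(2) by auto
    ultimately show ?thesis using \<delta>(2) by blast
  qed
  have "G d b s t \<notin> K" if t: "t \<in> {t1..<t0}" for t
  proof
    assume "G d b s t \<in> K"
    moreover have "G d b s t \<in> O'" using inO t by auto
    ultimately have "p d (G d b s t) = p d y" using O'(4) by blast
    moreover have "t \<in> side b" using subsetD[OF sub, of t] t by auto
    then have "p d (G d b s t) = t" by (rule p_G[OF d(1) s(1)])
    ultimately show False using t by (simp add: t0_def)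
  qed
  then show thesis using that[OF d(1) s(1) t1(1) sub s(2)] by blast
qed

end

section \<open>Disjoint pieces and the direction of their arcs\<close>

locale elementary_family = oriented_charts Y \<Omega> V p S G
  for Y :: "'a topology" and \<Omega> :: "'c set" and V :: "'c \<Rightarrow> 'a set" and p :: "'c \<Rightarrow> 'a \<Rightarrow> real"
    and S :: "'c \<Rightarrow> bool \<Rightarrow> 's topology" and G :: "'c \<Rightarrow> bool \<Rightarrow> 's \<Rightarrow> real \<Rightarrow> 'a" +
  fixes K :: "'a set" and n :: nat and Z :: "nat \<Rightarrow> 's topology" and Q :: "nat \<Rightarrow> 's \<Rightarrow> real \<Rightarrow> 'a"
  assumes K: "transversal K" and elem: "i < n \<Longrightarrow> elementary K (Z i) (Q i)"
    and cover: "topspace Y \<subseteq> (\<Union>i<n. region (Z i) (Q i))"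
begin

lemma closed_K: "closedin Y K"
  using K by (simp add: transversal_def)

lemma Z_props:
  assumes "i < n"
  shows "compact_space (Z i)" "Hausdorff_space (Z i)" "second_countable (Z i)" "Z i dim_le 0"
  using elem[OF assms] by (simp_all only: elementary_def)

lemma Q_cont: "i < n \<Longrightarrow> continuous_map (prod_topology (Z i) (top_of_set {0..1})) Y (\<lambda>(z, t). Q i z t)"
  using elem by (simp only: elementary_def)

lemma Q_values:
  assumes "i < n"
  shows "\<forall>z\<in>topspace (Z i). Q i z 0 \<in> K \<and> Q i z 1 \<in> K \<and> (\<forall>t. 0 < t \<and> t < 1 \<longrightarrow> Q i z t \<notin> K)"
  using elem[OF assms] unfolding elementary_def by (elim conjE)

lemma Q_ends: "i < n \<Longrightarrow> z \<in> topspace (Z i) \<Longrightarrow> Q i z 0 \<in> K" "i < n \<Longrightarrow> z \<in> topspace (Z i) \<Longrightarrow> Q i z 1 \<in> K"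
  using Q_values by blast+

lemma Q_open: "i < n \<Longrightarrow> z \<in> topspace (Z i) \<Longrightarrow> 0 < t \<Longrightarrow> t < 1 \<Longrightarrow> Q i z t \<notin> K"
  using Q_values by blast

lemma Q_inj:
  assumes "i < n" "z \<in> topspace (Z i)" "z' \<in> topspace (Z i)" "t \<in> {0<..<1}" "t' \<in> {0<..<1}" "Q i z t = Q i z' t'"
  shows "z = z' \<and> t = t'"
proof -
  have "\<forall>z\<in>topspace (Z i). \<forall>z'\<in>topspace (Z i). \<forall>t\<in>{0<..<1}. \<forall>t'\<in>{0<..<1}. Q i z t = Q i z' t' \<longrightarrow> z = z' \<and> t = t'"
    using elem[OF assms(1)] unfolding elementary_def by (elim conjE)
  then show ?thesis using assms(2-) by blast
qed

lemma Q_in_K: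
  assumes "i < n" "z \<in> topspace (Z i)" "t \<in> {0..1}" "Q i z t \<in> K"
  shows "t = 0 \<or> t = 1"
  using Q_open[OF assms(1,2), of t] assms(3,4) by fastforce

lemma Q_in_Y: "i < n \<Longrightarrow> z \<in> topspace (Z i) \<Longrightarrow> t \<in> {0..1} \<Longrightarrow> Q i z t \<in> topspace Y"
  using funcset_mem[OF continuous_map_funspace[OF Q_cont], of i "(z, t)"] by simp

definition piece :: "nat \<Rightarrow> 's set \<Rightarrow> 'a set" where
  "piece i W = {y. \<exists>z\<in>W. \<exists>t\<in>{0<..<1}. y = Q i z t}"

lemma piece_memI: "z \<in> W \<Longrightarrow> t \<in> {0<..<1} \<Longrightarrow> Q i z t \<in> piece i W"
  unfolding piece_def by blast

lemma openin_piece: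
  assumes "i < n" "openin (Z i) W" shows "openin Y (piece i W)"
proof -
  have "\<forall>W. openin (Z i) W \<longrightarrow> openin Y {y. \<exists>z\<in>W. \<exists>t\<in>{0<..<1}. y = Q i z t}"
    using elem[OF assms(1)] unfolding elementary_def by (elim conjE)
  then show ?thesis using assms(2) unfolding piece_def by simp
qed

text \<open>The closed arcs over \<open>W\<close> have a compact union, and they exceed the piece
  only by points of \<open>K\<close>. With \<open>openin_piece\<close> this makes a piece over a
  clopen \<open>W\<close> clopen in the complement of \<open>K\<close>.\<close>

lemma closedin_piece_K:
  assumes i: "i < n" and W: "closedin (Z i) W"
  shows "closedin Y (piece i W \<union> K)"
proof -
  have WZ: "W \<subseteq> topspace (Z i)" using W closedin_subset by blast
  have "compactin (prod_topology (Z i) (top_of_set {0..1})) (W \<times> {0..1::real})"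
    using closedin_compact_space[OF Z_props(1)[OF i] W] compact_Icc[of 0 "1::real"]
    by (simp add: compactin_Times compactin_subtopology)
  then have "compactin Y ((\<lambda>(z, t). Q i z t) ` (W \<times> {0..1}))" by (rule image_compactin[OF _ Q_cont[OF i]])
  then have "closedin Y ((\<lambda>(z, t). Q i z t) ` (W \<times> {0..1}))" by (rule compactin_imp_closedin[OF Hausdorff_Y])
  then have "closedin Y ((\<lambda>(z, t). Q i z t) ` (W \<times> {0..1}) \<union> K)" using closed_K by (rule closedin_Un)
  moreover have "(\<lambda>(z, t). Q i z t) ` (W \<times> {0..1}) \<union> K = piece i W \<union> K"
  proof (intro equalityI subsetI)
    fix y assume "y \<in> (\<lambda>(z, t). Q i z t) ` (W \<times> {0..1}) \<union> K"
    then consider "y \<in> K" | z t where "z \<in> W" "t \<in> {0..1}" "y = Q i z t" by auto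
    then show "y \<in> piece i W \<union> K"
    proof cases
      case (2 z t)
      show ?thesis
      proof (cases "t \<in> {0<..<1}")
        case True then show ?thesis using 2 piece_memI by blast
      next
        case False
        then have "t = 0 \<or> t = 1" using 2(2) by auto
        then show ?thesis using Q_ends[OF i, of z] 2 WZ by auto
      qed
    qed blast
  next
    fix y assume "y \<in> piece i W \<union> K"
    then consider "y \<in> K" | z t where "z \<in> W" "t \<in> {0<..<1}" "y = Q i z t" unfolding piece_def by blast
    then show "y \<in> (\<lambda>(z, t). Q i z t) ` (W \<times> {0..1}) \<union> K"
    proof cases
      case (2 z t)
      then have "(z, t) \<in> W \<times> {0..1}" by auto
      then show ?thesis using 2(3) by (metis UnI1 case_prod_conv image_eqI)
    qed blast
  qed
  ultimately show ?thesis by simp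
qed

text \<open>Off \<open>K\<close> a piece over a clopen set of arcs is clopen, so a connected set
  that misses \<open>K\<close> cannot leave it.\<close>

lemma connected_in_piece:
  assumes i: "i < n" and W: "openin (Z i) W" "closedin (Z i) W"
    and T: "connectedin Y T" "T \<inter> K = {}" "x \<in> T" "x \<in> piece i W"
  shows "T \<subseteq> piece i W"
proof (rule connectedin_subset_left[OF T(1) openin_piece[OF i W(1)]])
  show "openin Y (topspace Y - (piece i W \<union> K))" using closedin_piece_K[OF i W(2)] by blast
  show "T \<subseteq> piece i W \<union> (topspace Y - (piece i W \<union> K))" using T(2) connectedin_subset_topspace[OF T(1)] by blast
qed (use T in blast)+

lemma continuous_map_Q_fixed_z:
  assumes "i < n" "z \<in> topspace (Z i)" shows "continuous_map (top_of_set {0..1}) Y (Q i z)"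
proof -
  have "continuous_map (top_of_set {0..1}) (prod_topology (Z i) (top_of_set {0..1})) (\<lambda>t. (z, t))"
    using assms(2) by (intro continuous_map_pairedI) auto
  from continuous_map_compose[OF this Q_cont[OF assms(1)]] show ?thesis by (simp add: comp_def)
qed

lemma continuous_map_Q_fixed_t:
  assumes "i < n" "t \<in> {0..1}" shows "continuous_map (Z i) Y (\<lambda>z. Q i z t)"
proof -
  have "continuous_map (Z i) (prod_topology (Z i) (top_of_set {0..1})) (\<lambda>z. (z, t))"
    using assms(2) by (intro continuous_map_pairedI) (auto simp: continuous_map_in_subtopology)
  from continuous_map_compose[OF this Q_cont[OF assms(1)]] show ?thesis by (simp add: comp_def)
qed

text \<open>An open arc is connected and misses \<open>K\<close>. Hence one interior point, such as
  the midpoint, decides for the whole arc whether it lies in a piece.\<close>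

lemma arc_in_piece:
  assumes i: "i < n" "z \<in> topspace (Z i)" "t \<in> {0<..<1}" and j: "j < n" and t': "t' \<in> {0<..<1}"
    and mem: "Q i z t \<in> piece j (topspace (Z j))"
  shows "Q i z t' \<in> piece j (topspace (Z j))"
proof -
  have "continuous_map (top_of_set {0<..<1}) Y (Q i z)"
    using continuous_map_Q_fixed_z[OF i(1,2)] by (rule continuous_map_from_subtopology_mono) auto
  moreover have "connectedin (top_of_set {0<..<1::real}) {0<..<1}" by (simp add: connectedin_subtopology)
  ultimately have "connectedin Y (Q i z ` {0<..<1})" by (rule connectedin_continuous_map_image)
  moreover have "Q i z ` {0<..<1} \<inter> K = {}" using Q_open[OF i(1,2)] by auto
  moreover have "Q i z t \<in> Q i z ` {0<..<1}" using i(3) by (rule imageI)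
  ultimately have "Q i z ` {0<..<1} \<subseteq> piece j (topspace (Z j))"
    using connected_in_piece[OF j openin_topspace closedin_topspace _ _ _ mem] by blast
  moreover have "Q i z t' \<in> Q i z ` {0<..<1}" using t' by (rule imageI)
  ultimately show ?thesis by blast
qed

text \<open>Two pieces either share a whole arc or have no common point on it, so discarding the arcs whose
  midpoints lie in an earlier piece makes the pieces disjoint.\<close>

definition A :: "nat \<Rightarrow> 's set" where
  "A i = {z \<in> topspace (Z i). \<forall>j<i. Q i z (1/2) \<notin> piece j (topspace (Z j))}"

text \<open>Midpoints are off \<open>K\<close>, where the earlier pieces are clopen, and the
  midpoint depends continuously on the arc.\<close>

lemma A_clopen:
  assumes i: "i < n" shows "openin (Z i) (A i)" "closedin (Z i) (A i)"
proof -
  have half: "(1/2::real) \<in> {0..1}" by simp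
  let ?f = "\<lambda>z. Q i z (1/2)"
  have o: "openin (Z i) {z \<in> topspace (Z i). ?f z \<in> piece j (topspace (Z j))}"
    and c: "openin (Z i) {z \<in> topspace (Z i). ?f z \<notin> piece j (topspace (Z j))}" if "j < i" for j
  proof -
    have j: "j < n" using that i by simp
    show "openin (Z i) {z \<in> topspace (Z i). ?f z \<in> piece j (topspace (Z j))}"
      by (rule openin_continuous_map_preimage[OF continuous_map_Q_fixed_t[OF i half] openin_piece[OF j openin_topspace]])
    have "openin Y (topspace Y - (piece j (topspace (Z j)) \<union> K))"
      using closedin_piece_K[OF j closedin_topspace] by blast
    then have "openin (Z i) {z \<in> topspace (Z i). ?f z \<in> topspace Y - (piece j (topspace (Z j)) \<union> K)}"
      by (rule openin_continuous_map_preimage[OF continuous_map_Q_fixed_t[OF i half]])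
    moreover have "{z \<in> topspace (Z i). ?f z \<in> topspace Y - (piece j (topspace (Z j)) \<union> K)} =
        {z \<in> topspace (Z i). ?f z \<notin> piece j (topspace (Z j))}"
      using Q_open[OF i, of _ "1/2"] Q_in_Y[OF i _ half] by auto
    ultimately show "openin (Z i) {z \<in> topspace (Z i). ?f z \<notin> piece j (topspace (Z j))}" by simp
  qed
  show "openin (Z i) (A i)" unfolding A_def by (rule openin_Collect_all_less) (rule c)
  have "topspace (Z i) - A i = (\<Union>j<i. {z \<in> topspace (Z i). ?f z \<in> piece j (topspace (Z j))})"
    unfolding A_def by auto
  moreover have "openin (Z i) (\<Union>j<i. {z \<in> topspace (Z i). ?f z \<in> piece j (topspace (Z j))})"
    using o by (intro openin_Union) auto
  ultimately show "closedin (Z i) (A i)" unfolding closedin_def A_def by auto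
qed

lemma A_subset: "A i \<subseteq> topspace (Z i)"
  by (auto simp: A_def)

text \<open>A common point would put the midpoint of the arc with the larger index into the earlier
  piece, by \<open>arc_in_piece\<close>.\<close>

lemma pieces_disjoint:
  assumes "i < n" "j < n" "z \<in> A i" "z' \<in> A j" "t \<in> {0<..<1}" "t' \<in> {0<..<1}" "Q i z t = Q j z' t'"
  shows "i = j"
proof -
  have *: False if a: "i < j" "j < n" "z \<in> A i" "z' \<in> A j" "t \<in> {0<..<1}" "t' \<in> {0<..<1}" "Q i z t = Q j z' t'"
    for i j z z' t t'
  proof -
    have "Q j z' t' \<in> piece i (topspace (Z i))"
      unfolding a(7)[symmetric] using A_subset a(3,5) by (intro piece_memI) blast+
    then have "Q j z' (1/2) \<in> piece i (topspace (Z i))"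
      using a(1,2,4,6) A_subset by (intro arc_in_piece[of j z' t' i "1/2"]) auto
    then show False using a(1,4) unfolding A_def by blast
  qed
  show ?thesis
    using *[of i j z z' t t'] *[of j i z' z t' t] assms by (cases i j rule: linorder_cases) auto
qed

text \<open>Take the least index whose piece contains \<open>y\<close>. The arc through
  \<open>y\<close> is kept in \<open>A i\<close>, since a midpoint in an earlier piece would bring
  \<open>y\<close> into that piece as well.\<close>

lemma covered:
  assumes "y \<in> topspace Y" "y \<notin> K"
  obtains i z t where "i < n" "z \<in> A i" "t \<in> {0<..<1}" "y = Q i z t"
proof -
  have "\<exists>i. i < n \<and> y \<in> piece i (topspace (Z i))"
  proof -
    obtain i where i: "i < n" "y \<in> region (Z i) (Q i)" using cover assms(1) by blast
    then obtain z t where z: "z \<in> topspace (Z i)" "t \<in> {0..1}" "y = Q i z t" unfolding region_def by blast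
    have "t \<noteq> 0" "t \<noteq> 1" using Q_ends[OF i(1) z(1)] z(3) assms(2) by auto
    then have "t \<in> {0<..<1}" using z(2) by auto
    then show ?thesis using i(1) z piece_memI by blast
  qed
  then obtain i where i: "i < n" "y \<in> piece i (topspace (Z i))"
    and least: "\<forall>j<i. \<not> (j < n \<and> y \<in> piece j (topspace (Z j)))"
    using exists_least_iff[of "\<lambda>i. i < n \<and> y \<in> piece i (topspace (Z i))"] by auto
  obtain z t where z: "z \<in> topspace (Z i)" "t \<in> {0<..<1}" "y = Q i z t" using i(2) unfolding piece_def by blast
  have "Q i z (1/2) \<notin> piece j (topspace (Z j))" if j: "j < i" for j
  proof
    assume "Q i z (1/2) \<in> piece j (topspace (Z j))"
    then have "Q i z t \<in> piece j (topspace (Z j))"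
      using i(1) z(1,2) j by (intro arc_in_piece[of i z "1/2" j t]) auto
    then show False using least j i(1) z(3) by auto
  qed
  then have "z \<in> A i" using z(1) by (simp add: A_def)
  then show thesis using that i(1) z(2,3) by blast
qed

text \<open>The stretch of strand is connected and misses \<open>K\<close>, so it stays in one
  piece, and there over every clopen set of arcs containing \<open>z\<close>. As \<open>Z i\<close>
  is zero-dimensional and Hausdorff, only the arc \<open>z\<close> remains.\<close>

lemma chart_arc_in_piece:
  assumes c: "c \<in> \<Omega>" "s \<in> topspace (S c b)" and J: "is_interval J" "J \<subseteq> side b" "J \<noteq> {}" "\<forall>t\<in>J. G c b s t \<notin> K"
  obtains i z where "i < n" "z \<in> A i" "\<forall>t\<in>J. \<exists>u\<in>{0<..<1}. G c b s t = Q i z u"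
proof -
  obtain t1 where t1: "t1 \<in> J" using J(3) by blast
  have inY: "G c b s t \<in> topspace Y" if "t \<in> J" for t using G_in_V[OF c, of t] J(2) V_subset[OF c(1)] that by blast
  obtain i z u where i: "i < n" "z \<in> A i" "u \<in> {0<..<1}" "G c b s t1 = Q i z u"
    using covered[OF inY[OF t1]] J(4) t1 by blast
  have zZ: "z \<in> topspace (Z i)" using i(2) A_subset by blast
  define T where "T = G c b s ` J"
  have "continuous_map (top_of_set J) Y (G c b s)"
    using continuous_map_G_fixed_s[OF c] J(2) by (rule continuous_map_from_subtopology_mono)
  moreover have "connectedin (top_of_set J) J" using J(1) by (simp add: connectedin_subtopology is_interval_connected)
  ultimately have T: "connectedin Y T" unfolding T_def by (rule connectedin_continuous_map_image)
  have TK: "T \<inter> K = {}" using J(4) by (auto simp: T_def)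
  have T1: "G c b s t1 \<in> T" unfolding T_def using t1 by (rule imageI)
  have "G c b s t1 \<in> piece i (topspace (Z i))" unfolding i(4) using zZ i(3) by (rule piece_memI)
  then have sub: "T \<subseteq> piece i (topspace (Z i))"
    by (rule connected_in_piece[OF i(1) openin_topspace closedin_topspace T TK T1])
  have "\<exists>u\<in>{0<..<1}. G c b s t = Q i z u" if t: "t \<in> J" for t
  proof -
    have tT: "G c b s t \<in> T" unfolding T_def using t by (rule imageI)
    then have "G c b s t \<in> piece i (topspace (Z i))" using sub by blast
    then obtain z' u' where z': "z' \<in> topspace (Z i)" "u' \<in> {0<..<1}" "G c b s t = Q i z' u'"
      unfolding piece_def by blast
    have "z' = z"
    proof (rule ccontr)
      assume "z' \<noteq> z"
      then obtain W0 where W0: "openin (Z i) W0" "z \<in> W0" "z' \<notin> W0"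
        using Hausdorff_imp_t1_space[OF Z_props(2)[OF i(1)]] zZ z'(1) unfolding t1_space_def by metis
      obtain W where W: "openin (Z i) W" "closedin (Z i) W" "z \<in> W" "W \<subseteq> W0"
        by (rule clopen_neighbourhood[OF Z_props(4)[OF i(1)] W0(1,2)])
      have "G c b s t1 \<in> piece i W" unfolding i(4) using W(3) i(3) by (rule piece_memI)
      then have "T \<subseteq> piece i W" by (rule connected_in_piece[OF i(1) W(1,2) T TK T1])
      then have "G c b s t \<in> piece i W" using tT by blast
      then obtain w u'' where w: "w \<in> W" "u'' \<in> {0<..<1}" "G c b s t = Q i w u''" unfolding piece_def by blast
      have "w \<in> topspace (Z i)" using w(1) W(1) openin_subset by blast
      then have "w = z'" using Q_inj[OF i(1) _ z'(1) w(2) z'(2)] w(3) z'(3) by simp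
      then show False using w(1) W(4) W0(3) by blast
    qed
    then show ?thesis using z' by blast
  qed
  then show thesis using that[OF i(1,2)] by blast
qed

text \<open>The chart \<open>d\<close> of the piece compares both directions: by
  \<open>orient\<close> its height increases along the strand, and by \<open>elementary\<close> it
  increases with the parameter of the arc. So strand and arc run the same way.\<close>

lemma parameter_increasing:
  assumes c: "c \<in> \<Omega>" "s \<in> topspace (S c b)" and t: "t < t'" "{t..t'} \<subseteq> side b"
    and i: "i < n" "z \<in> topspace (Z i)" and J: "\<forall>w\<in>{t..t'}. \<exists>u\<in>{0<..<1}. G c b s w = Q i z u"
    and u: "u \<in> {0<..<1}" "u' \<in> {0<..<1}" "G c b s t = Q i z u" "G c b s t' = Q i z u'"
  shows "u < u'"
proof (rule ccontr)
  assume "\<not> u < u'"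
  obtain d where d: "d \<in> \<Omega>" "\<forall>t\<in>{0..1}. Q i z t \<in> V d"
    "\<forall>t t'. 0 \<le> t \<and> t < t' \<and> t' \<le> 1 \<longrightarrow> p d (Q i z t) < p d (Q i z t')"
  proof -
    obtain d where d: "d \<in> \<Omega>" "\<forall>z\<in>topspace (Z i). (\<forall>t\<in>{0..1}. Q i z t \<in> V d) \<and>
        (\<forall>t t'. 0 \<le> t \<and> t < t' \<and> t' \<le> 1 \<longrightarrow> p d (Q i z t) < p d (Q i z t'))"
      using elem[OF i(1)] unfolding elementary_def by (elim conjE bexE)
    show thesis using bspec[OF d(2) i(2)] by (elim conjE) (rule that[OF d(1)])
  qed
  have "\<forall>w\<in>{t..t'}. G c b s w \<in> V d"
  proof
    fix w assume "w \<in> {t..t'}"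
    from bspec[OF J this] obtain v where v: "v \<in> {0<..<1}" "G c b s w = Q i z v" by (rule bexE)
    then have "v \<in> {0..1}" by auto
    then show "G c b s w \<in> V d" unfolding v(2) by (rule bspec[OF d(2)])
  qed
  then have "p d (G c b s t) < p d (G c b s t')" by (rule orient[OF c(1) d(1) c(2) t])
  then have less: "p d (Q i z u) < p d (Q i z u')" using u(3,4) by simp
  show False
  proof (cases "u' = u")
    case True
    then show False using less by simp
  next
    case False
    then have "0 \<le> u' \<and> u' < u \<and> u \<le> 1" using u(1,2) \<open>\<not> u < u'\<close> by auto
    then have "p d (Q i z u') < p d (Q i z u)" using d(3) by blast
    then show False using less by simp
  qed
qed

lemma closed_arc:
  assumes "i < n" "z \<in> topspace (Z i)" "{u..v} \<subseteq> {0..1}"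
  shows "closedin Y (Q i z ` {u..v})"
proof (rule compactin_imp_closedin[OF Hausdorff_Y], rule image_compactin[OF _ continuous_map_Q_fixed_z[OF assms(1,2)]])
  show "compactin (top_of_set {0..1}) {u..v}" using assms(3) by (simp add: compactin_subtopology)
qed

text \<open>A strand leaving \<open>y\<close> upwards runs in a single arc, with parameters that
  increase up to \<open>u1 < 1\<close>. As the height tends to \<open>t0\<close>, closedness of the
  part over \<open>{0..u1}\<close> puts \<open>y\<close> on it, and the only point of
  \<open>K\<close> there is the start of the arc.\<close>

lemma initial_point:
  assumes y: "y \<in> K"
  obtains i z where "i < n" "z \<in> A i" "Q i z 0 = y"
proof -
  obtain c b s t0 t1 where c: "c \<in> \<Omega>" "s \<in> topspace (S c b)" and t: "t0 < t1" "{t0..t1} \<subseteq> side b"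
    "y = G c b s t0" "\<forall>t\<in>{t0<..t1}. G c b s t \<notin> K"
    by (rule leave_transversal_up[OF K y])
  have J: "is_interval {t0<..t1}" "{t0<..t1} \<subseteq> side b" "{t0<..t1} \<noteq> {}" using t(1,2) by (auto simp: is_interval_oc)
  obtain i z where i: "i < n" "z \<in> A i" "\<forall>t\<in>{t0<..t1}. \<exists>u\<in>{0<..<1}. G c b s t = Q i z u"
    by (rule chart_arc_in_piece[OF c J t(4)])
  have zZ: "z \<in> topspace (Z i)" using i(2) A_subset by blast
  have "t1 \<in> {t0<..t1}" using t(1) by simp
  from bspec[OF i(3) this] obtain u1 where u1: "u1 \<in> {0<..<1}" "G c b s t1 = Q i z u1" by (rule bexE)
  have u1s: "{0..u1} \<subseteq> {0..1}" using u1(1) by auto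
  have inB: "G c b s t \<in> Q i z ` {0..u1}" if tt: "t \<in> {t0<..t1}" for t
  proof -
    obtain u where u: "u \<in> {0<..<1}" "G c b s t = Q i z u" using i(3) tt by blast
    have "u \<le> u1"
    proof (cases "t = t1")
      case True
      then show ?thesis using Q_inj[OF i(1) zZ zZ u(1) u1(1)] u(2) u1(2) by simp
    next
      case False
      have sub: "{t..t1} \<subseteq> {t0<..t1}" using tt by auto
      have "u < u1"
        by (rule parameter_increasing[OF c _ _ i(1) zZ _ u(1) u1(1) u(2) u1(2)])
          (use False tt sub J(2) i(3) in auto)
      then show ?thesis by simp
    qed
    then have "u \<in> {0..u1}" using u(1) by auto
    then show ?thesis unfolding u(2) by (rule imageI)
  qed
  have cl: "closed {t \<in> {t0..t1}. G c b s t \<in> Q i z ` {0..u1}}"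
    by (rule compact_imp_closed[OF closed_crossings[OF c closed_arc[OF i(1) zZ u1s] t(2)]])
  have "{t0<..<t1} \<subseteq> {t \<in> {t0..t1}. G c b s t \<in> Q i z ` {0..u1}}" using inB by auto
  then have "closure {t0<..<t1} \<subseteq> {t \<in> {t0..t1}. G c b s t \<in> Q i z ` {0..u1}}" using cl by (rule closure_minimal)
  moreover have "t0 \<in> closure {t0<..<t1}" using t(1) by simp
  ultimately have "G c b s t0 \<in> Q i z ` {0..u1}" by blast
  then obtain v where v: "v \<in> {0..u1}" "y = Q i z v" using t(3) by auto
  then have "v = 0 \<or> v = 1" using Q_in_K[OF i(1) zZ, of v] y u1(1) by auto
  then have "v = 0" using v(1) u1(1) by auto
  then show thesis using that[OF i(1,2)] v(2) by simp
qed

text \<open>Along a strand leaving \<open>y\<close> downwards the parameters stay at least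
  \<open>u1 > 0\<close>, so the limit point \<open>y\<close> can only be the end of the arc.\<close>

lemma terminal_point:
  assumes y: "y \<in> K"
  obtains i z where "i < n" "z \<in> A i" "Q i z 1 = y"
proof -
  obtain c b s t0 t1 where c: "c \<in> \<Omega>" "s \<in> topspace (S c b)" and t: "t1 < t0" "{t1..t0} \<subseteq> side b"
    "y = G c b s t0" "\<forall>t\<in>{t1..<t0}. G c b s t \<notin> K"
    by (rule leave_transversal_down[OF K y])
  have J: "is_interval {t1..<t0}" "{t1..<t0} \<subseteq> side b" "{t1..<t0} \<noteq> {}" using t(1,2) by (auto simp: is_interval_co)
  obtain i z where i: "i < n" "z \<in> A i" "\<forall>t\<in>{t1..<t0}. \<exists>u\<in>{0<..<1}. G c b s t = Q i z u"
    by (rule chart_arc_in_piece[OF c J t(4)])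
  have zZ: "z \<in> topspace (Z i)" using i(2) A_subset by blast
  have "t1 \<in> {t1..<t0}" using t(1) by simp
  from bspec[OF i(3) this] obtain u1 where u1: "u1 \<in> {0<..<1}" "G c b s t1 = Q i z u1" by (rule bexE)
  have u1s: "{u1..1} \<subseteq> {0..1}" using u1(1) by auto
  have inB: "G c b s t \<in> Q i z ` {u1..1}" if tt: "t \<in> {t1..<t0}" for t
  proof -
    obtain u where u: "u \<in> {0<..<1}" "G c b s t = Q i z u" using i(3) tt by blast
    have "u1 \<le> u"
    proof (cases "t = t1")
      case True
      then show ?thesis using Q_inj[OF i(1) zZ zZ u(1) u1(1)] u(2) u1(2) by simp
    next
      case False
      have sub: "{t1..t} \<subseteq> {t1..<t0}" using tt by auto
      have "u1 < u"
        by (rule parameter_increasing[OF c _ _ i(1) zZ _ u1(1) u(1) u1(2) u(2)])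
          (use False tt sub J(2) i(3) in auto)
      then show ?thesis by simp
    qed
    then have "u \<in> {u1..1}" using u(1) by auto
    then show ?thesis unfolding u(2) by (rule imageI)
  qed
  have cl: "closed {t \<in> {t1..t0}. G c b s t \<in> Q i z ` {u1..1}}"
    by (rule compact_imp_closed[OF closed_crossings[OF c closed_arc[OF i(1) zZ u1s] t(2)]])
  have "{t1<..<t0} \<subseteq> {t \<in> {t1..t0}. G c b s t \<in> Q i z ` {u1..1}}" using inB by auto
  then have "closure {t1<..<t0} \<subseteq> {t \<in> {t1..t0}. G c b s t \<in> Q i z ` {u1..1}}" using cl by (rule closure_minimal)
  moreover have "t0 \<in> closure {t1<..<t0}" using t(1) by simp
  ultimately have "G c b s t0 \<in> Q i z ` {u1..1}" by blast
  then obtain v where v: "v \<in> {u1..1}" "y = Q i z v" using t(3) by auto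
  then have "v = 0 \<or> v = 1" using Q_in_K[OF i(1) zZ, of v] y u1(1) by auto
  then have "v = 1" using v(1) u1(1) by auto
  then show thesis using that[OF i(1,2)] v(2) by simp
qed

end

lemma openin_sum_component:
  assumes "i \<in> I" "openin (X i) W" shows "openin (sum_topology X I) ({i} \<times> W)"
  unfolding openin_sum_topology
proof (intro conjI ballI)
  show "{i} \<times> W \<subseteq> Sigma I (topspace \<circ> X)" using assms openin_subset by fastforce
  fix j assume "j \<in> I"
  have "{x. (j, x) \<in> {i} \<times> W} = (if j = i then W else {})" by auto
  then show "openin (X j) {x. (j, x) \<in> {i} \<times> W}" using assms(2) by simp
qed

lemma closedin_sum_component:
  assumes "i \<in> I" "closedin (X i) W" shows "closedin (sum_topology X I) ({i} \<times> W)"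
  unfolding closedin_sum_topology
proof (intro conjI ballI)
  show "{i} \<times> W \<subseteq> Sigma I (topspace \<circ> X)" using assms closedin_subset by fastforce
  fix j assume "j \<in> I"
  have "{x. (j, x) \<in> {i} \<times> W} = (if j = i then W else {})" by auto
  then show "closedin (X j) {x. (j, x) \<in> {i} \<times> W}" using assms(2) by simp
qed

section \<open>Assembly of the pieces into one arc bundle\<close>

context elementary_family
begin

definition arcs :: "(nat \<times> 's) topology" where
  "arcs = sum_topology (\<lambda>i. subtopology (Z i) (A i)) {..<n}"

definition arc :: "nat \<times> 's \<Rightarrow> real \<Rightarrow> 'a" where
  "arc x t = Q (fst x) (snd x) t"

lemma topspace_strand: "topspace (subtopology (Z i) (A i)) = A i"
  using A_subset by auto

lemma in_arcs: "x \<in> topspace arcs \<longleftrightarrow> fst x < n \<and> snd x \<in> A (fst x)"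
  using A_subset by (cases x) (auto simp: arcs_def)

lemma in_arcs_Z: "x \<in> topspace arcs \<Longrightarrow> snd x \<in> topspace (Z (fst x))"
  using in_arcs A_subset by blast

lemma compact_arcs: "compact_space arcs"
  unfolding arcs_def
proof (rule compact_space_sum_topology)
  fix i assume "i \<in> {..<n}"
  then show "compact_space (subtopology (Z i) (A i))"
    using closedin_compact_space[OF Z_props(1) A_clopen(2)] by (simp add: compact_space_subtopology)
qed simp

text \<open>Continuity is local in the summand: an open rectangle for \<open>Q i\<close> restricts
  to the strands in \<open>A i\<close> and is then open in the product over the sum.\<close>

lemma arc_cont: "continuous_map (prod_topology arcs (top_of_set {0..1})) Y (\<lambda>(x, t). arc x t)"
  unfolding continuous_map_def
proof (intro conjI allI impI)
  let ?M = "prod_topology arcs (top_of_set {0..1::real})"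
  show "(\<lambda>(x, t). arc x t) \<in> topspace ?M \<rightarrow> topspace Y"
    using Q_in_Y in_arcs in_arcs_Z by (auto simp: arc_def)
  fix U assume U: "openin Y U"
  let ?P = "{w \<in> topspace ?M. (\<lambda>(x, t). arc x t) w \<in> U}"
  have rect: "\<exists>W T. openin arcs W \<and> openin (top_of_set {0..1}) T \<and> x \<in> W \<and> t \<in> T \<and> W \<times> T \<subseteq> ?P"
    if xt: "(x, t) \<in> ?P" for x t
  proof -
    have x: "x \<in> topspace arcs" "t \<in> {0..1}" "arc x t \<in> U" using xt by auto
    obtain i z where iz: "x = (i, z)" by (cases x)
    have i: "i < n" "z \<in> A i" using x(1) iz by (auto simp: in_arcs)
    define Pi where "Pi = {w \<in> topspace (prod_topology (Z i) (top_of_set {0..1})). (\<lambda>(z, t). Q i z t) w \<in> U}"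
    have "openin (prod_topology (Z i) (top_of_set {0..1})) Pi"
      unfolding Pi_def by (rule openin_continuous_map_preimage[OF Q_cont[OF i(1)] U])
    then have alt: "\<forall>x y. (x, y) \<in> Pi \<longrightarrow> (\<exists>W T. openin (Z i) W \<and> openin (top_of_set {0..1}) T \<and> x \<in> W \<and> y \<in> T \<and> W \<times> T \<subseteq> Pi)"
      unfolding openin_prod_topology_alt .
    have "(z, t) \<in> Pi" unfolding Pi_def using x iz in_arcs_Z[OF x(1)] by (auto simp: arc_def)
    from mp[OF spec[OF spec[OF alt]] this]
    obtain W T where W: "openin (Z i) W" "openin (top_of_set {0..1}) T" "z \<in> W" "t \<in> T" "W \<times> T \<subseteq> Pi"
      by (elim exE conjE)
    have "openin (subtopology (Z i) (A i)) (A i \<inter> W)" using W(1) by (rule openin_subtopology_Int2)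
    then have 1: "openin arcs ({i} \<times> (A i \<inter> W))"
      unfolding arcs_def using i(1) by (intro openin_sum_component) auto
    have "{i} \<times> (A i \<inter> W) \<times> T \<subseteq> {i} \<times> A i \<times> {0..1}" using openin_imp_subset[OF W(2)] by blast
    have 2: "({i} \<times> (A i \<inter> W)) \<times> T \<subseteq> ?P"
    proof
      fix w assume w: "w \<in> ({i} \<times> (A i \<inter> W)) \<times> T"
      then obtain z' t' where w': "w = ((i, z'), t')" "z' \<in> A i" "z' \<in> W" "t' \<in> T" by blast
      have "(z', t') \<in> Pi" using w'(3,4) W(5) by blast
      then have "t' \<in> {0..1}" "Q i z' t' \<in> U" by (auto simp: Pi_def)
      moreover have "(i, z') \<in> topspace arcs" using i(1) w'(2) by (simp add: in_arcs)
      ultimately show "w \<in> ?P" using w'(1) by (simp add: arc_def)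
    qed
    have "x \<in> {i} \<times> (A i \<inter> W)" using iz i(2) W(3) by blast
    then show ?thesis using 1 2 W(2,4) by blast
  qed
  show "openin ?M ?P" unfolding openin_prod_topology_alt by (intro allI impI rect)
qed

lemma arc_end_cont:
  assumes "i \<in> {0, 1}" shows "continuous_map arcs (subtopology Y K) (\<lambda>x. arc x i)"
proof -
  have "continuous_map arcs (prod_topology arcs (top_of_set {0..1})) (\<lambda>x. (x, i))"
    using assms by (intro continuous_map_pairedI) (auto simp: continuous_map_in_subtopology)
  from continuous_map_compose[OF this arc_cont] have "continuous_map arcs Y (\<lambda>x. arc x i)" by (simp add: comp_def)
  moreover have "arc x i \<in> K" if "x \<in> topspace arcs" for x
    using Q_ends in_arcs_Z[OF that] in_arcs[of x] that assms by (auto simp: arc_def)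
  ultimately show ?thesis by (auto simp: continuous_map_in_subtopology)
qed

text \<open>Arcs in the same summand are separated by the sequence of that summand, arcs in
  different summands by a whole summand. Pairs of summand and index are enumerated by
  \<open>prod_decode\<close>.\<close>

lemma arcs_clopen_sequence:
  obtains C :: "nat \<Rightarrow> (nat \<times> 's) set" where "\<forall>m. openin arcs (C m) \<and> closedin arcs (C m)"
    "\<forall>x\<in>topspace arcs. \<forall>y\<in>topspace arcs. x \<noteq> y \<longrightarrow> (\<exists>m. x \<in> C m \<and> y \<notin> C m)"
proof -
  let ?S = "\<lambda>i. subtopology (Z i) (A i)"
  have "\<exists>C :: nat \<Rightarrow> 's set. \<forall>k. i < n \<longrightarrow> openin (?S i) (C k) \<and> closedin (?S i) (C k) \<and>
      (\<forall>x\<in>A i. \<forall>y\<in>A i. x \<noteq> y \<longrightarrow> (\<exists>k. x \<in> C k \<and> y \<notin> C k))" for i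
  proof (cases "i < n")
    case True
    have s: "second_countable (?S i)" using Z_props(3)[OF True] by (rule second_countable_subtopology)
    have d: "?S i dim_le 0" using Z_props(4)[OF True] by (rule dimension_le_subtopology)
    have t: "t1_space (?S i)" using Z_props(2)[OF True] Hausdorff_imp_t1_space Hausdorff_space_subtopology by blast
    obtain C :: "nat \<Rightarrow> 's set" where C: "\<forall>k. openin (?S i) (C k) \<and> closedin (?S i) (C k)"
      "\<forall>x\<in>topspace (?S i). \<forall>y\<in>topspace (?S i). x \<noteq> y \<longrightarrow> (\<exists>k. x \<in> C k \<and> y \<notin> C k)"
      by (rule clopen_separating_sequence[OF s d t])
    show ?thesis using C unfolding topspace_strand by (intro exI[of _ C]) simp
  qed simp
  then have "\<forall>i. \<exists>C :: nat \<Rightarrow> 's set. \<forall>k. i < n \<longrightarrow> openin (?S i) (C k) \<and> closedin (?S i) (C k) \<and>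
      (\<forall>x\<in>A i. \<forall>y\<in>A i. x \<noteq> y \<longrightarrow> (\<exists>k. x \<in> C k \<and> y \<notin> C k))" by (rule allI)
  from choice[OF this] obtain Ci :: "nat \<Rightarrow> nat \<Rightarrow> 's set" where
    "\<forall>i k. i < n \<longrightarrow> openin (?S i) (Ci i k) \<and> closedin (?S i) (Ci i k) \<and>
      (\<forall>x\<in>A i. \<forall>y\<in>A i. x \<noteq> y \<longrightarrow> (\<exists>k. x \<in> Ci i k \<and> y \<notin> Ci i k))" by (rule exE)
  then have Ci: "openin (?S i) (Ci i k)" "closedin (?S i) (Ci i k)"
      "\<forall>x\<in>A i. \<forall>y\<in>A i. x \<noteq> y \<longrightarrow> (\<exists>k. x \<in> Ci i k \<and> y \<notin> Ci i k)" if "i < n" for i k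
    using that by simp_all
  \<comment> \<open>Index 0 is reserved for the whole summand; the separating sequence is shifted by
    one.\<close>
  define F where "F i k = (case k of 0 \<Rightarrow> A i | Suc k \<Rightarrow> Ci i k)" for i and k :: nat
  \<comment> \<open>Codes with \<open>i\<close> outside the range get the empty set, which is clopen
    and separates nothing.\<close>
  define C where "C m = (let (i, k) = prod_decode m in if i < n then {i} \<times> F i k else {})" for m
  have C: "C (prod_encode (i, k)) = {i} \<times> F i k" if "i < n" for i k using that by (simp add: C_def)
  have Fo: "openin (?S i) (F i k)" "closedin (?S i) (F i k)" if "i < n" for i k
    using Ci(1,2)[OF that] openin_topspace[of "?S i"] closedin_topspace[of "?S i"]
    unfolding topspace_strand F_def by (auto split: nat.split)
  have "openin arcs (C m) \<and> closedin arcs (C m)" for m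
  proof -
    obtain i k where m: "prod_decode m = (i, k)" by (cases "prod_decode m")
    show ?thesis
    proof (cases "i < n")
      case True
      then show ?thesis unfolding C_def m arcs_def
        using openin_sum_component[of i "{..<n}" ?S "F i k"] closedin_sum_component[of i "{..<n}" ?S "F i k"]
          Fo[OF True] by simp
    qed (simp add: C_def m)
  qed
  moreover have "\<exists>m. x \<in> C m \<and> y \<notin> C m" if xy: "x \<in> topspace arcs" "y \<in> topspace arcs" "x \<noteq> y" for x y
  proof -
    obtain i z j w where e: "x = (i, z)" "y = (j, w)" by (cases x, cases y)
    have m: "i < n" "z \<in> A i" "j < n" "w \<in> A j" using xy(1,2) by (auto simp: e in_arcs)
    show ?thesis
    proof (cases "i = j")
      case True
      then have "z \<noteq> w" using xy(3) e by blast
      then obtain k where "z \<in> Ci i k" "w \<notin> Ci i k" using Ci(3)[OF m(1)] m(2,4) True by blast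
      then show ?thesis using C[OF m(1), of "Suc k"] e True by (intro exI[of _ "prod_encode (i, Suc k)"]) (simp add: F_def)
    next
      case False
      then show ?thesis using C[OF m(1), of 0] e m by (intro exI[of _ "prod_encode (i, 0)"]) (simp add: F_def)
    qed
  qed
  ultimately show thesis using that[of C] by blast
qed

lemma presentation: "\<exists>X V D f. directed_presentation X V D f Y"
proof -
  obtain C :: "nat \<Rightarrow> (nat \<times> 's) set" where C: "\<forall>m. openin arcs (C m) \<and> closedin arcs (C m)"
    "\<forall>x\<in>topspace arcs. \<forall>y\<in>topspace arcs. x \<noteq> y \<longrightarrow> (\<exists>m. x \<in> C m \<and> y \<notin> C m)"
    by (rule arcs_clopen_sequence)
  have sK: "second_countable (subtopology Y K)" using second_countable_Y by (rule second_countable_subtopology)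
  have tK: "t1_space (subtopology Y K)"
    using Hausdorff_Y Hausdorff_imp_t1_space Hausdorff_space_subtopology by blast
  obtain B :: "nat \<Rightarrow> 'a set" where BK: "\<forall>m. openin (subtopology Y K) (B m) \<and> closedin (subtopology Y K) (B m)"
    "\<forall>x\<in>topspace (subtopology Y K). \<forall>y\<in>topspace (subtopology Y K). x \<noteq> y \<longrightarrow> (\<exists>m. x \<in> B m \<and> y \<notin> B m)"
    by (rule clopen_separating_sequence[OF sK transversal_dim[OF K] tK])
  have B: "openin (subtopology Y K) (B m)" "closedin (subtopology Y K) (B m)" for m using BK(1) by simp_all
  have end_in_K: "arc x i \<in> topspace (subtopology Y K)" if "x \<in> topspace arcs" "i \<in> {0, 1}" for x i
    using funcset_mem[OF continuous_map_funspace[OF arc_end_cont[OF that(2)]] that(1)] .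
  interpret arc_bundle arcs Y arc C B
  proof
    show "compact_space arcs" by (rule compact_arcs)
    show "Hausdorff_space Y" by (rule Hausdorff_Y)
    show "continuous_map (prod_topology arcs (top_of_set {0..1})) Y (\<lambda>(z, t). arc z t)" by (rule arc_cont)
    show "\<exists>z\<in>topspace arcs. \<exists>t\<in>{0..1}. y = arc z t" if y: "y \<in> topspace Y" for y
    proof (cases "y \<in> K")
      case True
      obtain i z where "i < n" "z \<in> A i" "Q i z 0 = y" by (rule initial_point[OF True])
      then show ?thesis by (intro bexI[of _ "(i, z)"] bexI[of _ 0]) (auto simp: arc_def in_arcs)
    next
      case False
      obtain i z t where "i < n" "z \<in> A i" "t \<in> {0<..<1}" "y = Q i z t" by (rule covered[OF y False])
      then show ?thesis by (intro bexI[of _ "(i, z)"] bexI[of _ t]) (auto simp: arc_def in_arcs)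
    qed
    show "x = x' \<and> t = t'"
      if a: "x \<in> topspace arcs" "x' \<in> topspace arcs" "0 < t" "t < 1" "0 \<le> t'" "t' \<le> 1" "arc x t = arc x' t'" for x x' t t'
    proof -
      obtain i z j w where e: "x = (i, z)" "x' = (j, w)" by (cases x, cases x')
      have m: "i < n" "z \<in> A i" "j < n" "w \<in> A j" using a(1,2) by (auto simp: e in_arcs)
      have zw: "z \<in> topspace (Z i)" "w \<in> topspace (Z j)" using m A_subset by blast+
      have eq: "Q i z t = Q j w t'" using a(7) by (simp add: arc_def e)
      have "Q j w t' \<notin> K" using Q_open[OF m(1) zw(1) a(3,4)] eq by simp
      then have "t' \<noteq> 0" "t' \<noteq> 1" using Q_ends[OF m(3) zw(2)] by auto
      then have t: "t \<in> {0<..<1}" "t' \<in> {0<..<1}" using a(3-6) by auto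
      have ij: "i = j" by (rule pieces_disjoint[OF m(1,3,2,4) t eq])
      have "z = w \<and> t = t'"
        by (rule Q_inj[OF m(1) zw(1) _ t]) (use zw(2) eq ij in auto)
      then show ?thesis using e ij by simp
    qed
    show "\<exists>z'\<in>topspace arcs. arc z' 1 = arc z 0" if "z \<in> topspace arcs" for z
    proof -
      have "arc z 0 \<in> K" using end_in_K[OF that, of 0] by simp
      then obtain i z' where "i < n" "z' \<in> A i" "Q i z' 1 = arc z 0" by (rule terminal_point)
      then show ?thesis by (intro bexI[of _ "(i, z')"]) (auto simp: arc_def in_arcs)
    qed
    show "\<exists>z'\<in>topspace arcs. arc z' 0 = arc z 1" if "z \<in> topspace arcs" for z
    proof -
      have "arc z 1 \<in> K" using end_in_K[OF that, of 1] by simp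
      then obtain i z' where "i < n" "z' \<in> A i" "Q i z' 0 = arc z 1" by (rule initial_point)
      then show ?thesis by (intro bexI[of _ "(i, z')"]) (auto simp: arc_def in_arcs)
    qed
    show "openin arcs (C m)" "closedin arcs (C m)" for m using C(1) by simp_all
    show "\<exists>m. (z \<in> C m) \<noteq> (z' \<in> C m)" if "z \<in> topspace arcs" "z' \<in> topspace arcs" "z \<noteq> z'" for z z'
      using C(2) that by metis
    show "openin arcs {z \<in> topspace arcs. arc z i \<in> B m}" if "i \<in> {0, 1}" for i m
      by (rule openin_continuous_map_preimage[OF arc_end_cont[OF that] B(1)])
    show "closedin arcs {z \<in> topspace arcs. arc z i \<in> B m}" if "i \<in> {0, 1}" for i m
      by (rule closedin_continuous_map_preimage[OF arc_end_cont[OF that] B(2)])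
    show "\<exists>m. (arc z i \<in> B m) \<noteq> (arc z' i' \<in> B m)"
      if a: "z \<in> topspace arcs" "z' \<in> topspace arcs" "i \<in> {0, 1}" "i' \<in> {0, 1}" "arc z i \<noteq> arc z' i'" for z z' i i'
    proof -
      obtain m where "arc z i \<in> B m" "arc z' i' \<notin> B m"
        using mp[OF bspec[OF bspec[OF BK(2) end_in_K[OF a(1,3)]] end_in_K[OF a(2,4)]] a(5)] by (elim exE conjE)
      then show ?thesis by (intro exI[of _ m]) simp
    qed
  qed
  show ?thesis using directed_presentation by blast
qed

end

context oriented_charts
begin

theorem exists_directed_presentation: "\<exists>X V D f. directed_presentation X V D f Y"
proof -
  obtain K \<E> where E: "transversal K" "finite \<E>" "\<E> \<subseteq> elementary_regions K" "topspace Y \<subseteq> \<Union>\<E>"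
    by (rule elementary_cover)
  obtain n :: nat and R where R: "\<E> = R ` {i. i < n}"
    using finite_imp_nat_seg_image_inj_on[OF E(2)] by blast
  have "\<forall>i. \<exists>ZQ. i < n \<longrightarrow> elementary K (fst ZQ) (snd ZQ) \<and> R i = region (fst ZQ) (snd ZQ)"
  proof
    fix i
    show "\<exists>ZQ. i < n \<longrightarrow> elementary K (fst ZQ) (snd ZQ) \<and> R i = region (fst ZQ) (snd ZQ)"
    proof (cases "i < n")
      case True
      then have "R i \<in> elementary_regions K" using E(3) R by blast
      then obtain Z Q where "elementary K Z Q" "R i = region Z Q" unfolding elementary_regions_def by blast
      then show ?thesis by (intro exI[of _ "(Z, Q)"]) simp
    qed simp
  qed
  from choice[OF this] obtain ZQ where
    ZQ: "\<forall>i. i < n \<longrightarrow> elementary K (fst (ZQ i)) (snd (ZQ i)) \<and> R i = region (fst (ZQ i)) (snd (ZQ i))" by (rule exE)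
  have cov: "topspace Y \<subseteq> (\<Union>i<n. region (fst (ZQ i)) (snd (ZQ i)))"
  proof
    fix y assume "y \<in> topspace Y"
    then obtain i where "i < n" "y \<in> R i" using E(4) R by blast
    then show "y \<in> (\<Union>i<n. region (fst (ZQ i)) (snd (ZQ i)))" using ZQ by auto
  qed
  interpret elementary_family Y \<Omega> V p S G K n "\<lambda>i. fst (ZQ i)" "\<lambda>i. snd (ZQ i)"
    by unfold_locales (use E(1) ZQ cov in auto)
  show ?thesis by (rule presentation)
qed

end

section \<open>Charts of branched matchbox manifolds\<close>

definition chart_side :: "('a, 's) chart \<Rightarrow> bool \<Rightarrow> 's topology" where
  "chart_side c b = (if b then chart_right c else chart_left c)"

definition chart_height :: "('a, 's) chart \<Rightarrow> 'a \<Rightarrow> real" where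
  "chart_height c y = matchbox_proj (chart_map c y)"

definition chart_point :: "('a, 's) chart \<Rightarrow> bool \<Rightarrow> 's \<Rightarrow> real \<Rightarrow> 'a" where
  "chart_point c b s t = the_inv_into (chart_dom c) (chart_map c)
     (matchbox_rel (chart_left c) (chart_right c) (chart_rel c) `` {((b, s), t)})"

text \<open>A continuous injection of a compact space into a Hausdorff space is an embedding. This
  carries dimension 0 from strand spaces to the levels of a chart.\<close>

lemma dim_le_0_compact_image:
  assumes "continuous_map X Y f" "inj_on f (topspace X)" "compact_space X" "X dim_le 0" "Hausdorff_space Y"
  shows "subtopology Y (f ` topspace X) dim_le 0"
proof -
  have sub: "f ` topspace X \<subseteq> topspace Y" using assms(1) by (rule continuous_map_image_subset_topspace)
  have "homeomorphic_map X (subtopology Y (f ` topspace X)) f"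
  proof (rule continuous_imp_homeomorphic_map)
    show "continuous_map X (subtopology Y (f ` topspace X)) f"
      using assms(1) by (auto simp: continuous_map_in_subtopology)
    show "Hausdorff_space (subtopology Y (f ` topspace X))" using assms(5) by (rule Hausdorff_space_subtopology)
    show "f ` topspace X = topspace (subtopology Y (f ` topspace X))" using sub by auto
  qed (use assms in auto)
  then show ?thesis
    using homeomorphic_space_dimension_le homeomorphic_map_imp_homeomorphic_space assms(4) by blast
qed

locale matchbox_chart =
  fixes Y :: "'a topology" and c :: "('a, 's) chart"
  assumes chart: "chart_on Y c" and Hausdorff_Y: "Hausdorff_space Y"
begin

abbreviation pre :: "((bool \<times> 's) \<times> real) topology" where
  "pre \<equiv> prematchbox (chart_left c) (chart_right c)"

abbreviation cls :: "(bool \<times> 's) \<times> real \<Rightarrow> ((bool \<times> 's) \<times> real) set" where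
  "cls x \<equiv> matchbox_rel (chart_left c) (chart_right c) (chart_rel c) `` {x}"

abbreviation bottom :: "(bool \<times> 's) topology" where
  "bottom \<equiv> ends (chart_left c) (chart_right c)"

lemma data: "branching_data (chart_left c) (chart_right c) (chart_rel c)"
  and dom_open: "openin Y (chart_dom c)"
  and homeo: "homeomorphic_map (subtopology Y (chart_dom c)) (chart_box c) (chart_map c)"
  using chart by (simp_all add: chart_on_def)

lemma side_props:
  "compact_space (chart_side c b)" "Hausdorff_space (chart_side c b)"
  "second_countable (chart_side c b)" "chart_side c b dim_le 0"
  using data second_countable_metrizable metrizable_imp_Hausdorff_space
  by (auto simp: branching_data_def chart_side_def)

lemma in_bottom: "(b, s) \<in> topspace bottom \<longleftrightarrow> s \<in> topspace (chart_side c b)"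
  by (auto simp: ends_def chart_side_def)

lemma in_pre: "((b, s), t) \<in> topspace pre \<longleftrightarrow> s \<in> topspace (chart_side c b) \<and> t \<in> side b"
  using in_bottom[of b s] by (auto simp: prematchbox_def side_def)

lemma equiv_cls: "equiv (topspace pre) (matchbox_rel (chart_left c) (chart_right c) (chart_rel c))"
  by (rule equiv_matchbox_rel[OF data])

lemma cls_eq_iff:
  assumes "x \<in> topspace pre" "y \<in> topspace pre"
  shows "cls x = cls y \<longleftrightarrow> (fst x, fst y) \<in> chart_rel c \<and> snd x = 0 \<and> snd y = 0 \<or> x = y"
proof -
  have "cls x = cls y \<longleftrightarrow> (x, y) \<in> matchbox_rel (chart_left c) (chart_right c) (chart_rel c)"
    by (rule eq_equiv_class_iff[OF equiv_cls assms])
  also have "\<dots> \<longleftrightarrow> (fst x, fst y) \<in> chart_rel c \<and> snd x = 0 \<and> snd y = 0 \<or> x = y"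
    using assms by (cases x, cases y) (auto simp: matchbox_rel_def)
  finally show ?thesis .
qed

lemma quotient_cls: "quotient_map pre (chart_box c) cls"
  unfolding chart_box_def matchbox_def by (rule quotient_map_quotient_topology)

lemma topspace_dom: "topspace (subtopology Y (chart_dom c)) = chart_dom c"
  using dom_open openin_subset by fastforce

lemma topspace_box: "topspace (chart_box c) = cls ` topspace pre"
  using quotient_imp_surjective_map[OF quotient_cls] by simp

lemma inverse_chart:
  "continuous_map (chart_box c) (subtopology Y (chart_dom c)) (the_inv_into (chart_dom c) (chart_map c))"
  "w \<in> topspace (chart_box c) \<Longrightarrow> chart_map c (the_inv_into (chart_dom c) (chart_map c) w) = w"
  "y \<in> chart_dom c \<Longrightarrow> the_inv_into (chart_dom c) (chart_map c) (chart_map c y) = y"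
proof -
  obtain g where g: "homeomorphic_maps (subtopology Y (chart_dom c)) (chart_box c) (chart_map c) g"
    using homeo homeomorphic_map_maps by blast
  have inj: "inj_on (chart_map c) (chart_dom c)"
    using homeomorphic_imp_injective_map[OF homeo] unfolding topspace_dom .
  have gc: "continuous_map (chart_box c) (subtopology Y (chart_dom c)) g"
    and hg: "\<And>w. w \<in> topspace (chart_box c) \<Longrightarrow> chart_map c (g w) = w"
    using g by (auto simp: homeomorphic_maps_def)
  have gd: "g w \<in> chart_dom c" if "w \<in> topspace (chart_box c)" for w
    using funcset_mem[OF continuous_map_funspace[OF gc] that] unfolding topspace_dom .
  have eq: "the_inv_into (chart_dom c) (chart_map c) w = g w" if "w \<in> topspace (chart_box c)" for w
    by (rule the_inv_into_f_eq[OF inj hg[OF that] gd[OF that]])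
  show "continuous_map (chart_box c) (subtopology Y (chart_dom c)) (the_inv_into (chart_dom c) (chart_map c))"
    using gc by (rule continuous_map_eq) (simp add: eq)
  show "w \<in> topspace (chart_box c) \<Longrightarrow> chart_map c (the_inv_into (chart_dom c) (chart_map c) w) = w"
    using eq hg by simp
  show "y \<in> chart_dom c \<Longrightarrow> the_inv_into (chart_dom c) (chart_map c) (chart_map c y) = y"
    using inj by (rule the_inv_into_f_f)
qed

lemma point_def': "chart_point c b s t = the_inv_into (chart_dom c) (chart_map c) (cls ((b, s), t))"
  by (simp add: chart_point_def)

lemma map_point:
  assumes "((b, s), t) \<in> topspace pre"
  shows "chart_map c (chart_point c b s t) = cls ((b, s), t)"
  unfolding point_def' by (rule inverse_chart(2)) (use assms topspace_box in blast)

lemma point_eq_iff: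
  assumes "((b, s), t) \<in> topspace pre" "((b', s'), t') \<in> topspace pre"
  shows "chart_point c b s t = chart_point c b' s' t' \<longleftrightarrow>
    ((b, s), (b', s')) \<in> chart_rel c \<and> t = 0 \<and> t' = 0 \<or> b = b' \<and> s = s' \<and> t = t'"
proof -
  have "chart_point c b s t = chart_point c b' s' t' \<longleftrightarrow> cls ((b, s), t) = cls ((b', s'), t')"
    using map_point[OF assms(1)] map_point[OF assms(2)] unfolding point_def' by metis
  then show ?thesis using cls_eq_iff[OF assms] by simp
qed

lemma continuous_point: "continuous_map pre (subtopology Y (chart_dom c)) (\<lambda>x. chart_point c (fst (fst x)) (snd (fst x)) (snd x))"
proof -
  have "continuous_map pre (chart_box c) cls" by (rule quotient_imp_continuous_map[OF quotient_cls])
  from continuous_map_compose[OF this inverse_chart(1)] show ?thesis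
    by (simp add: comp_def point_def')
qed

lemma point_in_dom:
  assumes "s \<in> topspace (chart_side c b)" "t \<in> side b" shows "chart_point c b s t \<in> chart_dom c"
proof -
  have "((b, s), t) \<in> topspace pre" using assms in_pre by blast
  from funcset_mem[OF continuous_map_funspace[OF continuous_point] this] show ?thesis
    unfolding topspace_dom by simp
qed

lemma height_point:
  assumes "s \<in> topspace (chart_side c b)" "t \<in> side b"
  shows "chart_height c (chart_point c b s t) = t"
proof -
  have "((b, s), t) \<in> topspace pre" using assms in_pre by blast
  then show ?thesis unfolding chart_height_def using map_point matchbox_proj_class by metis
qed

lemma dom_cases:
  assumes "y \<in> chart_dom c"
  obtains b s where "s \<in> topspace (chart_side c b)" "chart_height c y \<in> side b" "y = chart_point c b s (chart_height c y)"
proof -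
  have "chart_map c y \<in> topspace (chart_box c)"
    using funcset_mem[OF continuous_map_funspace[OF homeomorphic_imp_continuous_map[OF homeo]]] assms
    unfolding topspace_dom by blast
  then obtain x where x: "x \<in> topspace pre" "chart_map c y = cls x" unfolding topspace_box by (rule imageE)
  obtain b s t where e: "x = ((b, s), t)" by (metis surj_pair)
  have m: "s \<in> topspace (chart_side c b)" "t \<in> side b" using x(1) unfolding e in_pre by auto
  have y: "y = chart_point c b s t" using inverse_chart(3)[OF assms] x(2) by (simp add: e point_def')
  then have "chart_height c y = t" using height_point[OF m] by simp
  then show thesis using that m y by simp
qed

lemma continuous_height: "continuous_map (subtopology Y (chart_dom c)) euclideanreal (chart_height c)"
proof -
  have "continuous_map pre euclideanreal snd"
    unfolding prematchbox_def by (intro continuous_map_from_subtopology continuous_map_snd)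
  then have "continuous_map pre euclideanreal (matchbox_proj \<circ> cls)"
  proof (rule continuous_map_eq)
    fix x assume "x \<in> topspace pre"
    then show "snd x = (matchbox_proj \<circ> cls) x"
      using matchbox_proj_class[of "fst x" "snd x" "chart_left c" "chart_right c" "chart_rel c"] by simp
  qed
  then have "continuous_map (chart_box c) euclideanreal matchbox_proj"
    by (rule continuous_compose_quotient_map[OF quotient_cls])
  from continuous_map_compose[OF homeomorphic_imp_continuous_map[OF homeo] this]
  show ?thesis by (simp add: comp_def chart_height_def[abs_def])
qed

lemma other_side:
  assumes "s \<in> topspace (chart_side c b)"
  obtains s' where "s' \<in> topspace (chart_side c (\<not> b))" "((b, s), (\<not> b, s')) \<in> chart_rel c"
proof (cases b)
  case True
  then obtain s' where "s' \<in> topspace (chart_left c)" "((True, s), (False, s')) \<in> chart_rel c"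
    using data assms by (auto simp: branching_data_def chart_side_def)
  then show thesis using that True by (simp add: chart_side_def)
next
  case False
  then obtain s' where "s' \<in> topspace (chart_right c)" "((False, s), (True, s')) \<in> chart_rel c"
    using data assms by (auto simp: branching_data_def chart_side_def)
  then show thesis using that False by (simp add: chart_side_def)
qed

text \<open>A point may be given by a strand of the opposite side only if its height is 0. There the
  branching data provide an equivalent strand on the required side.\<close>

lemma point_onto:
  assumes "y \<in> chart_dom c" "chart_height c y \<in> side b"
  shows "\<exists>s\<in>topspace (chart_side c b). y = chart_point c b s (chart_height c y)"
proof -
  obtain b' s' where s': "s' \<in> topspace (chart_side c b')" "chart_height c y \<in> side b'"
    "y = chart_point c b' s' (chart_height c y)"
    by (rule dom_cases[OF assms(1)])
  show ?thesis
  proof (cases "b' = b")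
    case False
    then have 0: "chart_height c y = 0" using side_unique[OF s'(2) assms(2)] by blast
    have nb: "(\<not> b') = b" using False by auto
    obtain s where s: "s \<in> topspace (chart_side c b)" "((b', s'), (b, s)) \<in> chart_rel c"
      using other_side[OF s'(1)] unfolding nb by blast
    have "((b', s'), 0) \<in> topspace pre" "((b, s), 0) \<in> topspace pre" using s(1) s'(1) by (auto simp: in_pre)
    then have "chart_point c b' s' 0 = chart_point c b s 0" using point_eq_iff s(2) by blast
    then show ?thesis using s(1) s'(3) 0 by auto
  qed (use s' in blast)
qed

lemma continuous_point_side:
  "continuous_map (prod_topology (chart_side c b) (top_of_set (side b))) Y (\<lambda>(s, t). chart_point c b s t)"
proof -
  let ?M = "prod_topology (chart_side c b) (top_of_set (side b))"
  have "continuous_map (chart_side c b) bottom (\<lambda>s. (b, s))"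
    using continuous_map_component_injection[of b UNIV "\<lambda>b. if b then chart_right c else chart_left c"]
    by (simp add: ends_def chart_side_def)
  from continuous_map_compose[OF continuous_map_fst this]
  have 1: "continuous_map ?M bottom (\<lambda>x. (b, fst x))" by (simp add: comp_def)
  have "continuous_map ?M (top_of_set (side b)) snd" by (rule continuous_map_snd)
  then have 2: "continuous_map ?M euclideanreal snd" by (simp add: continuous_map_in_subtopology)
  have "continuous_map ?M (prod_topology bottom euclideanreal) (\<lambda>x. ((b, fst x), snd x))"
    using 1 2 by (rule continuous_map_pairedI)
  then have "continuous_map ?M pre (\<lambda>x. ((b, fst x), snd x))"
    unfolding prematchbox_def continuous_map_in_subtopology by (auto simp: side_def)
  from continuous_map_compose[OF this continuous_point]
  have "continuous_map ?M (subtopology Y (chart_dom c)) (\<lambda>x. chart_point c b (fst x) (snd x))" by (simp add: comp_def)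
  then have "continuous_map ?M Y (\<lambda>x. chart_point c b (fst x) (snd x))" using continuous_map_in_subtopology by blast
  then show ?thesis by (simp add: case_prod_unfold)
qed

lemma continuous_point_fixed_t:
  assumes "t \<in> side b" shows "continuous_map (chart_side c b) Y (\<lambda>s. chart_point c b s t)"
proof -
  have "continuous_map (chart_side c b) (prod_topology (chart_side c b) (top_of_set (side b))) (\<lambda>s. (s, t))"
    using assms by (intro continuous_map_pairedI) (auto simp: continuous_map_in_subtopology)
  from continuous_map_compose[OF this continuous_point_side] show ?thesis by (simp add: comp_def)
qed

lemma continuous_point_fixed_s:
  assumes "s \<in> topspace (chart_side c b)" shows "continuous_map (top_of_set (side b)) Y (\<lambda>t. chart_point c b s t)"
proof -
  have "continuous_map (top_of_set (side b)) (prod_topology (chart_side c b) (top_of_set (side b))) (\<lambda>t. (s, t))"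
    using assms by (intro continuous_map_pairedI) auto
  from continuous_map_compose[OF this continuous_point_side] show ?thesis by (simp add: comp_def)
qed

text \<open>A level at nonzero height is an embedded copy of a strand space. Level 0 is an embedded
  copy of the quotient of both strand spaces by \<open>chart_rel c\<close>, and this is where the
  assumption that the quotient is zero-dimensional enters. Other levels are empty.\<close>

lemma level_dim: "subtopology Y {y \<in> chart_dom c. chart_height c y = l} dim_le 0"
proof -
  have image: "{y \<in> chart_dom c. chart_height c y = l} = (\<lambda>s. chart_point c b s l) ` topspace (chart_side c b)"
    if b: "l \<in> side b" for b
  proof (intro equalityI subsetI)
    fix y assume "y \<in> {y \<in> chart_dom c. chart_height c y = l}"
    then obtain s where "s \<in> topspace (chart_side c b)" "y = chart_point c b s l" using point_onto[of y b] b by auto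
    then show "y \<in> (\<lambda>s. chart_point c b s l) ` topspace (chart_side c b)" by blast
  next
    fix y assume "y \<in> (\<lambda>s. chart_point c b s l) ` topspace (chart_side c b)"
    then obtain s where "s \<in> topspace (chart_side c b)" "y = chart_point c b s l" by blast
    then show "y \<in> {y \<in> chart_dom c. chart_height c y = l}" using point_in_dom[OF _ b] height_point[OF _ b] by simp
  qed
  consider b where "l \<in> side b" "l \<noteq> 0" | "l = 0" | "\<forall>b. l \<notin> side b" by blast
  then show ?thesis
  proof cases
    case (1 b)
    have "inj_on (\<lambda>s. chart_point c b s l) (topspace (chart_side c b))"
    proof (rule inj_onI)
      fix s s' assume a: "s \<in> topspace (chart_side c b)" "s' \<in> topspace (chart_side c b)"
        "chart_point c b s l = chart_point c b s' l"
      then show "s = s'" using point_eq_iff[of b s l b s' l] 1 in_pre by auto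
    qed
    then show ?thesis unfolding image[OF 1(1)]
      by (rule dim_le_0_compact_image[OF continuous_point_fixed_t[OF 1(1)] _ side_props(1,4) Hausdorff_Y])
  next
    case 2
    let ?q = "\<lambda>z. chart_rel c `` {z}" and ?f = "\<lambda>z. chart_point c (fst z) (snd z) 0"
    let ?B = "quotient_topology bottom (chart_rel c)"
    have eqv: "equiv (topspace bottom) (chart_rel c)" and dimB: "?B dim_le 0"
      using data by (simp_all add: branching_data_def)
    have q: "quotient_map bottom ?B ?q" by (rule quotient_map_quotient_topology)
    have "compact_space bottom" unfolding ends_def
      by (rule compact_space_sum_topology) (use side_props(1) in \<open>auto simp: chart_side_def\<close>)
    then have compB: "compact_space ?B"
      using image_compactin[OF _ quotient_imp_continuous_map[OF q]] quotient_imp_surjective_map[OF q]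
      unfolding compact_space_def by metis
    have bot: "(z, 0) \<in> topspace pre" if "z \<in> topspace bottom" for z
      using that in_bottom[of "fst z" "snd z"] in_pre[of "fst z" "snd z" 0] by simp
    have f_eq: "?f z = ?f w \<longleftrightarrow> ?q z = ?q w" if "z \<in> topspace bottom" "w \<in> topspace bottom" for z w
    proof -
      have "?f z = ?f w \<longleftrightarrow> (z, w) \<in> chart_rel c \<or> z = w"
        using point_eq_iff[of "fst z" "snd z" 0 "fst w" "snd w" 0] bot that by (auto simp: prod_eq_iff)
      also have "\<dots> \<longleftrightarrow> (z, w) \<in> chart_rel c" using eqv that(1) by (auto simp: equiv_def refl_on_def)
      also have "\<dots> \<longleftrightarrow> ?q z = ?q w" using eq_equiv_class_iff[OF eqv that] by blast
      finally show ?thesis .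
    qed
    have "continuous_map bottom pre (\<lambda>z. (z, 0))"
    proof -
      have "continuous_map bottom (prod_topology bottom euclideanreal) (\<lambda>z. (z, 0))"
        by (intro continuous_map_pairedI) auto
      then show ?thesis unfolding prematchbox_def continuous_map_in_subtopology by auto
    qed
    from continuous_map_compose[OF this continuous_point]
    have "continuous_map bottom (subtopology Y (chart_dom c)) ?f" by (simp add: comp_def)
    then have fc: "continuous_map bottom Y ?f" using continuous_map_in_subtopology by blast
    obtain g where g: "continuous_map ?B Y g" "g ` topspace ?B = ?f ` topspace bottom"
      "\<And>z. z \<in> topspace bottom \<Longrightarrow> g (?q z) = ?f z"
      by (rule quotient_map_lift_exists[OF q fc]) (use f_eq in auto)
    have "inj_on g (topspace ?B)"
    proof (rule inj_onI)
      fix u v assume a: "u \<in> topspace ?B" "v \<in> topspace ?B" "g u = g v"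
      obtain z where z: "z \<in> topspace bottom" "u = ?q z"
        using a(1) quotient_imp_surjective_map[OF q] by blast
      obtain w where w: "w \<in> topspace bottom" "v = ?q w"
        using a(2) quotient_imp_surjective_map[OF q] by blast
      show "u = v" using a(3) g(3)[OF z(1)] g(3)[OF w(1)] f_eq[OF z(1) w(1)] z(2) w(2) by simp
    qed
    then have "subtopology Y (g ` topspace ?B) dim_le 0"
      by (rule dim_le_0_compact_image[OF g(1) _ compB dimB Hausdorff_Y])
    moreover have "?f ` topspace bottom = {y \<in> chart_dom c. chart_height c y = l}"
    proof (intro equalityI subsetI)
      fix y assume "y \<in> ?f ` topspace bottom"
      then obtain z where z: "z \<in> topspace bottom" "y = ?f z" by blast
      then have "snd z \<in> topspace (chart_side c (fst z))" using in_bottom[of "fst z" "snd z"] by simp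
      then show "y \<in> {y \<in> chart_dom c. chart_height c y = l}"
        using point_in_dom[of "snd z" "fst z" 0] height_point[of "snd z" "fst z" 0] z(2) 2 by simp
    next
      fix y assume "y \<in> {y \<in> chart_dom c. chart_height c y = l}"
      then obtain s where s: "s \<in> topspace (chart_side c True)" "y = chart_point c True s 0"
        using point_onto[of y True] 2 by auto
      then have "(True, s) \<in> topspace bottom" using in_bottom by blast
      moreover have "y = ?f (True, s)" using s(2) by simp
      ultimately show "y \<in> ?f ` topspace bottom" by blast
    qed
    ultimately show ?thesis using g(2) by simp
  next
    case 3
    have empty: "{y \<in> chart_dom c. chart_height c y = l} = {}" using 3 dom_cases by blast
    show ?thesis unfolding empty by (rule dim_le_0I) (auto dest: openin_subset)
  qed
qed

end

text \<open>The strand is an injective curve along which the height in \<open>c\<close> increases,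
  so \<open>same_direction\<close> makes the height in \<open>d\<close> nondecreasing. If it were
  not larger at the end, it would be constant, and the curve would be a connected set with more than
  one point inside a zero-dimensional level.\<close>

lemma chart_arc_increasing:
  assumes c: "matchbox_chart Y c" and d: "matchbox_chart Y d" and dir: "same_direction Y c d"
    and s: "s \<in> topspace (chart_side c b)" and t: "t1 < t2" "{t1..t2} \<subseteq> side b"
    and sub: "\<forall>t\<in>{t1..t2}. chart_point c b s t \<in> chart_dom d"
  shows "chart_height d (chart_point c b s t1) < chart_height d (chart_point c b s t2)"
proof -
  interpret C: matchbox_chart Y c by (rule c)
  interpret D: matchbox_chart Y d by (rule d)
  define \<gamma> where "\<gamma> u = chart_point c b s (t1 + u * (t2 - t1))" for u
  have par: "t1 + u * (t2 - t1) \<in> {t1..t2}" if "u \<in> {0..1}" for u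
  proof -
    have "0 \<le> u * (t2 - t1)" "u * (t2 - t1) \<le> 1 * (t2 - t1)"
      using that t(1) by (auto intro: mult_right_mono)
    then show ?thesis by simp
  qed
  have ht: "chart_height c (\<gamma> u) = t1 + u * (t2 - t1)" if "u \<in> {0..1}" for u
    unfolding \<gamma>_def using par[OF that] t(2) by (intro C.height_point[OF s]) blast
  have "continuous_map (top_of_set {0..1}) (top_of_set (side b)) (\<lambda>u. t1 + u * (t2 - t1))"
  proof -
    have "continuous_on {0..1} (\<lambda>u. t1 + u * (t2 - t1))" by (intro continuous_intros)
    moreover have "(\<lambda>u. t1 + u * (t2 - t1)) \<in> {0..1} \<rightarrow> side b" using par t(2) by blast
    ultimately show ?thesis by (simp add: continuous_map_in_subtopology)
  qed
  from continuous_map_compose[OF this C.continuous_point_fixed_s[OF s]]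
  have \<gamma>c: "continuous_map (top_of_set {0..1}) Y \<gamma>" by (simp add: comp_def \<gamma>_def[abs_def])
  have \<gamma>d: "\<gamma> u \<in> chart_dom c \<inter> chart_dom d" if "u \<in> {0..1}" for u
    unfolding \<gamma>_def using par[OF that] C.point_in_dom[OF s, of "t1 + u * (t2 - t1)"] t(2) sub by blast
  have inj: "inj_on \<gamma> {0..1}"
  proof (rule inj_onI)
    fix u v :: real assume "u \<in> {0..1}" "v \<in> {0..1}" "\<gamma> u = \<gamma> v"
    then have "t1 + u * (t2 - t1) = t1 + v * (t2 - t1)" using ht by metis
    then show "u = v" using t(1) by simp
  qed
  have "locally_one_to_one \<gamma>"
    unfolding locally_one_to_one_def
  proof
    fix t :: real
    have "inj_on \<gamma> ({0..1} \<inter> ball t 1)" by (rule inj_on_subset[OF inj]) blast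
    then show "\<exists>\<epsilon>>0. inj_on \<gamma> ({0..1} \<inter> ball t \<epsilon>)" by (intro exI[of _ 1]) simp
  qed
  moreover have "continuous_map (top_of_set {0..1}) (subtopology Y (chart_dom c \<inter> chart_dom d)) \<gamma>"
    using \<gamma>c \<gamma>d by (auto simp: continuous_map_in_subtopology)
  moreover have "mono_on {0..1} (matchbox_proj \<circ> chart_map c \<circ> \<gamma>)"
  proof (rule mono_onI)
    fix u v :: real assume "u \<in> {0..1}" "v \<in> {0..1}" "u \<le> v"
    then show "(matchbox_proj \<circ> chart_map c \<circ> \<gamma>) u \<le> (matchbox_proj \<circ> chart_map c \<circ> \<gamma>) v"
      using ht[of u] ht[of v] t(1) by (simp add: chart_height_def)
  qed
  ultimately have "mono_on {0..1} (matchbox_proj \<circ> chart_map d \<circ> \<gamma>)"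
    using dir unfolding same_direction_def by blast
  then have mono: "chart_height d (\<gamma> u) \<le> chart_height d (\<gamma> v)" if "u \<in> {0..1}" "v \<in> {0..1}" "u \<le> v" for u v
    using mono_onD[of "{0..1}" "matchbox_proj \<circ> chart_map d \<circ> \<gamma>" u v] that by (simp add: chart_height_def)
  have ends: "\<gamma> 0 = chart_point c b s t1" "\<gamma> 1 = chart_point c b s t2" by (simp_all add: \<gamma>_def)
  show ?thesis
  proof (rule ccontr)
    assume "\<not> ?thesis"
    then have le: "chart_height d (\<gamma> 1) \<le> chart_height d (\<gamma> 0)" by (simp add: ends)
    define l where "l = chart_height d (\<gamma> 0)"
    \<comment> \<open>A nondecreasing function whose last value does not exceed its first is
      constant.\<close>
    have const: "chart_height d (\<gamma> u) = l" if "u \<in> {0..1}" for u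
      using mono[of 0 u] mono[of u 1] le that by (auto simp: l_def)
    let ?L = "{y \<in> chart_dom d. chart_height d y = l}"
    have "connectedin Y (\<gamma> ` {0..1})"
      by (rule connectedin_continuous_map_image[OF \<gamma>c]) (simp add: connectedin_subtopology)
    moreover have "\<gamma> ` {0..1} \<subseteq> ?L" using \<gamma>d const by blast
    ultimately have "connectedin (subtopology Y ?L) (\<gamma> ` {0..1})" by (simp add: connectedin_subtopology)
    moreover have "t1_space (subtopology Y ?L)"
      using D.Hausdorff_Y Hausdorff_imp_t1_space Hausdorff_space_subtopology by blast
    ultimately have "\<gamma> 0 = \<gamma> 1"
      by (intro connectedin_dim_le_0[OF D.level_dim[of l]]) auto
    then show False using inj_onD[OF inj, of 0 1] by simp
  qed
qed

theorem proposition2p11: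
  fixes Y :: "'a topology" and A \<Omega> :: "('a, 's) chart set"
  assumes "branched_matchbox_manifold Y A"
    and "compact_space Y" and "connected_space Y"
    and "orientation Y A \<Omega>"
  shows "\<exists>X V D f. directed_presentation X V D f Y"
proof -
  have Y: "metrizable_space Y" "separable_space Y"
    using assms(1) by (simp_all add: branched_matchbox_manifold_def)
  have H: "Hausdorff_space Y" using Y(1) by (rule metrizable_imp_Hausdorff_space)
  have \<Omega>: "\<Omega> \<subseteq> A" "covers \<Omega> Y" and dir: "\<And>c d. c \<in> \<Omega> \<Longrightarrow> d \<in> \<Omega> \<Longrightarrow> same_direction Y c d"
    using assms(4) by (auto simp: orientation_def oriented_cover_def)
  have ch: "matchbox_chart Y c" if "c \<in> \<Omega>" for c
    using assms(1) \<Omega>(1) H that by (auto simp: matchbox_chart_def branched_matchbox_manifold_def)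
  \<comment> \<open>The index set is \<open>\<Omega>\<close>: its charts cover \<open>Y\<close> and
    pairwise agree in direction, which \<open>chart_arc_increasing\<close> turns into
    \<open>orient\<close>.\<close>
  interpret oriented_charts Y \<Omega> chart_dom chart_height chart_side chart_point
  proof
    fix c assume c: "c \<in> \<Omega>"
    interpret matchbox_chart Y c by (rule ch[OF c])
    show "openin Y (chart_dom c)" by (rule dom_open)
    show "continuous_map (subtopology Y (chart_dom c)) euclideanreal (chart_height c)" by (rule continuous_height)
    show "-1 < chart_height c y \<and> chart_height c y < 1" if "y \<in> chart_dom c" for y
      using dom_cases[OF that] side_bounds by metis
    fix b
    show "compact_space (chart_side c b)" "Hausdorff_space (chart_side c b)"
      "second_countable (chart_side c b)" "chart_side c b dim_le 0" by (rule side_props)+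
    show "continuous_map (prod_topology (chart_side c b) (top_of_set (side b))) Y (\<lambda>(s, t). chart_point c b s t)"
      by (rule continuous_point_side)
    show "\<exists>s\<in>topspace (chart_side c b). y = chart_point c b s (chart_height c y)"
      if "y \<in> chart_dom c" "chart_height c y \<in> side b" for y
      using that by (rule point_onto)
    show "subtopology Y {y \<in> chart_dom c. chart_height c y = l} dim_le 0" for l by (rule level_dim)
    fix s t assume s: "s \<in> topspace (chart_side c b)"
    show "chart_height d (chart_point c b s t1) < chart_height d (chart_point c b s t2)"
      if "d \<in> \<Omega>" "t1 < t2" "{t1..t2} \<subseteq> side b" "\<forall>t\<in>{t1..t2}. chart_point c b s t \<in> chart_dom d" for d t1 t2
      by (rule chart_arc_increasing[OF ch[OF c] ch[OF that(1)] dir[OF c that(1)] s that(2-4)])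
    assume t: "t \<in> side b"
    show "chart_point c b s t \<in> chart_dom c" "chart_height c (chart_point c b s t) = t"
      by (rule point_in_dom[OF s t], rule height_point[OF s t])
    show "s = s'" if "s' \<in> topspace (chart_side c b)" "t \<noteq> 0" "chart_point c b s t = chart_point c b s' t" for s'
      using point_eq_iff[of b s t b s' t] that s t in_pre by auto
  qed (use assms(2) H Y \<Omega>(2) in \<open>auto simp: covers_def second_countable_metrizable\<close>)
  show ?thesis by (rule exists_directed_presentation)
qed

end
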